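(* Let $\Gamma$ be a $\mathbb Q$-tropical curve. Then the $\mathbb Q$-tropical Picard group $\mathrm{Pic}_{\mathbb Q}(\Gamma)$ is the direct limit of the critical groups of the subdivisions of $\Gamma$: $$\mathrm{Pic}_{\mathbb Q}(\Gamma)\;\cong\;\varinjlim_{k\ge1}K(G_k,v_0),$$ where the index set $\{k\ge 1\}$ is ordered by divisibility and, for $k_1\mid k_2$, the transition map $\psi_{k_1,k_2}:K(G_{k_1},v_0)\to K(G_{k_2},v_0)$ is given by extending configurations by $0$ on the new vertices.
   Context: A $\mathbb Q$-tropical curve ($\mathbb Q$-graph) is a compact connected metric graph $\Gamma$ having a model (a finite vertex set containing all points of valence $\neq2$) all of whose edges have rational length. $\Gamma_{\mathbb Q}$ is the set of points of $\Gamma$ whose distance from every vertex is rational. $\mathrm{Div}^0_{\mathbb Q}(\Gamma)$ is the group of degree-$0$ divisors (finite formal $\mathbb Z$-combinations) supported on $\Gamma_{\mathbb Q}$. $\mathrm{Prin}_{\mathbb Q}(\Gamma)$ is the subgroup of those of the form $(f)$ with $f$ a tropical rational function (continuous, piecewise linear with finitely many pieces and integer slopes), $(f)=\sum_x\mathrm{ord}_x(f)\cdot x$, $\mathrm{ord}_x(f)$ the sum of outgoing slopes at $x$. $\mathrm{Pic}_{\mathbb Q}(\Gamma)=\mathrm{Div}^0_{\mathbb Q}(\Gamma)/\mathrm{Prin}_{\mathbb Q}(\Gamma)$. Subdivisions: uniformly scale all edges of $\Gamma$ to obtain $\Gamma'$ with all edge lengths integers. $G_0$ is the coarsest finite graph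 structure on $\Gamma'$, with vertices the points of valence one or $\ge3$ (if $\Gamma$ is a circle, $G_0$ has a single vertex and a single loop edge). Fix a vertex $v_0$ of $G_0$. For $k\ge1$, $G_k$ is the finite graph obtained from $G_0$ by choosing more points of $\Gamma'$ as vertices so that all edges have length $1/k$; $v_0$ is a vertex of every $G_k$, and $V(G_{k_1})\subset V(G_{k_2})$ if $k_1\mid k_2$. Critical group: for a finite graph $G$ with vertices $v_0,\dots,v_{n-1}$, the Laplacian is $L(G)=\mathrm{diag}(\mathrm{val}(v_0),\dots,\mathrm{val}(v_{n-1}))-A(G)$, with $A(G)$ the adjacency matrix (entries are numbers of edges between vertices; loops do not contribute to $L(G)$), and $L_0(G)$ is $L(G)$ with the row and column of $v_0$ deleted. $K(G,v_0)=\mathbb Z^{n-1}/L_0(G)\mathbb Z^{n-1}$. Each class has a unique superstable representative: a degree-$0$ divisor $D$ on $V(G)$ with $D(v)\ge0$ for $v\ne v_0$ such that for no nonempty $A\subset V(G)\setminus\{v_0\}$ does simultaneously firing all vertices of $A$ (subtracting $\sum_{v\in A}L_v$, $L_v$ the column of $L(G)$ for $v$) leave all coefficients at vertices other than $v_0$ nonnegative. $\psi_{k_1,k_2}$ sends the superstable $D=\sum_{v\in V(G_{k_1})}D(v)v$ to the same divisor, with coefficient $0$ at vertices of $G_{k_2}$ not in $G_{k_1}$ (which is superstable on $G_{k_2}$, and $\psi_{k_1,k_2}$ is a group homomorphism). *)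

theory Defs
  imports "HOL-Analysis.Analysis" "HOL-Algebra.Free_Abelian_Groups"
begin

section \<open>Metric graphs\<close>

text \<open>
  A metric graph is a set \<open>\<Gamma>\<close> in a metric space, with the induced metric, which is required to be
  the path metric of \<open>\<Gamma>\<close>. In a star chart at \<open>x\<close> a neighbourhood of \<open>x\<close> is isometric to \<open>n\<close>
  segments of length \<open>r\<close> (\<open>n = 0\<close> is an isolated point) glued at \<open>x\<close>; \<open>leg i t\<close> is the point at
  distance \<open>t\<close> from \<open>x\<close> on the \<open>i\<close>-th segment.
\<close>

definition star_chart ::
  "'a::metric_space set \<Rightarrow> 'a \<Rightarrow> nat \<Rightarrow> real \<Rightarrow> (nat \<Rightarrow> real \<Rightarrow> 'a) \<Rightarrow> bool" where
  "star_chart \<Gamma> x n r leg \<longleftrightarrow>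
     r > 0 \<and> (\<forall>i<n. leg i 0 = x) \<and>
     ball x r \<inter> \<Gamma> = insert x (\<Union>i<n. leg i ` {0..<r}) \<and>
     (\<forall>i<n. \<forall>j<n. \<forall>s\<in>{0..<r}. \<forall>t\<in>{0..<r}.
        dist (leg i s) (leg j t) = (if i = j then \<bar>s - t\<bar> else s + t))"

definition has_valence :: "'a::metric_space set \<Rightarrow> 'a \<Rightarrow> nat \<Rightarrow> bool" where
  "has_valence \<Gamma> x n \<longleftrightarrow> (\<exists>r leg. star_chart \<Gamma> x n r leg)"

definition path_metric :: "'a::metric_space set \<Rightarrow> bool" where
  "path_metric \<Gamma> \<longleftrightarrow>
     (\<forall>x\<in>\<Gamma>. \<forall>y\<in>\<Gamma>. \<exists>\<gamma>. \<gamma> 0 = x \<and> \<gamma> (dist x y) = y \<and> \<gamma> ` {0..dist x y} \<subseteq> \<Gamma> \<and>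
        (\<forall>s\<in>{0..dist x y}. \<forall>t\<in>{0..dist x y}. dist (\<gamma> s) (\<gamma> t) = \<bar>s - t\<bar>))"

definition metric_graph :: "'a::metric_space set \<Rightarrow> bool" where
  "metric_graph \<Gamma> \<longleftrightarrow>
     \<Gamma> \<noteq> {} \<and> compact \<Gamma> \<and> connected \<Gamma> \<and> path_metric \<Gamma> \<and> (\<forall>x\<in>\<Gamma>. \<exists>n. has_valence \<Gamma> x n)"

text \<open>
  A model is given by its vertex set \<open>V\<close>; its (open) edges are the connected components of
  \<open>\<Gamma> - V\<close>. An edge \<open>C\<close> is parametrised by arc length by \<open>\<phi>\<close> on \<open>(0, l)\<close>. The parametrisation is
  only locally isometric, since the ends of a long edge can be close to each other in \<open>\<Gamma>\<close>.
\<close>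

definition graph_model :: "'a::metric_space set \<Rightarrow> 'a set \<Rightarrow> bool" where
  "graph_model \<Gamma> V \<longleftrightarrow> finite V \<and> V \<noteq> {} \<and> V \<subseteq> \<Gamma> \<and> {x\<in>\<Gamma>. \<not> has_valence \<Gamma> x 2} \<subseteq> V"

definition edge_chart :: "'a::metric_space set \<Rightarrow> real \<Rightarrow> (real \<Rightarrow> 'a) \<Rightarrow> bool" where
  "edge_chart C l \<phi> \<longleftrightarrow>
     l > 0 \<and> (\<exists>\<phi>'. homeomorphism {0<..<l} C \<phi> \<phi>') \<and>
     (\<forall>t\<in>{0<..<l}. \<exists>\<epsilon>>0. \<forall>s\<in>{0<..<l}. \<forall>s'\<in>{0<..<l}.
        \<bar>s - t\<bar> < \<epsilon> \<and> \<bar>s' - t\<bar> < \<epsilon> \<longrightarrow> dist (\<phi> s) (\<phi> s') = \<bar>s - s'\<bar>)"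

definition has_edge_length :: "'a::metric_space set \<Rightarrow> real \<Rightarrow> bool" where
  "has_edge_length C l \<longleftrightarrow> (\<exists>\<phi>. edge_chart C l \<phi>)"

text \<open>
  The model \<open>V\<close> is part of the data: if \<open>\<Gamma>\<close> is a circle, the set of rational points depends on it.
\<close>

definition Q_tropical_curve :: "'a::metric_space set \<Rightarrow> 'a set \<Rightarrow> bool" where
  "Q_tropical_curve \<Gamma> V \<longleftrightarrow>
     metric_graph \<Gamma> \<and> graph_model \<Gamma> V \<and> (\<forall>C\<in>components (\<Gamma> - V). \<exists>l\<in>\<rat>. has_edge_length C l)"

definition rational_points :: "'a::metric_space set \<Rightarrow> 'a set \<Rightarrow> 'a set" where
  "rational_points \<Gamma> V = {x\<in>\<Gamma>. \<forall>v\<in>V. dist x v \<in> \<rat>}"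


section \<open>Tropical rational functions and the Picard group\<close>

definition tropical_rational :: "'a::metric_space set \<Rightarrow> ('a \<Rightarrow> real) \<Rightarrow> bool" where
  "tropical_rational \<Gamma> f \<longleftrightarrow>
     continuous_on \<Gamma> f \<and>
     (\<exists>W. graph_model \<Gamma> W \<and>
        (\<forall>C\<in>components (\<Gamma> - W). \<exists>l \<phi> a. \<exists>s::int.
           edge_chart C l \<phi> \<and> (\<forall>t\<in>{0<..<l}. f (\<phi> t) = a + of_int s * t)))"

text \<open>\<open>s i\<close> is the outgoing slope of \<open>f\<close> at \<open>x\<close> along the \<open>i\<close>-th leg.\<close>

definition has_ord :: "'a::metric_space set \<Rightarrow> ('a \<Rightarrow> real) \<Rightarrow> 'a \<Rightarrow> int \<Rightarrow> bool" where
  "has_ord \<Gamma> f x m \<longleftrightarrow>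
     (\<exists>n r leg. \<exists>s :: nat \<Rightarrow> int. star_chart \<Gamma> x n r leg \<and>
        (\<forall>i<n. \<forall>\<^sub>F t in at_right 0. f (leg i t) = f x + of_int (s i) * t) \<and>
        m = (\<Sum>i<n. s i))"

definition Div0 :: "'a set \<Rightarrow> ('a \<Rightarrow>\<^sub>0 int) monoid" where
  "Div0 S = (free_Abelian_group S)
     \<lparr>carrier := {D \<in> carrier (free_Abelian_group S).
                   (\<Sum>x\<in>Poly_Mapping.keys D. Poly_Mapping.lookup D x) = 0}\<rparr>"

definition Prin_Q :: "'a::metric_space set \<Rightarrow> 'a set \<Rightarrow> ('a \<Rightarrow>\<^sub>0 int) set" where
  "Prin_Q \<Gamma> V =
     {D \<in> carrier (Div0 (rational_points \<Gamma> V)).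
        \<exists>f. tropical_rational \<Gamma> f \<and> (\<forall>x\<in>\<Gamma>. has_ord \<Gamma> f x (Poly_Mapping.lookup D x))}"

definition Pic_Q :: "'a::metric_space set \<Rightarrow> 'a set \<Rightarrow> ('a \<Rightarrow>\<^sub>0 int) set monoid" where
  "Pic_Q \<Gamma> V = Div0 (rational_points \<Gamma> V) Mod Prin_Q \<Gamma> V"


section \<open>Critical groups of finite graphs\<close>

text \<open>
  Multigraphs with loops; \<open>ends e\<close> has two elements for a proper edge and one for a loop. Loops are
  left out of both \<open>adjacency\<close> and \<open>val\<close>, as they do not contribute to the Laplacian.
\<close>

record ('v, 'e) multigraph =
  verts :: "'v set"
  edges :: "'e set"
  ends :: "'e \<Rightarrow> 'v set"

definition adjacency :: "('v, 'e) multigraph \<Rightarrow> 'v \<Rightarrow> 'v \<Rightarrow> nat" where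
  "adjacency G v w = (if v = w then 0 else card {e \<in> edges G. ends G e = {v, w}})"

definition val :: "('v, 'e) multigraph \<Rightarrow> 'v \<Rightarrow> nat" where
  "val G v = card {e \<in> edges G. v \<in> ends G e \<and> card (ends G e) = 2}"

definition laplacian :: "('v, 'e) multigraph \<Rightarrow> 'v \<Rightarrow> 'v \<Rightarrow> int" where
  "laplacian G v w = (if v = w then int (val G v) else 0) - int (adjacency G v w)"

text \<open>
  The group \<open>\<int>\<^sup>n\<^sup>-\<^sup>1\<close> of column vectors is the free abelian group on the vertices other than \<open>v0\<close>.
\<close>

definition config_group :: "('v, 'e) multigraph \<Rightarrow> 'v \<Rightarrow> ('v \<Rightarrow>\<^sub>0 int) monoid" where
  "config_group G v0 = free_Abelian_group (verts G - {v0})"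

definition laplacian_lattice :: "('v, 'e) multigraph \<Rightarrow> 'v \<Rightarrow> ('v \<Rightarrow>\<^sub>0 int) set" where
  "laplacian_lattice G v0 =
     {x \<in> carrier (config_group G v0). \<exists>z \<in> carrier (config_group G v0).
        \<forall>v \<in> verts G - {v0}. Poly_Mapping.lookup x v =
          (\<Sum>w \<in> verts G - {v0}. laplacian G v w * Poly_Mapping.lookup z w)}"

definition critical_group :: "('v, 'e) multigraph \<Rightarrow> 'v \<Rightarrow> ('v \<Rightarrow>\<^sub>0 int) set monoid" where
  "critical_group G v0 = config_group G v0 Mod laplacian_lattice G v0"

definition superstable :: "('v, 'e) multigraph \<Rightarrow> 'v \<Rightarrow> ('v \<Rightarrow>\<^sub>0 int) \<Rightarrow> bool" where
  "superstable G v0 D \<longleftrightarrow>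
     D \<in> carrier (Div0 (verts G)) \<and>
     (\<forall>v \<in> verts G - {v0}. Poly_Mapping.lookup D v \<ge> 0) \<and>
     \<not> (\<exists>A. A \<noteq> {} \<and> A \<subseteq> verts G - {v0} \<and>
          (\<forall>v \<in> verts G - {v0}. Poly_Mapping.lookup D v - (\<Sum>w\<in>A. laplacian G v w) \<ge> 0))"

text \<open>The class of a degree-0 divisor, obtained by deleting its coefficient at \<open>v0\<close>.\<close>

definition divisor_class ::
  "('v, 'e) multigraph \<Rightarrow> 'v \<Rightarrow> ('v \<Rightarrow>\<^sub>0 int) \<Rightarrow> ('v \<Rightarrow>\<^sub>0 int) set" where
  "divisor_class G v0 D =
     laplacian_lattice G v0 #>\<^bsub>config_group G v0\<^esub> Poly_Mapping.update v0 0 D"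

text \<open>
  For \<open>verts G \<subseteq> verts H\<close>. Divisors on \<open>G\<close> and on \<open>H\<close> are finitely supported functions on the same
  type, so extending a divisor by 0 on the new vertices leaves it unchanged.
\<close>

definition extension_map ::
  "('v, 'e) multigraph \<Rightarrow> ('v, 'e) multigraph \<Rightarrow> 'v \<Rightarrow> ('v \<Rightarrow>\<^sub>0 int) set \<Rightarrow> ('v \<Rightarrow>\<^sub>0 int) set" where
  "extension_map G H v0 c =
     divisor_class H v0 (THE D. superstable G v0 D \<and> divisor_class G v0 D = c)"


section \<open>Subdivisions\<close>

definition model_graph :: "'a::metric_space set \<Rightarrow> 'a set \<Rightarrow> ('a, 'a set) multigraph" where
  "model_graph \<Gamma> W = \<lparr>verts = W, edges = components (\<Gamma> - W), ends = (\<lambda>C. closure C \<inter> W)\<rparr>"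

text \<open>
  For the vertices of the coarsest graph structure, the second case is that of a circle. On a
  one-point graph, the only point (of valence 0) is a vertex.
\<close>

definition coarsest_vertices :: "'a::metric_space set \<Rightarrow> 'a set \<Rightarrow> 'a set \<Rightarrow> bool" where
  "coarsest_vertices \<Gamma> V V0 \<longleftrightarrow>
     (if \<exists>x\<in>\<Gamma>. \<not> has_valence \<Gamma> x 2 then V0 = {x\<in>\<Gamma>. \<not> has_valence \<Gamma> x 2}
      else \<exists>v\<in>rational_points \<Gamma> V. V0 = {v})"

text \<open>
  The rescaled curve \<open>\<Gamma>'\<close> is \<open>\<Gamma>\<close> with its metric multiplied by \<open>c\<close>, so that an edge of length \<open>l\<close> in
  \<open>\<Gamma>\<close> has length \<open>c * l\<close> in \<open>\<Gamma>'\<close>.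
\<close>

definition integral_scaling :: "'a::metric_space set \<Rightarrow> 'a set \<Rightarrow> real \<Rightarrow> bool" where
  "integral_scaling \<Gamma> V0 c \<longleftrightarrow>
     c > 0 \<and> (\<forall>C\<in>components (\<Gamma> - V0). \<exists>l. has_edge_length C l \<and> c * l \<in> \<int>)"

definition subdivision_vertices ::
  "'a::metric_space set \<Rightarrow> 'a set \<Rightarrow> real \<Rightarrow> nat \<Rightarrow> 'a set \<Rightarrow> bool" where
  "subdivision_vertices \<Gamma> V0 c k W \<longleftrightarrow>
     graph_model \<Gamma> W \<and> V0 \<subseteq> W \<and>
     (\<forall>C\<in>components (\<Gamma> - W). \<exists>l. has_edge_length C l \<and> c * l = 1 / real k)"


section \<open>Direct limits\<close>

text \<open>
  The direct limit of groups \<open>G i\<close> over a directed index set \<open>(I, ord_rel)\<close> with transition maps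
  \<open>\<psi> i j\<close>: the disjoint union of the carriers, modulo becoming equal at a later index.
\<close>

definition limit_rel ::
  "'i set \<Rightarrow> ('i \<Rightarrow> 'i \<Rightarrow> bool) \<Rightarrow> ('i \<Rightarrow> 'g monoid) \<Rightarrow> ('i \<Rightarrow> 'i \<Rightarrow> 'g \<Rightarrow> 'g) \<Rightarrow> ('i \<times> 'g) rel" where
  "limit_rel I ord_rel G \<psi> =
     {((i, x), (j, y)). i \<in> I \<and> j \<in> I \<and> x \<in> carrier (G i) \<and> y \<in> carrier (G j) \<and>
        (\<exists>m\<in>I. ord_rel i m \<and> ord_rel j m \<and> \<psi> i m x = \<psi> j m y)}"

definition direct_limit ::
  "'i set \<Rightarrow> ('i \<Rightarrow> 'i \<Rightarrow> bool) \<Rightarrow> ('i \<Rightarrow> 'g monoid) \<Rightarrow> ('i \<Rightarrow> 'i \<Rightarrow> 'g \<Rightarrow> 'g) \<Rightarrow> ('i \<times> 'g) set monoid"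
  where
  "direct_limit I ord_rel G \<psi> =
     \<lparr>carrier = (SIGMA i:I. carrier (G i)) // limit_rel I ord_rel G \<psi>,
      mult = (\<lambda>P Q. \<Union>(i, x)\<in>P. \<Union>(j, y)\<in>Q. \<Union>m\<in>{m\<in>I. ord_rel i m \<and> ord_rel j m}.
                limit_rel I ord_rel G \<psi> `` {(m, \<psi> i m x \<otimes>\<^bsub>G m\<^esub> \<psi> j m y)}),
      one = (\<Union>i\<in>I. limit_rel I ord_rel G \<psi> `` {(i, \<one>\<^bsub>G i\<^esub>)})\<rparr>"

end

theory Submission
  imports Defs
begin

text \<open>
  Let \<open>D\<close> be a degree-0 divisor supported on the vertices of \<open>G\<^sub>k\<close>. If \<open>D = (f)\<close>, then \<open>f\<close> is
  affine with integral slope on each edge of \<open>G\<^sub>k\<close>, so its values at the vertices are, up to a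
  constant, integral multiples of the edge length, and \<open>D\<close> is up to sign the image of these
  multiples under the Laplacian; conversely such multiples interpolate to a tropical rational
  function. Hence each critical group embeds into the Picard group. The transition maps are
  compatible with these embeddings, because each class has a superstable representative, which they
  do not move. The embeddings are jointly surjective: along an edge of the coarsest graph structure
  the rational points are the rational positions, while the vertices of \<open>G\<^sub>k\<close> are the multiples of
  \<open>1 / (c * k)\<close>, and \<open>c\<close> is rational.
\<close>

text \<open>The obstacle is that the data are tied together only through the metric: star charts,
  edge charts, geodesics and the subdivisions \<open>W k\<close> are unrelated existence statements,
  and an edge chart is isometric only locally. Two comparisons bridge this. The legs of a star at a
  vertex are matched with the half-edges leaving it, so that orders become sums over half-edges and
  thereby rows of the Laplacian. Positions are compared along locally isometric paths: a geodesic,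
  or an edge of the coarsest structure, may cross many edges of another model. Instead of following
  it edge by edge, one fixes a dense group \<open>H\<close> of reals containing the edge lengths,
  calls a point a lattice point if its position on its edge lies in \<open>H\<close>, and propagates
  this property by small steps from \<open>H\<close>. The rationals yield the rational points. The
  vertices of \<open>W k\<close> belong to a discrete group, and are caught as the common lattice
  points for two dense groups. The same comparison shows that the sets \<open>W k\<close>, of which
  little but the edge lengths is prescribed, are nested. On the algebraic side all levels are
  compared through principality on \<open>\<Gamma>\<close>, a condition that does not mention
  \<open>k\<close>.\<close>

section \<open>Paths and stars in metric graphs\<close>

text \<open>Maximum principle: the difference with a chord attains its maximum at the ends.\<close>

lemma locally_symmetric_le_chord:
  fixes h :: "real \<Rightarrow> real"
  assumes ab: "a < b" and cont: "continuous_on {a..b} h"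
    and sym: "\<And>u. u \<in> {a<..<b} \<Longrightarrow> \<forall>\<^sub>F s in at_right 0. h (u + s) + h (u - s) = 2 * h u"
    and t: "t \<in> {a..b}"
  shows "(b - a) * h t \<le> (b - t) * h a + (t - a) * h b"
proof -
  define k where "k t = (b - a) * h t - ((b - t) * h a + (t - a) * h b)" for t
  have kcont: "continuous_on {a..b} k"
    unfolding k_def by (intro continuous_intros cont)
  obtain m where m: "m \<in> {a..b}" "\<And>x. x \<in> {a..b} \<Longrightarrow> k x \<le> k m"
    using continuous_attains_sup[of "{a..b}" k] kcont ab by auto
  \<comment> \<open>The last maximiser \<open>u\<close> of \<open>k\<close>: if it were interior,
    \<open>k (u + s) + k (u - s) = 2 * k u\<close> with both terms at most the maximum would make
    \<open>u + s\<close> a later maximiser.\<close>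
  define S where "S = {x \<in> {a..b}. k x = k m}"
  have "closed S" unfolding S_def
    by (rule continuous_closed_preimage_constant[OF kcont]) simp
  then have "compact ({a..b} \<inter> S)" by (intro compact_Int_closed) auto
  moreover have "{a..b} \<inter> S = S" by (auto simp: S_def)
  ultimately have "compact S" by simp
  then obtain u where u: "u \<in> S" "\<And>x. x \<in> S \<Longrightarrow> x \<le> u"
    using compact_attains_sup[of S] m(1) by (auto simp: S_def)
  have "k m \<le> 0"
  proof (rule ccontr)
    assume pos: "\<not> k m \<le> 0"
    have "k a = 0" "k b = 0" by (simp_all add: k_def)
    then have uab: "u \<in> {a<..<b}" using u(1) pos unfolding S_def by (cases "u = a"; cases "u = b") auto
    have "\<forall>\<^sub>F s in at_right 0. s \<in> {0<..<min (u - a) (b - u)}"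
      by (rule eventually_at_right_real) (use uab in auto)
    with sym[OF uab] have "\<forall>\<^sub>F s in at_right 0. h (u + s) + h (u - s) = 2 * h u \<and> s \<in> {0<..<min (u - a) (b - u)}"
      by eventually_elim simp
    then obtain s where s: "h (u + s) + h (u - s) = 2 * h u" "s \<in> {0<..<min (u - a) (b - u)}"
      using eventually_happens'[OF trivial_limit_at_right_real] by blast
    have "k (u + s) + k (u - s) = (b - a) * (h (u + s) + h (u - s)) - 2 * ((b - u) * h a + (u - a) * h b)"
      unfolding k_def by (simp add: algebra_simps)
    also have "\<dots> = 2 * k u" unfolding s(1) k_def by (simp add: algebra_simps)
    finally have sum: "k (u + s) + k (u - s) = 2 * k u" .
    have "k (u + s) \<le> k m" "k (u - s) \<le> k m" using m(2) s(2) uab by auto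
    moreover have "k (u + s) \<noteq> k m" using u(2)[of "u + s"] s(2) uab by (auto simp: S_def)
    moreover have "k u = k m" using u(1) by (simp add: S_def)
    ultimately show False using sum by linarith
  qed
  then show ?thesis using m(2)[OF t] unfolding k_def by linarith
qed

text \<open>The chord bound for \<open>h\<close> and for \<open>- h\<close> makes \<open>h\<close>
  affine on every compact subinterval. Two fixed points \<open>a < b\<close> then determine the
  line, and a point outside \<open>{a..b}\<close> is reached by using it as an end of the
  chord.\<close>

lemma locally_symmetric_imp_affine:
  fixes h :: "real \<Rightarrow> real"
  assumes pq: "p < q" and cont: "continuous_on {p<..<q} h"
    and sym: "\<And>u. u \<in> {p<..<q} \<Longrightarrow> \<forall>\<^sub>F s in at_right 0. h (u + s) + h (u - s) = 2 * h u"
  shows "\<exists>\<alpha> \<sigma>. \<forall>t\<in>{p<..<q}. h t = \<alpha> + \<sigma> * t"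
proof -
  have chord: "(b - a) * h t = (b - t) * h a + (t - a) * h b"
    if ab: "a < b" "a \<in> {p<..<q}" "b \<in> {p<..<q}" and t: "t \<in> {a..b}" for a b t
  proof (rule antisym)
    have c: "continuous_on {a..b} h" by (rule continuous_on_subset[OF cont]) (use ab in auto)
    have s: "\<forall>\<^sub>F s in at_right 0. h (u + s) + h (u - s) = 2 * h u" if "u \<in> {a<..<b}" for u
      using sym[of u] that ab by auto
    show "(b - a) * h t \<le> (b - t) * h a + (t - a) * h b"
      by (rule locally_symmetric_le_chord[OF ab(1) c s t])
    have "(b - a) * (- h t) \<le> (b - t) * (- h a) + (t - a) * (- h b)"
    proof (rule locally_symmetric_le_chord[OF ab(1) _ _ t])
      show "continuous_on {a..b} (\<lambda>x. - h x)" by (intro continuous_intros c)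
      show "\<forall>\<^sub>F s in at_right 0. - h (u + s) + - h (u - s) = 2 * - h u" if "u \<in> {a<..<b}" for u
        using s[OF that] by eventually_elim linarith
    qed
    then show "(b - t) * h a + (t - a) * h b \<le> (b - a) * h t" by linarith
  qed
  \<comment> \<open>Inner points at the thirds, since nothing is assumed about \<open>h\<close> at
    \<open>p\<close> and \<open>q\<close>.\<close>
  define a b where "a = (2 * p + q) / 3" and "b = (p + 2 * q) / 3"
  have ab: "a < b" "a \<in> {p<..<q}" "b \<in> {p<..<q}" using pq by (auto simp: a_def b_def field_simps)
  have line: "(b - a) * h t = (b - t) * h a + (t - a) * h b" if t: "t \<in> {p<..<q}" for t
  proof -
    consider "t < a" | "t \<in> {a..b}" | "b < t" by fastforce
    then show ?thesis
    proof cases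
      case 1
      show ?thesis using chord[of t b a] 1 ab t by (simp add: algebra_simps)
    next
      case 2
      then show ?thesis using chord ab by blast
    next
      case 3
      show ?thesis using chord[of a t b] 3 ab t by (simp add: algebra_simps)
    qed
  qed
  have "h t = (b * h a - a * h b) / (b - a) + (h b - h a) / (b - a) * t" if "t \<in> {p<..<q}" for t
    using line[OF that] ab(1) by (simp add: divide_simps) (simp add: algebra_simps)
  then show ?thesis by blast
qed

lemma isometric_imp_continuous_on:
  fixes g :: "real \<Rightarrow> 'a::metric_space"
  assumes "\<And>s t. s \<in> S \<Longrightarrow> t \<in> S \<Longrightarrow> dist (g s) (g t) = \<bar>s - t\<bar>"
  shows "continuous_on S g"
  unfolding continuous_on_iff using assms by (metis dist_real_def)

text \<open>The values \<open>u (t0 + s)\<close> and \<open>u (t0 - s)\<close> lie at distance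
  \<open>s\<close> from \<open>u t0\<close> and at distance \<open>2 * s\<close> from each other,
  hence on opposite sides of it. So \<open>u\<close> is locally symmetric, therefore affine, and its
  slope has absolute value 1.\<close>

lemma local_isometry_imp_affine:
  fixes u :: "real \<Rightarrow> real"
  assumes pq: "p < q" and cont: "continuous_on {p<..<q} u"
    and loc: "\<And>t0. t0 \<in> {p<..<q} \<Longrightarrow> \<exists>\<epsilon>>0. \<forall>s\<in>{p<..<q}. \<forall>t\<in>{p<..<q}.
      \<bar>s - t0\<bar> < \<epsilon> \<and> \<bar>t - t0\<bar> < \<epsilon> \<longrightarrow> \<bar>u s - u t\<bar> = \<bar>s - t\<bar>"
  shows "\<exists>\<alpha>. (\<forall>t\<in>{p<..<q}. u t = \<alpha> + t) \<or> (\<forall>t\<in>{p<..<q}. u t = \<alpha> - t)"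
proof -
  have "\<forall>\<^sub>F s in at_right 0. u (t0 + s) + u (t0 - s) = 2 * u t0" if t0: "t0 \<in> {p<..<q}" for t0
  proof -
    obtain \<epsilon> where \<epsilon>: "\<epsilon> > 0" "\<And>s t. s \<in> {p<..<q} \<Longrightarrow> t \<in> {p<..<q} \<Longrightarrow> \<bar>s - t0\<bar> < \<epsilon> \<Longrightarrow>
      \<bar>t - t0\<bar> < \<epsilon> \<Longrightarrow> \<bar>u s - u t\<bar> = \<bar>s - t\<bar>" using loc[OF t0] by blast
    have "\<forall>\<^sub>F s in at_right 0. s \<in> {0<..<Min {\<epsilon>, t0 - p, q - t0}}"
      by (rule eventually_at_right_real) (use t0 \<epsilon>(1) in auto)
    then show ?thesis
    proof eventually_elim
      case (elim s)
      have "\<bar>u (t0 + s) - u t0\<bar> = s" "\<bar>u (t0 - s) - u t0\<bar> = s" "\<bar>u (t0 + s) - u (t0 - s)\<bar> = 2 * s"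
        using \<epsilon>(2)[of "t0 + s" t0] \<epsilon>(2)[of "t0 - s" t0] \<epsilon>(2)[of "t0 + s" "t0 - s"] elim t0 \<epsilon>(1) by auto
      then show ?case using elim by (auto simp: abs_if split: if_splits)
    qed
  qed
  then obtain \<alpha> \<sigma> where aff: "\<forall>t\<in>{p<..<q}. u t = \<alpha> + \<sigma> * t"
    using locally_symmetric_imp_affine[OF pq cont] by blast
  define m where "m = (p + q) / 2"
  have m: "m \<in> {p<..<q}" using pq by (simp add: m_def field_simps)
  obtain \<epsilon> where \<epsilon>: "\<epsilon> > 0" "\<And>s t. s \<in> {p<..<q} \<Longrightarrow> t \<in> {p<..<q} \<Longrightarrow> \<bar>s - m\<bar> < \<epsilon> \<Longrightarrow>
      \<bar>t - m\<bar> < \<epsilon> \<Longrightarrow> \<bar>u s - u t\<bar> = \<bar>s - t\<bar>" using loc[OF m] by blast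
  define s where "s = min (\<epsilon> / 2) ((q - m) / 2)"
  have s: "s > 0" "s < \<epsilon>" "m + s \<in> {p<..<q}" using \<epsilon>(1) m by (auto simp: s_def min_def field_simps)
  have "\<bar>u (m + s) - u m\<bar> = s" using \<epsilon>(2)[of "m + s" m] s m \<epsilon>(1) by auto
  moreover have "u (m + s) - u m = \<sigma> * s" using aff m s by (simp add: algebra_simps)
  ultimately have "\<bar>\<sigma>\<bar> = 1" using s(1) by (simp add: abs_mult)
  then consider "\<sigma> = 1" | "\<sigma> = -1" by linarith
  then show ?thesis
  proof cases
    case 1
    then show ?thesis using aff by (intro exI[of _ \<alpha>] disjI1) simp
  next
    case 2
    then show ?thesis using aff by (intro exI[of _ \<alpha>] disjI2) simp
  qed
qed

text \<open>\<open>star_chart\<close> with an arbitrary finite index set in place of an initial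
  segment of the naturals, so that legs can be indexed by the half-edges leaving a vertex or, at an
  interior point of an edge, by the two directions.\<close>

definition star_at ::
  "'a::metric_space set \<Rightarrow> 'a \<Rightarrow> 'i set \<Rightarrow> real \<Rightarrow> ('i \<Rightarrow> real \<Rightarrow> 'a) \<Rightarrow> bool" where
  "star_at \<Gamma> x I r p \<longleftrightarrow>
     r > 0 \<and> finite I \<and> (\<forall>i\<in>I. p i 0 = x) \<and>
     ball x r \<inter> \<Gamma> = insert x (\<Union>i\<in>I. p i ` {0..<r}) \<and>
     (\<forall>i\<in>I. \<forall>j\<in>I. \<forall>s\<in>{0..<r}. \<forall>t\<in>{0..<r}.
        dist (p i s) (p j t) = (if i = j then \<bar>s - t\<bar> else s + t))"

lemma star_chart_iff_star_at: "star_chart \<Gamma> x n r leg \<longleftrightarrow> star_at \<Gamma> x {..<n} r leg"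
  by (simp add: star_chart_def star_at_def Ball_def)

lemma star_at_D:
  assumes "star_at \<Gamma> x I r p"
  shows "r > 0" "finite I" "\<And>i. i \<in> I \<Longrightarrow> p i 0 = x"
    "ball x r \<inter> \<Gamma> = insert x (\<Union>i\<in>I. p i ` {0..<r})"
    "\<And>i s t. i \<in> I \<Longrightarrow> s \<in> {0..<r} \<Longrightarrow> t \<in> {0..<r} \<Longrightarrow> dist (p i s) (p i t) = \<bar>s - t\<bar>"
    "\<And>i j s t. i \<in> I \<Longrightarrow> j \<in> I \<Longrightarrow> i \<noteq> j \<Longrightarrow> s \<in> {0..<r} \<Longrightarrow> t \<in> {0..<r} \<Longrightarrow> dist (p i s) (p j t) = s + t"
  using assms unfolding star_at_def by (blast, blast, blast, blast, simp, simp)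

lemma star_at_dist:
  assumes "star_at \<Gamma> x I r p" "i \<in> I" "t \<in> {0..<r}"
  shows "dist x (p i t) = t" "p i t \<in> \<Gamma>"
proof -
  show "dist x (p i t) = t"
    using star_at_D(5)[OF assms(1,2), of 0 t] star_at_D(3)[OF assms(1,2)] assms(3) by simp
  have "p i t \<in> ball x r \<inter> \<Gamma>" using star_at_D(4)[OF assms(1)] assms(2,3) by blast
  then show "p i t \<in> \<Gamma>" by simp
qed

lemma star_at_cases:
  assumes "star_at \<Gamma> x I r p" "y \<in> \<Gamma>" "dist x y < r" "y \<noteq> x"
  obtains i where "i \<in> I" "y = p i (dist x y)" 
proof -
  have "y \<in> ball x r \<inter> \<Gamma>" using assms by simp
  then obtain i t where it: "i \<in> I" "t \<in> {0..<r}" "y = p i t" using star_at_D(4)[OF assms(1)] assms(4) by auto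
  then show thesis using that[OF it(1)] star_at_dist(1)[OF assms(1) it(1,2)] by simp
qed

lemma star_at_mono:
  assumes "star_at \<Gamma> x I r p" "0 < r'" "r' \<le> r"
  shows "star_at \<Gamma> x I r' p"
proof -
  have "ball x r' \<inter> \<Gamma> = insert x (\<Union>i\<in>I. p i ` {0..<r'})"
  proof (intro subset_antisym subsetI)
    fix y assume y: "y \<in> ball x r' \<inter> \<Gamma>"
    show "y \<in> insert x (\<Union>i\<in>I. p i ` {0..<r'})"
    proof (cases "y = x")
      case False
      have "y \<in> \<Gamma>" "dist x y < r" using y assms(3) by auto
      from star_at_cases[OF assms(1) this False] obtain i where i: "i \<in> I" "y = p i (dist x y)" .
      have "y \<in> p i ` {0..<r'}" by (rule image_eqI[of _ _ "dist x y"]) (use y i(2) in auto)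
      then show ?thesis using i(1) by blast
    qed simp
  next
    fix y assume "y \<in> insert x (\<Union>i\<in>I. p i ` {0..<r'})"
    moreover have "x \<in> \<Gamma>" using star_at_D(4)[OF assms(1)] by blast
    ultimately show "y \<in> ball x r' \<inter> \<Gamma>" using star_at_dist[OF assms(1)] assms(2,3) by auto
  qed
  then show ?thesis using assms unfolding star_at_def by auto
qed

text \<open>Each leg meets a small sphere once, and distinct legs meet it in distinct points. The
  sphere does not depend on the chart, which makes sums over legs comparable between charts.\<close>

lemma star_at_sphere:
  assumes "star_at \<Gamma> x I r p" "0 < t" "t < r"
  shows "bij_betw (\<lambda>i. p i t) I {y\<in>\<Gamma>. dist x y = t}"
proof (rule bij_betw_imageI)
  show "inj_on (\<lambda>i. p i t) I"
  proof (rule inj_onI, rule ccontr)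
    fix i j assume "i \<in> I" "j \<in> I" "p i t = p j t" "i \<noteq> j"
    then show False using star_at_D(6)[OF assms(1), of i j t t] assms(2,3) by simp
  qed
  show "(\<lambda>i. p i t) ` I = {y\<in>\<Gamma>. dist x y = t}"
  proof (intro subset_antisym subsetI)
    fix y assume "y \<in> {y\<in>\<Gamma>. dist x y = t}"
    then have y: "y \<in> \<Gamma>" "dist x y = t" by auto
    have "y \<noteq> x" "dist x y < r" using y assms(2,3) by auto
    from star_at_cases[OF assms(1) y(1) this(2,1)] obtain i where "i \<in> I" "y = p i (dist x y)" .
    then show "y \<in> (\<lambda>i. p i t) ` I" unfolding y(2) by blast
  qed (use star_at_dist[OF assms(1)] assms(2,3) in auto)
qed

lemma star_at_obtain_chart:
  assumes "star_at \<Gamma> x I r p"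
  obtains b where "bij_betw b {..<card I} I" "star_chart \<Gamma> x (card I) r (\<lambda>k. p (b k))"
proof -
  obtain b where b: "bij_betw b {..<card I} I"
    using ex_bij_betw_nat_finite[OF star_at_D(2)[OF assms]] by (auto simp: atLeast0LessThan)
  have bI: "b ` {..<card I} = I" and inj: "inj_on b {..<card I}" using b by (auto simp: bij_betw_def)
  have "(\<Union>i\<in>I. p i ` {0..<r}) = (\<Union>k\<in>{..<card I}. p (b k) ` {0..<r})"
    by (subst bI[symmetric]) (simp add: image_image)
  moreover have "b k = b k' \<longleftrightarrow> k = k'" if "k < card I" "k' < card I" for k k'
    using inj that by (auto simp: inj_on_def)
  moreover have "b k \<in> I" if "k < card I" for k using bI that by blast
  ultimately have "star_chart \<Gamma> x (card I) r (\<lambda>k. p (b k))"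
    using assms unfolding star_chart_def star_at_def by simp
  with b show thesis by (rule that)
qed

lemma has_ord_star_at:
  assumes star: "star_at \<Gamma> x I r p"
    and lin: "\<And>i. i \<in> I \<Longrightarrow> \<forall>\<^sub>F t in at_right 0. f (p i t) = f x + of_int (s i) * t"
  shows "has_ord \<Gamma> f x (\<Sum>i\<in>I. s i)"
proof -
  obtain b where b: "bij_betw b {..<card I} I" "star_chart \<Gamma> x (card I) r (\<lambda>k. p (b k))"
    using star_at_obtain_chart[OF star] by blast
  have "b k \<in> I" if "k < card I" for k using b(1) that by (auto simp: bij_betw_def)
  moreover have "(\<Sum>i\<in>I. s i) = (\<Sum>k<card I. s (b k))"
    by (rule sum.reindex_bij_betw[OF b(1), symmetric])
  ultimately show ?thesis
    unfolding has_ord_def using b(2) lin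
    by (intro exI[of _ "card I"] exI[of _ r] exI[of _ "\<lambda>k. p (b k)"] exI[of _ "\<lambda>k. s (b k)"]) simp
qed

text \<open>Summing \<open>f y - f x\<close> over small spheres expresses \<open>has_ord\<close> without reference to a chart.\<close>

lemma has_ord_sphere:
  assumes "has_ord \<Gamma> f x m"
  obtains \<epsilon> B where "\<epsilon> > 0"
    "\<And>t. t \<in> {0<..<\<epsilon>} \<Longrightarrow> (\<Sum>y\<in>{y\<in>\<Gamma>. dist x y = t}. f y - f x) = of_int m * t"
    "\<And>t y. t \<in> {0<..<\<epsilon>} \<Longrightarrow> y \<in> \<Gamma> \<Longrightarrow> dist x y = t \<Longrightarrow> \<exists>s::int. f y - f x = of_int s * t"
    "\<And>y. y \<in> \<Gamma> \<Longrightarrow> dist x y < \<epsilon> \<Longrightarrow> \<bar>f y - f x\<bar> \<le> B * dist x y"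
proof -
  obtain n r leg and s :: "nat \<Rightarrow> int" where star: "star_chart \<Gamma> x n r leg"
    and lin: "\<forall>i<n. \<forall>\<^sub>F t in at_right 0. f (leg i t) = f x + of_int (s i) * t" and m: "m = (\<Sum>i<n. s i)"
    using assms unfolding has_ord_def by blast
  have star: "star_at \<Gamma> x {..<n} r leg" using star by (simp add: star_chart_iff_star_at)
  have "\<forall>\<^sub>F t in at_right 0. \<forall>i\<in>{..<n}. f (leg i t) = f x + of_int (s i) * t"
    using lin by (intro eventually_ball_finite) auto
  then obtain \<epsilon>0 where \<epsilon>0: "\<epsilon>0 > 0" "\<And>i t. i < n \<Longrightarrow> t \<in> {0<..<\<epsilon>0} \<Longrightarrow> f (leg i t) = f x + of_int (s i) * t"
    unfolding eventually_at_right_field by auto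
  define \<epsilon> where "\<epsilon> = min \<epsilon>0 r"
  have \<epsilon>: "\<epsilon> > 0" "\<epsilon> \<le> r" "\<epsilon> \<le> \<epsilon>0" using \<epsilon>0(1) star_at_D(1)[OF star] by (auto simp: \<epsilon>_def)
  define B where "B = (\<Sum>i<n. \<bar>real_of_int (s i)\<bar>)"
  have *: "\<exists>i<n. f y - f x = of_int (s i) * dist x y" if y: "y \<in> \<Gamma>" "y \<noteq> x" "dist x y < \<epsilon>" for y
  proof -
    have "dist x y < r" "dist x y \<in> {0<..<\<epsilon>0}" using y \<epsilon> by auto
    from star_at_cases[OF star y(1) this(1) y(2)] obtain i where i: "i \<in> {..<n}" "y = leg i (dist x y)" .
    then have "f y = f x + of_int (s i) * dist x y"
      using \<epsilon>0(2)[of i "dist x y"] \<open>dist x y \<in> {0<..<\<epsilon>0}\<close> by simp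
    then show ?thesis using i by auto
  qed
  show thesis
  proof (rule that[of \<epsilon> B])
    fix t assume t: "t \<in> {0<..<\<epsilon>}"
    have "(\<Sum>y\<in>{y\<in>\<Gamma>. dist x y = t}. f y - f x) = (\<Sum>i<n. f (leg i t) - f x)"
      by (rule sum.reindex_bij_betw[OF star_at_sphere[OF star], symmetric]) (use t \<epsilon> in auto)
    also have "\<dots> = (\<Sum>i<n. of_int (s i) * t)" using t \<epsilon> \<epsilon>0(2) by (intro sum.cong) auto
    also have "\<dots> = of_int m * t" by (simp add: m sum_distrib_right)
    finally show "(\<Sum>y\<in>{y\<in>\<Gamma>. dist x y = t}. f y - f x) = of_int m * t" .
  next
    fix t y assume t: "t \<in> {0<..<\<epsilon>}" "y \<in> \<Gamma>" "dist x y = t"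
    then have "y \<noteq> x" by auto
    then show "\<exists>s::int. f y - f x = of_int s * t" using *[of y] t by auto
  next
    fix y assume y: "y \<in> \<Gamma>" "dist x y < \<epsilon>"
    show "\<bar>f y - f x\<bar> \<le> B * dist x y"
    proof (cases "y = x")
      case False
      then obtain i where i: "i < n" "f y - f x = of_int (s i) * dist x y" using * y by blast
      have "\<bar>real_of_int (s i)\<bar> \<le> B" unfolding B_def using i by (intro member_le_sum) auto
      then show ?thesis using i(2) by (simp add: abs_mult mult_right_mono)
    qed simp
  qed (use \<epsilon> in auto)
qed

text \<open>The slopes at \<open>x\<close> bound the growth of \<open>f\<close> near
  \<open>x\<close> linearly. Continuity of a function assembled from edges can thus be read off from
  its orders, with no gluing argument.\<close>

lemma has_ord_imp_continuous:
  assumes "has_ord \<Gamma> f x m"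
  shows "continuous (at x within \<Gamma>) f"
proof -
  obtain \<epsilon> B where \<epsilon>: "\<epsilon> > 0" "\<And>y. y \<in> \<Gamma> \<Longrightarrow> dist x y < \<epsilon> \<Longrightarrow> \<bar>f y - f x\<bar> \<le> B * dist x y"
    by (rule has_ord_sphere[OF assms]) (rule that)
  show ?thesis
    unfolding continuous_within_eps_delta
  proof (intro allI impI)
    fix e :: real assume e: "e > 0"
    define d where "d = min \<epsilon> (e / (\<bar>B\<bar> + 1))"
    have "d > 0" using \<epsilon>(1) e by (simp add: d_def)
    moreover have "dist (f y) (f x) < e" if y: "y \<in> \<Gamma>" "dist y x < d" for y
    proof -
      have d: "dist x y < \<epsilon>" "dist x y < e / (\<bar>B\<bar> + 1)" using y(2) by (auto simp: d_def dist_commute)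
      have "\<bar>f y - f x\<bar> \<le> B * dist x y" by (rule \<epsilon>(2)[OF y(1) d(1)])
      also have "\<dots> \<le> (\<bar>B\<bar> + 1) * dist x y" by (intro mult_right_mono) auto
      also have "\<dots> < e" using d(2) by (simp add: field_simps)
      finally show ?thesis by (simp add: dist_real_def)
    qed
    ultimately show "\<exists>d>0. \<forall>y\<in>\<Gamma>. dist y x < d \<longrightarrow> dist (f y) (f x) < e" by blast
  qed
qed

section \<open>Edges of a model\<close>

lemma edge_chartE:
  assumes "edge_chart C l \<theta>"
  obtains \<psi> where "l > 0" "\<theta> ` {0<..<l} = C" "continuous_on {0<..<l} \<theta>" "continuous_on C \<psi>"
    "\<And>t. t \<in> {0<..<l} \<Longrightarrow> \<psi> (\<theta> t) = t" "\<And>y. y \<in> C \<Longrightarrow> \<psi> y \<in> {0<..<l} \<and> \<theta> (\<psi> y) = y"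
proof -
  obtain \<psi> where "l > 0" "homeomorphism {0<..<l} C \<theta> \<psi>"
    using assms unfolding edge_chart_def by blast
  then show thesis by (intro that[of \<psi>]) (auto simp: homeomorphism_def)
qed

lemma edge_chart_pos: "edge_chart C l \<theta> \<Longrightarrow> l > 0"
  by (simp add: edge_chart_def)

lemma edge_chart_image: "edge_chart C l \<theta> \<Longrightarrow> \<theta> ` {0<..<l} = C"
  by (erule edge_chartE)

lemma edge_chart_mem: "edge_chart C l \<theta> \<Longrightarrow> t \<in> {0<..<l} \<Longrightarrow> \<theta> t \<in> C"
  using edge_chart_image by blast

lemma edge_chart_inj:
  assumes "edge_chart C l \<theta>" "s \<in> {0<..<l}" "t \<in> {0<..<l}" "\<theta> s = \<theta> t"
  shows "s = t"
proof -
  obtain \<psi> where "\<And>t. t \<in> {0<..<l} \<Longrightarrow> \<psi> (\<theta> t) = t"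
    using assms(1) by (rule edge_chartE) (rule that)
  then show ?thesis using assms(2-4) by metis
qed

lemma edge_chart_local:
  assumes "edge_chart C l \<theta>" "t \<in> {0<..<l}"
  obtains \<epsilon> where "\<epsilon> > 0" "\<And>s s'. s \<in> {0<..<l} \<Longrightarrow> s' \<in> {0<..<l} \<Longrightarrow> \<bar>s - t\<bar> < \<epsilon> \<Longrightarrow>
    \<bar>s' - t\<bar> < \<epsilon> \<Longrightarrow> dist (\<theta> s) (\<theta> s') = \<bar>s - s'\<bar>"
proof -
  have "\<exists>\<epsilon>>0. \<forall>s\<in>{0<..<l}. \<forall>s'\<in>{0<..<l}.
        \<bar>s - t\<bar> < \<epsilon> \<and> \<bar>s' - t\<bar> < \<epsilon> \<longrightarrow> dist (\<theta> s) (\<theta> s') = \<bar>s - s'\<bar>"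
    using assms by (simp add: edge_chart_def)
  then obtain \<epsilon> where "\<epsilon> > 0" "\<forall>s\<in>{0<..<l}. \<forall>s'\<in>{0<..<l}.
        \<bar>s - t\<bar> < \<epsilon> \<and> \<bar>s' - t\<bar> < \<epsilon> \<longrightarrow> dist (\<theta> s) (\<theta> s') = \<bar>s - s'\<bar>" by blast
  then show thesis by (intro that[of \<epsilon>]) auto
qed

lemma edge_chart_flip:
  assumes "edge_chart C l \<theta>"
  shows "edge_chart C l (\<lambda>t. \<theta> (l - t))"
proof -
  obtain \<psi> where h: "homeomorphism {0<..<l} C \<theta> \<psi>" and l: "l > 0"
    using assms unfolding edge_chart_def by blast
  have "homeomorphism {0<..<l} {0<..<l} ((-) l) ((-) l)"
    unfolding homeomorphism_def
    by (auto intro!: continuous_intros image_eqI[where x = "l - _"])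
  from homeomorphism_compose[OF this h]
  have "homeomorphism {0<..<l} C (\<lambda>t. \<theta> (l - t)) ((-) l \<circ> \<psi>)" by (simp add: o_def)
  moreover have "\<exists>\<epsilon>>0. \<forall>s\<in>{0<..<l}. \<forall>s'\<in>{0<..<l}. \<bar>s - t\<bar> < \<epsilon> \<and> \<bar>s' - t\<bar> < \<epsilon> \<longrightarrow>
      dist (\<theta> (l - s)) (\<theta> (l - s')) = \<bar>s - s'\<bar>" if t: "t \<in> {0<..<l}" for t
  proof -
    have "l - t \<in> {0<..<l}" using t by auto
    from edge_chart_local[OF assms this] obtain \<epsilon> where \<epsilon>: "\<epsilon> > 0"
      "\<And>s s'. s \<in> {0<..<l} \<Longrightarrow> s' \<in> {0<..<l} \<Longrightarrow> \<bar>s - (l - t)\<bar> < \<epsilon> \<Longrightarrow>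
        \<bar>s' - (l - t)\<bar> < \<epsilon> \<Longrightarrow> dist (\<theta> s) (\<theta> s') = \<bar>s - s'\<bar>" by blast
    have "dist (\<theta> (l - s)) (\<theta> (l - s')) = \<bar>s - s'\<bar>"
      if "s \<in> {0<..<l}" "s' \<in> {0<..<l}" "\<bar>s - t\<bar> < \<epsilon>" "\<bar>s' - t\<bar> < \<epsilon>" for s s'
      using \<epsilon>(2)[of "l - s" "l - s'"] that by (auto simp: abs_minus_commute)
    then show ?thesis using \<epsilon>(1) by blast
  qed
  ultimately show ?thesis using l unfolding edge_chart_def by blast
qed

text \<open>A negative \<open>\<alpha>\<close> would give positions outside the domain. If
  \<open>\<alpha>\<close> were positive, then \<open>leg t\<close>, which tends to \<open>w\<close>
  as \<open>t\<close> tends to 0, would also tend to the point \<open>\<theta> \<alpha>\<close> of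
  \<open>C\<close>, while \<open>w\<close> lies outside \<open>C\<close>.\<close>

lemma leg_offset_zero:
  assumes chart: "edge_chart C l \<theta>" and w: "w \<notin> C" and \<delta>: "\<delta> > 0"
    and dist_w: "\<And>t. t \<in> {0<..<\<delta>} \<Longrightarrow> dist w (leg t) = t"
    and leg: "\<And>t. t \<in> {0<..<\<delta>} \<Longrightarrow> \<alpha> + t \<in> {0<..<l} \<and> leg t = \<theta> (\<alpha> + t)"
  shows "\<alpha> = 0"
proof (rule ccontr)
  assume "\<alpha> \<noteq> 0"
  have "\<alpha> \<ge> 0"
  proof (rule ccontr)
    assume "\<not> \<alpha> \<ge> 0"
    moreover define t where "t = min (\<delta> / 2) (- \<alpha>)"
    ultimately have "t \<in> {0<..<\<delta>}" "\<alpha> + t \<le> 0" using \<delta> by auto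
    then show False using leg[of t] by auto
  qed
  moreover have "\<alpha> < l" using leg[of "\<delta> / 2"] \<delta> by auto
  ultimately have \<alpha>: "\<alpha> \<in> {0<..<l}" using \<open>\<alpha> \<noteq> 0\<close> by simp
  from edge_chart_local[OF chart \<alpha>] obtain \<epsilon> where \<epsilon>: "\<epsilon> > 0"
    "\<And>s s'. s \<in> {0<..<l} \<Longrightarrow> s' \<in> {0<..<l} \<Longrightarrow> \<bar>s - \<alpha>\<bar> < \<epsilon> \<Longrightarrow>
        \<bar>s' - \<alpha>\<bar> < \<epsilon> \<Longrightarrow> dist (\<theta> s) (\<theta> s') = \<bar>s - s'\<bar>" by blast
  have "dist w (\<theta> \<alpha>) \<le> e" if e: "e > 0" for e
  proof -
    define t where "t = Min {e / 2, \<delta> / 2, \<epsilon> / 2}"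
    have t: "t > 0" "t \<le> e / 2" "t < \<delta>" "t < \<epsilon>" using e \<delta> \<epsilon>(1) by (auto simp: t_def min_def)
    have "dist w (\<theta> \<alpha>) \<le> dist w (leg t) + dist (leg t) (\<theta> \<alpha>)" by (rule dist_triangle)
    also have "dist (leg t) (\<theta> \<alpha>) = t" using leg[of t] t \<epsilon>(2)[of "\<alpha> + t" \<alpha>] \<alpha> by auto
    finally show ?thesis using dist_w[of t] t by simp
  qed
  then have "dist w (\<theta> \<alpha>) \<le> 0" by (meson dense_ge)
  then show False using edge_chart_mem[OF chart \<alpha>] w by simp
qed

text \<open>Read through the inverse chart, the leg is a local isometry between intervals, hence
  affine of slope 1 or -1. As it issues from a point outside \<open>C\<close>, it starts at one of
  the two ends of the chart.\<close>

lemma leg_in_chart: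
  assumes chart: "edge_chart C l \<theta>" and w: "w \<notin> C" and \<delta>: "\<delta> > 0"
    and leg: "\<And>t. t \<in> {0<..<\<delta>} \<Longrightarrow> leg t \<in> C"
    and iso: "\<And>s t. s \<in> {0<..<\<delta>} \<Longrightarrow> t \<in> {0<..<\<delta>} \<Longrightarrow> dist (leg s) (leg t) = \<bar>s - t\<bar>"
    and dist_w: "\<And>t. t \<in> {0<..<\<delta>} \<Longrightarrow> dist w (leg t) = t"
  shows "(\<forall>t\<in>{0<..<\<delta>}. t < l \<and> leg t = \<theta> t) \<or> (\<forall>t\<in>{0<..<\<delta>}. t < l \<and> leg t = \<theta> (l - t))"
proof -
  obtain \<psi> where \<psi>: "continuous_on C \<psi>" "\<And>y. y \<in> C \<Longrightarrow> \<psi> y \<in> {0<..<l} \<and> \<theta> (\<psi> y) = y"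
    using chart by (rule edge_chartE) (rule that)
  define u where "u t = \<psi> (leg t)" for t
  have u: "u t \<in> {0<..<l}" "\<theta> (u t) = leg t" if "t \<in> {0<..<\<delta>}" for t
    using \<psi>(2) leg[OF that] by (auto simp: u_def)
  have cont: "continuous_on {0<..<\<delta>} u"
    unfolding u_def
    by (rule continuous_on_compose2[OF \<psi>(1) isometric_imp_continuous_on]) (use iso leg in auto)
  have "\<exists>\<epsilon>>0. \<forall>s\<in>{0<..<\<delta>}. \<forall>t\<in>{0<..<\<delta>}. \<bar>s - t0\<bar> < \<epsilon> \<and> \<bar>t - t0\<bar> < \<epsilon> \<longrightarrow> \<bar>u s - u t\<bar> = \<bar>s - t\<bar>"
    if t0: "t0 \<in> {0<..<\<delta>}" for t0
  proof -
    from edge_chart_local[OF chart u(1)[OF t0]] obtain e where e: "e > 0"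
      "\<And>s s'. s \<in> {0<..<l} \<Longrightarrow> s' \<in> {0<..<l} \<Longrightarrow> \<bar>s - u t0\<bar> < e \<Longrightarrow>
        \<bar>s' - u t0\<bar> < e \<Longrightarrow> dist (\<theta> s) (\<theta> s') = \<bar>s - s'\<bar>" by blast
    from cont[unfolded continuous_on_iff] t0 e(1) obtain d where d: "d > 0"
      "\<And>t. t \<in> {0<..<\<delta>} \<Longrightarrow> dist t t0 < d \<Longrightarrow> dist (u t) (u t0) < e" by blast
    have "\<bar>u s - u t\<bar> = \<bar>s - t\<bar>"
      if "s \<in> {0<..<\<delta>}" "t \<in> {0<..<\<delta>}" "\<bar>s - t0\<bar> < d" "\<bar>t - t0\<bar> < d" for s t
      using e(2)[of "u s" "u t"] d(2)[of s] d(2)[of t] u[of s] u[of t] iso[of s t] that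
      by (simp add: dist_real_def)
    then show ?thesis using d(1) by blast
  qed
  then obtain \<alpha> where "(\<forall>t\<in>{0<..<\<delta>}. u t = \<alpha> + t) \<or> (\<forall>t\<in>{0<..<\<delta>}. u t = \<alpha> - t)"
    using local_isometry_imp_affine[OF \<delta> cont] by blast
  then show ?thesis
  proof
    assume a: "\<forall>t\<in>{0<..<\<delta>}. u t = \<alpha> + t"
    have "\<alpha> = 0" by (rule leg_offset_zero[OF chart w \<delta> dist_w]) (use a u in auto)
    then show ?thesis using a u by (intro disjI1) fastforce
  next
    assume a: "\<forall>t\<in>{0<..<\<delta>}. u t = \<alpha> - t"
    have "l - \<alpha> = 0"
      by (rule leg_offset_zero[OF edge_chart_flip[OF chart] w \<delta> dist_w])
        (use a u in \<open>force simp: algebra_simps\<close>)+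
    then show ?thesis using a u by (intro disjI2) fastforce
  qed
qed

locale vertex_model =
  fixes \<Gamma> U :: "'a::metric_space set"
  assumes graph: "metric_graph \<Gamma>" and model: "graph_model \<Gamma> U"
begin

abbreviation edgeset :: "'a set set" where "edgeset \<equiv> components (\<Gamma> - U)"

lemma finite_U: "finite U" and U_sub: "U \<subseteq> \<Gamma>" and U_ne: "U \<noteq> {}"
  using model by (auto simp: graph_model_def)

lemma compact_graph: "compact \<Gamma>" and connected_graph: "connected \<Gamma>"
  using graph by (auto simp: metric_graph_def)

lemma geodesic:
  assumes "x \<in> \<Gamma>" "y \<in> \<Gamma>"
  obtains \<gamma> where "\<gamma> 0 = x" "\<gamma> (dist x y) = y" "\<And>t. t \<in> {0..dist x y} \<Longrightarrow> \<gamma> t \<in> \<Gamma>"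
    "\<And>s t. s \<in> {0..dist x y} \<Longrightarrow> t \<in> {0..dist x y} \<Longrightarrow> dist (\<gamma> s) (\<gamma> t) = \<bar>s - t\<bar>"
proof -
  have "path_metric \<Gamma>" using graph by (simp add: metric_graph_def)
  then obtain \<gamma> where "\<gamma> 0 = x" "\<gamma> (dist x y) = y" "\<gamma> ` {0..dist x y} \<subseteq> \<Gamma>"
        "\<forall>s\<in>{0..dist x y}. \<forall>t\<in>{0..dist x y}. dist (\<gamma> s) (\<gamma> t) = \<bar>s - t\<bar>"
    using assms unfolding path_metric_def by blast
  then show thesis by (intro that[of \<gamma>]) auto
qed

lemma exists_star:
  assumes "x \<in> \<Gamma>"
  obtains n r leg where "star_at \<Gamma> x {..<n::nat} r leg"
  using graph assms unfolding metric_graph_def has_valence_def star_chart_iff_star_at by blast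

lemma edge_subset: "C \<in> edgeset \<Longrightarrow> C \<subseteq> \<Gamma> - U"
  by (rule in_components_subset)

lemma edge_unique: "C \<in> edgeset \<Longrightarrow> C' \<in> edgeset \<Longrightarrow> x \<in> C \<Longrightarrow> x \<in> C' \<Longrightarrow> C = C'"
  using components_nonoverlap by blast

lemma edge_cover: "x \<in> \<Gamma> \<Longrightarrow> x \<notin> U \<Longrightarrow> \<exists>C\<in>edgeset. x \<in> C"
  using Union_components[of "\<Gamma> - U"] by (metis DiffI UnionE)

text \<open>A geodesic from \<open>x\<close> that is too short to reach \<open>U\<close> stays in
  the component of \<open>x\<close>. It is the path metric that makes the components open.\<close>

lemma edge_open:
  assumes C: "C \<in> edgeset" "x \<in> C"
  obtains r where "r > 0" "ball x r \<inter> \<Gamma> \<subseteq> C"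
proof -
  have x: "x \<in> \<Gamma>" "x \<notin> U" using edge_subset C by auto
  have "open (- U)" using finite_U by (simp add: finite_imp_closed open_Compl)
  then obtain r where r: "r > 0" "ball x r \<subseteq> - U" using x by (auto simp: open_contains_ball)
  have "y \<in> C" if y: "y \<in> ball x r \<inter> \<Gamma>" for y
  proof -
    have yG: "y \<in> \<Gamma>" using y by simp
    obtain \<gamma> where \<gamma>: "\<gamma> 0 = x" "\<gamma> (dist x y) = y" "\<And>t. t \<in> {0..dist x y} \<Longrightarrow> \<gamma> t \<in> \<Gamma>"
      "\<And>s t. s \<in> {0..dist x y} \<Longrightarrow> t \<in> {0..dist x y} \<Longrightarrow> dist (\<gamma> s) (\<gamma> t) = \<bar>s - t\<bar>"
      using x(1) yG by (rule geodesic) (rule that)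
    have "\<gamma> t \<in> \<Gamma> - U" if t: "t \<in> {0..dist x y}" for t
    proof -
      have "dist x (\<gamma> t) = t" using \<gamma>(4)[of 0 t] \<gamma>(1) t by simp
      then have "\<gamma> t \<in> ball x r" using t y by simp
      then show ?thesis using r(2) \<gamma>(3)[OF t] by blast
    qed
    then have "\<gamma> ` {0..dist x y} \<subseteq> \<Gamma> - U" by blast
    moreover have "connected (\<gamma> ` {0..dist x y})"
      by (rule connected_continuous_image[OF isometric_imp_continuous_on[OF \<gamma>(4)]]) auto
    moreover have "x \<in> C \<inter> \<gamma> ` {0..dist x y}" using C \<gamma>(1) by (auto intro!: image_eqI[of x \<gamma> 0])
    ultimately have "\<gamma> ` {0..dist x y} \<subseteq> C" using components_maximal[OF C(1)] by blast
    then show ?thesis using \<gamma>(2) by (metis atLeastAtMost_iff image_subset_iff order_refl zero_le_dist)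
  qed
  then show thesis using that r(1) by blast
qed

lemma edge_interior:
  assumes C: "C \<in> edgeset" and chart: "edge_chart C l \<theta>" and u: "u \<in> {0<..<l}"
  obtains r where "r > 0" "r \<le> u" "r \<le> l - u" "ball (\<theta> u) r \<inter> \<Gamma> = \<theta> ` {u-r<..<u+r}"
    "\<And>s t. s \<in> {u-r<..<u+r} \<Longrightarrow> t \<in> {u-r<..<u+r} \<Longrightarrow> dist (\<theta> s) (\<theta> t) = \<bar>s - t\<bar>"
proof -
  let ?x = "\<theta> u"
  have x: "?x \<in> C" by (rule edge_chart_mem[OF chart u])
  from edge_chart_local[OF chart u] obtain \<epsilon> where \<epsilon>: "\<epsilon> > 0"
    "\<And>s s'. s \<in> {0<..<l} \<Longrightarrow> s' \<in> {0<..<l} \<Longrightarrow> \<bar>s - u\<bar> < \<epsilon> \<Longrightarrow>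
        \<bar>s' - u\<bar> < \<epsilon> \<Longrightarrow> dist (\<theta> s) (\<theta> s') = \<bar>s - s'\<bar>" by blast
  obtain r1 where r1: "r1 > 0" "ball ?x r1 \<inter> \<Gamma> \<subseteq> C" using C x by (rule edge_open)
  obtain \<psi> where \<psi>: "continuous_on C \<psi>" "\<And>t. t \<in> {0<..<l} \<Longrightarrow> \<psi> (\<theta> t) = t"
    "\<And>y. y \<in> C \<Longrightarrow> \<psi> y \<in> {0<..<l} \<and> \<theta> (\<psi> y) = y"
    using chart by (rule edge_chartE) (rule that)
  from \<psi>(1)[unfolded continuous_on_iff] x \<epsilon>(1) obtain d where d: "d > 0"
    "\<And>y. y \<in> C \<Longrightarrow> dist y ?x < d \<Longrightarrow> dist (\<psi> y) (\<psi> ?x) < \<epsilon>" by blast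
  \<comment> \<open>Below \<open>\<epsilon>\<close> the chart is isometric, below \<open>r1\<close>
    the ball stays in \<open>C\<close>, below \<open>d\<close> its points have parameters near
    \<open>u\<close>; the bounds \<open>u\<close> and \<open>l - u\<close> keep the interval inside
    the domain.\<close>
  define r where "r = Min {\<epsilon>, r1, d, u, l - u}"
  have r: "r > 0" "r \<le> \<epsilon>" "r \<le> r1" "r \<le> d" "r \<le> u" "r \<le> l - u"
    using \<epsilon>(1) r1(1) d(1) u by (auto simp: r_def)
  have iso: "dist (\<theta> s) (\<theta> t) = \<bar>s - t\<bar>" if "s \<in> {u-r<..<u+r}" "t \<in> {u-r<..<u+r}" for s t
    by (rule \<epsilon>(2)) (use that r in auto)
  have "ball ?x r \<inter> \<Gamma> = \<theta> ` {u-r<..<u+r}"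
  proof (intro subset_antisym subsetI)
    fix y assume y: "y \<in> ball ?x r \<inter> \<Gamma>"
    then have yC: "y \<in> C" using r1(2) r by auto
    then have "\<bar>\<psi> y - u\<bar> < \<epsilon>" using d(2)[OF yC] y r \<psi>(2)[OF u] by (simp add: dist_commute dist_real_def)
    then have "dist (\<theta> (\<psi> y)) ?x = \<bar>\<psi> y - u\<bar>" using \<epsilon>(1) \<epsilon>(2)[of "\<psi> y" u] \<psi>(3)[OF yC] u by simp
    then have "\<bar>\<psi> y - u\<bar> < r" using \<psi>(3)[OF yC] y by (simp add: dist_commute)
    then have "\<psi> y \<in> {u-r<..<u+r}" by auto
    then show "y \<in> \<theta> ` {u-r<..<u+r}" using \<psi>(3)[OF yC] by (metis imageI)
  next
    fix y assume "y \<in> \<theta> ` {u-r<..<u+r}"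
    then obtain s where s: "s \<in> {u-r<..<u+r}" "y = \<theta> s" by blast
    have "dist ?x y = \<bar>u - s\<bar>" using iso[of u s] s r by simp
    moreover have "y \<in> C" using s r edge_chart_mem[OF chart, of s] by auto
    ultimately show "y \<in> ball ?x r \<inter> \<Gamma>" using s edge_subset[OF C] by auto
  qed
  then show thesis using that[of r] r iso by blast
qed

text \<open>Close to \<open>w\<close> the leg meets none of the finitely many other vertices, and
  its image is connected.\<close>

lemma leg_edge:
  assumes w: "w \<in> U" and star: "star_at \<Gamma> w I r p" and i: "i \<in> I"
  obtains C \<delta> where "C \<in> edgeset" "\<delta> > 0" "\<delta> \<le> r" "\<And>t. t \<in> {0<..<\<delta>} \<Longrightarrow> p i t \<in> C"
proof -
  have "finite (U - {w})" using finite_U by simp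
  from finite_set_avoid[OF this, of w] obtain d where d: "d > 0" "\<forall>x\<in>U - {w}. x \<noteq> w \<longrightarrow> d \<le> dist w x" by blast
  define \<delta> where "\<delta> = min r d"
  have \<delta>: "\<delta> > 0" "\<delta> \<le> r" "\<delta> \<le> d" using d(1) star_at_D(1)[OF star] by (auto simp: \<delta>_def)
  have out: "p i t \<in> \<Gamma> - U" if t: "t \<in> {0<..<\<delta>}" for t
  proof -
    have "dist w (p i t) = t" "p i t \<in> \<Gamma>" using star_at_dist[OF star i, of t] t \<delta> by auto
    moreover have "p i t \<notin> U" using d(2) \<open>dist w (p i t) = t\<close> t \<delta> by force
    ultimately show ?thesis by simp
  qed
  have "connected (p i ` {0<..<\<delta>})"
    by (rule connected_continuous_image[OF isometric_imp_continuous_on])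
      (use star_at_D(5)[OF star i] \<delta> in auto)
  obtain C where C: "C \<in> edgeset" "p i (\<delta> / 2) \<in> C" using out[of "\<delta> / 2"] \<delta>(1) edge_cover by auto
  have "p i ` {0<..<\<delta>} \<subseteq> C"
  proof (rule components_maximal[OF C(1) \<open>connected (p i ` {0<..<\<delta>})\<close>])
    show "C \<inter> p i ` {0<..<\<delta>} \<noteq> {}" using C(2) \<delta>(1) by auto
  qed (use out in blast)
  then show thesis using that[OF C(1) \<delta>(1,2)] by blast
qed

text \<open>A single point \<open>\<theta> t0\<close> close to \<open>w\<close> lies on some leg,
  and this leg runs inside \<open>C\<close>, so it is an initial piece of the chart or of the
  reversed chart; the latter is incompatible with a small \<open>t0\<close>. Assuming accumulation
  instead of convergence allows the lemma to be used for proving convergence.\<close>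

lemma accumulation_leg:
  assumes C: "C \<in> edgeset" and chart: "edge_chart C l \<theta>" and w: "w \<in> U"
    and star: "star_at \<Gamma> w I r p"
    and acc: "\<And>\<epsilon>. \<epsilon> > 0 \<Longrightarrow> \<exists>t\<in>{0<..<\<epsilon>}. t < l \<and> dist w (\<theta> t) < \<epsilon>"
  shows "\<exists>i\<in>I. \<exists>\<delta>>0. \<delta> \<le> l \<and> \<delta> \<le> r \<and> (\<forall>t\<in>{0<..<\<delta>}. p i t = \<theta> t)"
proof -
  have l: "l > 0" using chart by (rule edge_chart_pos)
  have "w \<notin> C" using edge_subset[OF C] w by blast
  have "\<exists>C'\<in>edgeset. \<exists>\<delta>>0. \<delta> \<le> r \<and> (\<forall>t\<in>{0<..<\<delta>}. p i t \<in> C')" if "i \<in> I" for i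
    by (rule leg_edge[OF w star that]) blast
  then obtain E d where E: "\<And>i. i \<in> I \<Longrightarrow> E i \<in> edgeset"
    and d: "\<And>i. i \<in> I \<Longrightarrow> d i > 0" "\<And>i. i \<in> I \<Longrightarrow> d i \<le> r" "\<And>i t. i \<in> I \<Longrightarrow> t \<in> {0<..<d i} \<Longrightarrow> p i t \<in> E i"
    by metis
  \<comment> \<open>The bound \<open>l / 2\<close> separates the two ends of the chart, which
    matters when both of them are at \<open>w\<close>, as for a loop.\<close>
  define \<delta> where "\<delta> = Min (insert (l / 2) (insert r (d ` I)))"
  have fin: "finite (insert (l / 2) (insert r (d ` I)))" using star_at_D(2)[OF star] by simp
  have "\<delta> > 0"
    unfolding \<delta>_def using fin l star_at_D(1)[OF star] d(1) by (subst Min_gr_iff) auto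
  moreover have "\<delta> \<le> l / 2" "\<delta> \<le> r" "\<And>i. i \<in> I \<Longrightarrow> \<delta> \<le> d i"
    unfolding \<delta>_def by (rule Min_le[OF fin], blast)+
  ultimately have \<delta>: "\<delta> > 0" "\<delta> \<le> l / 2" "\<delta> \<le> r" "\<And>i. i \<in> I \<Longrightarrow> \<delta> \<le> d i" by blast+
  obtain t0 where t0: "t0 \<in> {0<..<\<delta>}" "t0 < l" "dist w (\<theta> t0) < \<delta>" using acc[OF \<delta>(1)] by blast
  have x: "\<theta> t0 \<in> C" using edge_chart_mem[OF chart] t0 by simp
  have "\<theta> t0 \<in> \<Gamma>" "dist w (\<theta> t0) < r" "\<theta> t0 \<noteq> w"
    using x edge_subset[OF C] t0 \<delta> \<open>w \<notin> C\<close> by auto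
  from star_at_cases[OF star this] obtain i where i: "i \<in> I" "\<theta> t0 = p i (dist w (\<theta> t0))" .
  define g where "g = dist w (\<theta> t0)"
  have g: "g \<in> {0<..<\<delta>}" "\<theta> t0 = p i g" using t0 \<open>\<theta> t0 \<noteq> w\<close> i(2) by (auto simp: g_def)
  have "p i g \<in> E i" using d(3)[OF i(1), of g] g \<delta>(4)[OF i(1)] by auto
  then have "E i = C" using edge_unique[OF E[OF i(1)] C] x g(2) by simp
  have "(\<forall>t\<in>{0<..<\<delta>}. t < l \<and> p i t = \<theta> t) \<or> (\<forall>t\<in>{0<..<\<delta>}. t < l \<and> p i t = \<theta> (l - t))"
  proof (rule leg_in_chart[OF chart \<open>w \<notin> C\<close> \<delta>(1)])
    show "p i t \<in> C" if "t \<in> {0<..<\<delta>}" for t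
      using d(3)[OF i(1), of t] that \<delta>(4)[OF i(1)] \<open>E i = C\<close> by auto
    show "dist (p i s) (p i t) = \<bar>s - t\<bar>" if "s \<in> {0<..<\<delta>}" "t \<in> {0<..<\<delta>}" for s t
      using star_at_D(5)[OF star i(1), of s t] that \<delta>(3) by auto
    show "dist w (p i t) = t" if "t \<in> {0<..<\<delta>}" for t
      using star_at_dist(1)[OF star i(1), of t] that \<delta>(3) by auto
  qed
  moreover have "\<not> (\<forall>t\<in>{0<..<\<delta>}. t < l \<and> p i t = \<theta> (l - t))"
  proof
    assume "\<forall>t\<in>{0<..<\<delta>}. t < l \<and> p i t = \<theta> (l - t)"
    then have "\<theta> t0 = \<theta> (l - g)" "g < l" using g by auto
    then have "t0 = l - g" using edge_chart_inj[OF chart, of t0 "l - g"] t0 g by auto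
    then show False using t0 g \<delta>(2) by auto
  qed
  ultimately show ?thesis using i(1) \<delta> l by (intro bexI[of _ i] exI[of _ \<delta>]) auto
qed

text \<open>Compactness supplies a limit point \<open>w\<close> of \<open>\<theta>\<close> along
  parameters tending to 0. Inside an edge, \<open>w\<close> would have parameter 0 by continuity of
  the inverse chart. At a vertex, \<open>accumulation_leg\<close> shows that the chart follows a
  leg, and a leg does converge.\<close>

lemma edge_end_exists:
  assumes C: "C \<in> edgeset" and chart: "edge_chart C l \<theta>"
  shows "\<exists>w\<in>U. (\<theta> \<longlongrightarrow> w) (at_right 0)"
proof -
  have l: "l > 0" using chart by (rule edge_chart_pos)
  obtain \<psi> where \<psi>: "continuous_on C \<psi>" "\<And>t. t \<in> {0<..<l} \<Longrightarrow> \<psi> (\<theta> t) = t"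
    "\<And>y. y \<in> C \<Longrightarrow> \<psi> y \<in> {0<..<l} \<and> \<theta> (\<psi> y) = y"
    using chart by (rule edge_chartE) (rule that)
  \<comment> \<open>Starting at \<open>l / 2\<close> keeps every term strictly inside the
    domain.\<close>
  define \<tau> where "\<tau> n = l / real (n + 2)" for n
  have \<tau>: "\<tau> n \<in> {0<..<l}" for n
  proof -
    have "l / real (n + 2) < l / 1" using l by (intro divide_strict_left_mono) auto
    then show ?thesis using l by (simp add: \<tau>_def)
  qed
  have \<tau>_lim: "\<tau> \<longlonglongrightarrow> 0" unfolding \<tau>_def
    by (rule LIMSEQ_ignore_initial_segment[OF lim_const_over_n])
  have "\<theta> (\<tau> n) \<in> \<Gamma>" for n using edge_chart_mem[OF chart \<tau>] edge_subset[OF C] by blast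
  then obtain w s where w: "w \<in> \<Gamma>" and s: "strict_mono s" "((\<lambda>n. \<theta> (\<tau> n)) \<circ> s) \<longlonglongrightarrow> w"
    using compact_graph unfolding compact_def by metis
  have \<tau>s: "(\<lambda>n. \<tau> (s n)) \<longlonglongrightarrow> 0"
    using LIMSEQ_subseq_LIMSEQ[OF \<tau>_lim s(1)] by (simp add: o_def)
  have lim: "(\<lambda>n. \<theta> (\<tau> (s n))) \<longlonglongrightarrow> w" using s(2) by (simp add: o_def)
  have wU: "w \<in> U"
  proof (rule ccontr)
    assume "w \<notin> U"
    then obtain C' where C': "C' \<in> edgeset" "w \<in> C'" using edge_cover w by blast
    obtain r where r: "r > 0" "ball w r \<inter> \<Gamma> \<subseteq> C'" using C' by (rule edge_open)
    have "\<forall>\<^sub>F n in sequentially. dist (\<theta> (\<tau> (s n))) w < r" by (rule tendstoD[OF lim r(1)])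
    from eventually_happens'[OF sequentially_bot this]
    obtain n where "dist (\<theta> (\<tau> (s n))) w < r" by blast
    then have "\<theta> (\<tau> (s n)) \<in> C'" using r(2) \<open>\<theta> (\<tau> (s n)) \<in> \<Gamma>\<close> by (auto simp: dist_commute)
    then have "C' = C" using edge_unique[OF C'(1) C] edge_chart_mem[OF chart \<tau>] by blast
    then have "w \<in> C" using C' by simp
    have "(\<lambda>n. \<psi> (\<theta> (\<tau> (s n)))) \<longlonglongrightarrow> \<psi> w"
      by (rule continuous_on_tendsto_compose[OF \<psi>(1) lim \<open>w \<in> C\<close>])
        (simp add: edge_chart_mem[OF chart \<tau>])
    then have "(\<lambda>n. \<tau> (s n)) \<longlonglongrightarrow> \<psi> w" using \<psi>(2)[OF \<tau>] by simp
    then have "\<psi> w = 0" using \<tau>s LIMSEQ_unique by blast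
    then show False using \<psi>(3)[OF \<open>w \<in> C\<close>] by simp
  qed
  obtain n r leg where star: "star_at \<Gamma> w {..<n::nat} r leg" using exists_star[OF w] by blast
  have "\<exists>t\<in>{0<..<\<epsilon>}. t < l \<and> dist w (\<theta> t) < \<epsilon>" if \<epsilon>: "\<epsilon> > 0" for \<epsilon>
  proof -
    have "\<forall>\<^sub>F n in sequentially. dist (\<theta> (\<tau> (s n))) w < \<epsilon> \<and> \<tau> (s n) < \<epsilon>"
      using tendstoD[OF lim \<epsilon>] order_tendstoD(2)[OF \<tau>s \<epsilon>] by (rule eventually_conj)
    from eventually_happens'[OF sequentially_bot this]
    obtain n where "dist (\<theta> (\<tau> (s n))) w < \<epsilon>" "\<tau> (s n) < \<epsilon>" by blast
    then show ?thesis using \<tau>[of "s n"] by (intro bexI[of _ "\<tau> (s n)"]) (auto simp: dist_commute)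
  qed
  from accumulation_leg[OF C chart wU star this] obtain i \<delta> where i: "i < n" "\<delta> > 0" "\<delta> \<le> r"
    "\<forall>t\<in>{0<..<\<delta>}. leg i t = \<theta> t" by auto
  have "dist (\<theta> t) w = t" if "t \<in> {0<..<\<delta>}" for t
    using star_at_dist(1)[OF star, of i t] i that by (auto simp: dist_commute)
  moreover have "\<forall>\<^sub>F t in at_right 0. t \<in> {0<..<\<delta>}" by (rule eventually_at_right_real[OF i(2)])
  ultimately have "\<forall>\<^sub>F t in at_right 0. dist (\<theta> t) w = t" by (auto elim: eventually_mono)
  moreover have "((\<lambda>t::real. t) \<longlongrightarrow> 0) (at_right 0)" by (rule tendsto_ident_at)
  ultimately have "((\<lambda>t. dist (\<theta> t) w) \<longlongrightarrow> 0) (at_right 0)" by (simp add: tendsto_cong)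
  then have "(\<theta> \<longlongrightarrow> w) (at_right 0)" by (subst tendsto_dist_iff)
  then show ?thesis using wU by blast
qed

end

section \<open>Half-edges\<close>

lemma star_at_reindex:
  assumes star: "star_at \<Gamma> x I r p" and b: "bij_betw b J I"
    and q: "\<And>j t. j \<in> J \<Longrightarrow> t \<in> {0..<r} \<Longrightarrow> q j t = p (b j) t"
  shows "star_at \<Gamma> x J r q"
proof -
  have bJ: "b ` J = I" and inj: "inj_on b J" using b by (auto simp: bij_betw_def)
  have bI: "b j \<in> I" if "j \<in> J" for j using bJ that by blast
  have r: "r > 0" by (rule star_at_D(1)[OF star])
  have "q j ` {0..<r} = p (b j) ` {0..<r}" if "j \<in> J" for j
    using q[OF that] by (intro image_cong) auto
  then have "(\<Union>j\<in>J. q j ` {0..<r}) = (\<Union>i\<in>I. p i ` {0..<r})"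
    by (subst bJ[symmetric]) simp
  then have "ball x r \<inter> \<Gamma> = insert x (\<Union>j\<in>J. q j ` {0..<r})"
    using star_at_D(4)[OF star] by simp
  moreover have "finite J" using bij_betw_finite[OF b] star_at_D(2)[OF star] by simp
  moreover have "q j 0 = x" if "j \<in> J" for j
    using q[OF that, of 0] star_at_D(3)[OF star bI[OF that]] r by simp
  moreover have "dist (q i s) (q j t) = (if i = j then \<bar>s - t\<bar> else s + t)"
    if "i \<in> J" "j \<in> J" "s \<in> {0..<r}" "t \<in> {0..<r}" for i j s t
  proof (cases "i = j")
    case True
    then show ?thesis using q that star_at_D(5)[OF star bI[OF that(1)]] by simp
  next
    case False
    then have "b i \<noteq> b j" using inj that by (auto simp: inj_on_def)
    then show ?thesis using False q that star_at_D(6)[OF star bI[OF that(1)] bI[OF that(2)]] by simp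
  qed
  ultimately show ?thesis using r unfolding star_at_def by blast
qed

text \<open>Lebesgue number of a cover by balls: two points at small distance lie in a common ball
  of the cover.\<close>

lemma compact_uniform_locally:
  fixes K :: "'b::metric_space set"
  assumes K: "compact K"
    and loc: "\<And>x. x \<in> K \<Longrightarrow> \<exists>\<epsilon>>0. \<forall>s\<in>K. \<forall>t\<in>K. dist x s < \<epsilon> \<and> dist x t < \<epsilon> \<longrightarrow> P s t"
  shows "\<exists>\<eta>>0. \<forall>s\<in>K. \<forall>t\<in>K. dist s t < \<eta> \<longrightarrow> P s t"
proof -
  obtain \<epsilon> where \<epsilon>: "\<And>x. x \<in> K \<Longrightarrow> \<epsilon> x > 0"
    "\<And>x s t. x \<in> K \<Longrightarrow> s \<in> K \<Longrightarrow> t \<in> K \<Longrightarrow> dist x s < \<epsilon> x \<Longrightarrow> dist x t < \<epsilon> x \<Longrightarrow> P s t"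
    using loc by metis
  have "K \<subseteq> \<Union>((\<lambda>x. ball x (\<epsilon> x)) ` K)" using \<epsilon>(1) by force
  then obtain \<eta> where \<eta>: "\<eta> > 0" "\<And>s. s \<in> K \<Longrightarrow> \<exists>G\<in>(\<lambda>x. ball x (\<epsilon> x)) ` K. ball s \<eta> \<subseteq> G"
    by (rule Heine_Borel_lemma[OF K]) auto
  have "P s t" if st: "s \<in> K" "t \<in> K" "dist s t < \<eta>" for s t
  proof -
    obtain x where x: "x \<in> K" "ball s \<eta> \<subseteq> ball x (\<epsilon> x)" using \<eta>(2)[OF st(1)] by blast
    have "s \<in> ball s \<eta>" "t \<in> ball s \<eta>" using st \<eta>(1) by auto
    then have "s \<in> ball x (\<epsilon> x)" "t \<in> ball x (\<epsilon> x)" using x(2) by blast+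
    then show ?thesis using \<epsilon>(2)[OF x(1) st(1,2)] by simp
  qed
  then show ?thesis using \<eta>(1) by blast
qed

locale charted_model = vertex_model \<Gamma> U for \<Gamma> U :: "'a::metric_space set" +
  fixes len :: "'a set \<Rightarrow> real" and \<phi> :: "'a set \<Rightarrow> real \<Rightarrow> 'a"
  assumes chart: "C \<in> components (\<Gamma> - U) \<Longrightarrow> edge_chart C (len C) (\<phi> C)"
begin

text \<open>A half-edge is an edge with a direction, \<open>True\<close> being that of the chart.\<close>

definition halves :: "('a set \<times> bool) set" where
  "halves = edgeset \<times> UNIV"

definition hlen :: "'a set \<times> bool \<Rightarrow> real" where
  "hlen h = len (fst h)"

definition rev_half :: "'a set \<times> bool \<Rightarrow> 'a set \<times> bool" where
  "rev_half h = (fst h, \<not> snd h)"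

definition raw :: "'a set \<times> bool \<Rightarrow> real \<Rightarrow> 'a" where
  "raw h t = \<phi> (fst h) (if snd h then t else hlen h - t)"

definition src :: "'a set \<times> bool \<Rightarrow> 'a" where
  "src h = (SOME w. w \<in> U \<and> (raw h \<longlongrightarrow> w) (at_right 0))"

text \<open>\<open>raw\<close> on the open interval, completed by its limits at the two ends. The
  limit at \<open>hlen h\<close> is the source of the reversed half-edge.\<close>

definition half :: "'a set \<times> bool \<Rightarrow> real \<Rightarrow> 'a" where
  "half h t = (if t = 0 then src h else if t = hlen h then src (rev_half h) else raw h t)"

text \<open>Both directions of a loop at \<open>w\<close> belong to this set, so a loop counts
  twice, as it does for the valence.\<close>

definition out_halves :: "'a \<Rightarrow> ('a set \<times> bool) set" where
  "out_halves w = {h \<in> halves. src h = w}"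

lemma halvesD: "h \<in> halves \<Longrightarrow> fst h \<in> edgeset"
  by (auto simp: halves_def)

lemma rev_half_simps [simp]: "rev_half (rev_half h) = h" "hlen (rev_half h) = hlen h"
  "fst (rev_half h) = fst h" "rev_half h \<in> halves \<longleftrightarrow> h \<in> halves"
  by (cases h; simp add: rev_half_def hlen_def halves_def)+

lemma raw_rev: "raw (rev_half h) t = raw h (hlen h - t)"
  by (cases h) (auto simp: raw_def rev_half_def hlen_def)

lemma raw_chart: "h \<in> halves \<Longrightarrow> edge_chart (fst h) (hlen h) (raw h)"
  using chart[OF halvesD, of h] edge_chart_flip[OF chart[OF halvesD, of h]]
  by (cases "snd h") (simp_all add: raw_def[abs_def] hlen_def)

lemma hlen_pos: "h \<in> halves \<Longrightarrow> hlen h > 0"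
  using edge_chart_pos raw_chart by blast

lemma src: assumes "h \<in> halves" shows "src h \<in> U" "(raw h \<longlongrightarrow> src h) (at_right 0)"
  using edge_end_exists[OF halvesD[OF assms] raw_chart[OF assms]] someI_ex[of "\<lambda>w. w \<in> U \<and> (raw h \<longlongrightarrow> w) (at_right 0)"]
  unfolding src_def by blast+

lemma src_unique: "h \<in> halves \<Longrightarrow> (raw h \<longlongrightarrow> w) (at_right 0) \<Longrightarrow> src h = w"
  using src(2) tendsto_unique trivial_limit_at_right_real by blast

lemma half_0 [simp]: "half h 0 = src h"
  by (simp add: half_def)

lemma half_hlen [simp]: "h \<in> halves \<Longrightarrow> half h (hlen h) = src (rev_half h)"
  using hlen_pos[of h] by (simp add: half_def)

lemma half_raw: "t \<in> {0<..<hlen h} \<Longrightarrow> half h t = raw h t"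
  by (simp add: half_def)

lemma half_rev: "h \<in> halves \<Longrightarrow> half (rev_half h) t = half h (hlen h - t)"
  using hlen_pos[of h] by (auto simp: half_def raw_rev)

lemma half_in_edge: "h \<in> halves \<Longrightarrow> t \<in> {0<..<hlen h} \<Longrightarrow> half h t \<in> fst h"
  using edge_chart_mem[OF raw_chart] by (simp add: half_raw)

lemma half_notin_U: "h \<in> halves \<Longrightarrow> t \<in> {0<..<hlen h} \<Longrightarrow> half h t \<notin> U"
  using half_in_edge edge_subset[OF halvesD] by blast

lemma half_in_graph:
  assumes "h \<in> halves" "t \<in> {0..hlen h}"
  shows "half h t \<in> \<Gamma>"
proof -
  consider "t = 0" | "t = hlen h" | "t \<in> {0<..<hlen h}" using assms(2) by fastforce
  then show ?thesis
  proof cases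
    case 1
    then show ?thesis using src(1)[OF assms(1)] U_sub by auto
  next
    case 2
    then show ?thesis using src(1)[of "rev_half h"] assms(1) U_sub by auto
  next
    case 3
    then show ?thesis using half_in_edge assms(1) edge_subset[OF halvesD] by blast
  qed
qed

lemma half_cover:
  assumes "x \<in> \<Gamma>" "x \<notin> U"
  obtains C t where "\<And>b. (C, b) \<in> halves" "t \<in> {0<..<hlen (C, True)}" "x = half (C, True) t"
proof -
  obtain C where C: "C \<in> edgeset" "x \<in> C" using edge_cover assms by blast
  then have "(C, True) \<in> halves" by (simp add: halves_def)
  then have "raw (C, True) ` {0<..<hlen (C, True)} = C"
    using edge_chart_image[OF raw_chart, of "(C, True)"] by simp
  then obtain t where "t \<in> {0<..<hlen (C, True)}" "x = raw (C, True) t"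
    using C(2) by blast
  then show thesis using that[of C t] C half_raw by (simp add: halves_def)
qed

lemma half_inj:
  assumes "h \<in> halves" "s \<in> {0<..<hlen h}" "t \<in> {0<..<hlen h}" "half h s = half h t"
  shows "s = t"
  using edge_chart_inj[OF raw_chart[OF assms(1)]] assms half_raw by simp

text \<open>An edge has only two directions, and the positions of a point on them add up to the
  length, so they cannot both be less than half of it.\<close>

lemma half_eq_half:
  assumes h: "h \<in> halves" "h' \<in> halves" and st: "s \<in> {0<..<hlen h / 2}" "t \<in> {0<..<hlen h' / 2}"
    and eq: "half h s = half h' t"
  shows "h = h'"
proof -
  have st': "s \<in> {0<..<hlen h}" "t \<in> {0<..<hlen h'}" using st by auto
  have C: "fst h = fst h'"
    using edge_unique[OF halvesD[OF h(1)] halvesD[OF h(2)]] half_in_edge[OF h(1) st'(1)]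
      half_in_edge[OF h(2) st'(2)] eq by simp
  then have l: "hlen h' = hlen h" by (simp add: hlen_def)
  show ?thesis
  proof (rule ccontr)
    assume "h \<noteq> h'"
    then have "h' = rev_half h" using C by (auto simp: rev_half_def prod_eq_iff)
    then have "half h s = half h (hlen h - t)" using eq half_rev[OF h(1)] by simp
    moreover have "hlen h - t \<in> {0<..<hlen h}" using st' l by auto
    ultimately have "s = hlen h - t" using half_inj[OF h(1) st'(1)] by blast
    then show False using st l by auto
  qed
qed

lemma src_accumulation:
  assumes h: "h \<in> halves" and \<epsilon>: "\<epsilon> > 0"
  shows "\<exists>t\<in>{0<..<\<epsilon>}. t < hlen h \<and> dist (src h) (raw h t) < \<epsilon>"
proof -
  have "\<forall>\<^sub>F t in at_right 0. t \<in> {0<..<min \<epsilon> (hlen h)}"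
    by (rule eventually_at_right_real) (use \<epsilon> hlen_pos[OF h] in simp)
  with tendstoD[OF src(2)[OF h] \<epsilon>]
  have "\<forall>\<^sub>F t in at_right 0. dist (raw h t) (src h) < \<epsilon> \<and> t \<in> {0<..<min \<epsilon> (hlen h)}"
    by (rule eventually_conj)
  from eventually_happens'[OF trivial_limit_at_right_real this]
  show ?thesis by (auto simp: dist_commute)
qed

text \<open>Every half-edge leaving \<open>w\<close> agrees near \<open>w\<close> with a leg of a
  given star chart, and the map \<open>b\<close> so obtained is a bijection: two half-edges on the
  same leg would share points of their first halves, and every leg, lying in one edge near
  \<open>w\<close>, is the beginning of one of the two directions of that edge.\<close>

lemma star_vertex:
  assumes w: "w \<in> U"
  obtains \<delta> where "\<delta> > 0" "\<And>h. h \<in> out_halves w \<Longrightarrow> 2 * \<delta> \<le> hlen h"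
    "star_at \<Gamma> w (out_halves w) \<delta> half"
proof -
  obtain n r leg where star: "star_at \<Gamma> w {..<n::nat} r leg"
    using U_sub w by (rule_tac exists_star[of w]) auto
  have r: "r > 0" by (rule star_at_D(1)[OF star])
  define P where "P h i \<delta> \<longleftrightarrow> \<delta> > 0 \<and> \<delta> \<le> hlen h \<and> \<delta> \<le> r \<and> (\<forall>t\<in>{0<..<\<delta>}. leg i t = raw h t)"
    for h i \<delta>
  have "\<exists>i\<in>{..<n}. \<exists>\<delta>>0. \<delta> \<le> hlen h \<and> \<delta> \<le> r \<and> (\<forall>t\<in>{0<..<\<delta>}. leg i t = raw h t)"
    if "h \<in> out_halves w" for h
  proof (rule accumulation_leg[OF halvesD raw_chart w star])
    show "h \<in> halves" "h \<in> halves" using that by (auto simp: out_halves_def)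
    show "\<exists>t\<in>{0<..<\<epsilon>}. t < hlen h \<and> dist w (raw h t) < \<epsilon>" if "\<epsilon> > 0" for \<epsilon>
      using src_accumulation[OF \<open>h \<in> halves\<close> that] \<open>h \<in> out_halves w\<close> by (simp add: out_halves_def)
  qed
  then have "\<exists>i\<in>{..<n}. \<exists>\<delta>. P h i \<delta>" if "h \<in> out_halves w" for h
    unfolding P_def using that by blast
  then obtain b d where bd: "\<And>h. h \<in> out_halves w \<Longrightarrow> b h \<in> {..<n}" "\<And>h. h \<in> out_halves w \<Longrightarrow> P h (b h) (d h)"
    by metis
  then have b: "\<And>h. h \<in> out_halves w \<Longrightarrow> b h \<in> {..<n}"
    and d: "\<And>h. h \<in> out_halves w \<Longrightarrow> d h > 0" "\<And>h. h \<in> out_halves w \<Longrightarrow> d h \<le> hlen h"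
      "\<And>h. h \<in> out_halves w \<Longrightarrow> d h \<le> r"
      "\<And>h t. h \<in> out_halves w \<Longrightarrow> t \<in> {0<..<d h} \<Longrightarrow> leg (b h) t = raw h t"
    unfolding P_def by blast+
  have leg_half: "leg (b h) t = half h t" if h: "h \<in> out_halves w" "t \<in> {0<..<d h}" for h t
    using d(4)[OF h] half_raw[of t h] h d(2)[OF h(1)] by auto
  have inj: "inj_on b (out_halves w)"
  proof (rule inj_onI)
    fix h h' assume h: "h \<in> out_halves w" "h' \<in> out_halves w" "b h = b h'"
    \<comment> \<open>Small enough for both points to lie in the first halves, since
      \<open>d h \<le> hlen h\<close>.\<close>
    define t where "t = min (d h / 3) (d h' / 3)"
    have t: "t > 0" "t < d h" "t < d h'" "t < hlen h / 2" "t < hlen h' / 2"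
      using d(1,2)[OF h(1)] d(1,2)[OF h(2)] by (auto simp: t_def)
    show "h = h'"
      by (rule half_eq_half[of _ _ t t])
        (use h t leg_half[OF h(1), of t] leg_half[OF h(2), of t] in \<open>auto simp: out_halves_def\<close>)
  qed
  have onto: "i \<in> b ` out_halves w" if i: "i \<in> {..<n}" for i
  proof -
    obtain C \<delta> where C: "C \<in> edgeset" "\<delta> > 0" "\<delta> \<le> r" "\<And>t. t \<in> {0<..<\<delta>} \<Longrightarrow> leg i t \<in> C"
      using w star i by (rule leg_edge) (rule that)
    have "(\<forall>t\<in>{0<..<\<delta>}. t < len C \<and> leg i t = \<phi> C t) \<or> (\<forall>t\<in>{0<..<\<delta>}. t < len C \<and> leg i t = \<phi> C (len C - t))"
    proof (rule leg_in_chart[OF chart[OF C(1)] _ C(2,4)])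
      show "w \<notin> C" using edge_subset[OF C(1)] w by blast
      show "dist (leg i s) (leg i t) = \<bar>s - t\<bar>" if "s \<in> {0<..<\<delta>}" "t \<in> {0<..<\<delta>}" for s t
        using star_at_D(5)[OF star i, of s t] that C(3) by auto
      show "dist w (leg i t) = t" if "t \<in> {0<..<\<delta>}" for t
        using star_at_dist(1)[OF star i, of t] that C(3) by auto
    qed
    then obtain e where e: "\<forall>t\<in>{0<..<\<delta>}. t < len C \<and> leg i t = raw (C, e) t"
    proof
      assume "\<forall>t\<in>{0<..<\<delta>}. t < len C \<and> leg i t = \<phi> C t"
      then show thesis using that[of True] by (simp add: raw_def)
    next
      assume "\<forall>t\<in>{0<..<\<delta>}. t < len C \<and> leg i t = \<phi> C (len C - t)"
      then show thesis using that[of False] by (simp add: raw_def hlen_def)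
    qed
    have h: "(C, e) \<in> halves" using C by (simp add: halves_def)
    have "((\<lambda>t. dist (raw (C, e) t) w) \<longlongrightarrow> 0) (at_right 0)"
    proof (rule tendsto_cong[THEN iffD1, OF _ tendsto_ident_at])
      have "\<forall>\<^sub>F t in at_right 0. t \<in> {0<..<\<delta>}" by (rule eventually_at_right_real[OF C(2)])
      then show "\<forall>\<^sub>F t in at_right 0. t = dist (raw (C, e) t) w"
      proof eventually_elim
        case (elim t)
        then show ?case using star_at_dist(1)[OF star i, of t] e C(3) by (simp add: dist_commute)
      qed
    qed
    then have "(raw (C, e) \<longlongrightarrow> w) (at_right 0)" by (subst tendsto_dist_iff)
    then have o: "(C, e) \<in> out_halves w" using src_unique[OF h] h by (simp add: out_halves_def)
    \<comment> \<open>At \<open>t\<close> the leg \<open>i\<close> and the leg assigned to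
      \<open>(C, e)\<close> pass through the same point, whereas distinct legs would be at distance
      \<open>2 * t\<close> there.\<close>
    define t where "t = min \<delta> (d (C, e)) / 2"
    have t: "t \<in> {0<..<\<delta>}" "t \<in> {0<..<d (C, e)}" using C(2) d(1)[OF o] by (auto simp: t_def)
    have "leg i t = leg (b (C, e)) t" using e t d(4)[OF o t(2)] by simp
    moreover have "t \<in> {0..<r}" "t > 0" using t C(3) by auto
    ultimately have "b (C, e) = i" using star_at_D(6)[OF star i b[OF o], of t t] by auto
    then show ?thesis using o by blast
  qed
  have bij: "bij_betw b (out_halves w) {..<n}"
    using inj onto b by (auto simp: bij_betw_def)
  have fin: "finite (out_halves w)" using bij_betw_finite[OF bij] by simp
  \<comment> \<open>Halving \<open>d h\<close> ensures \<open>2 * \<delta> \<le> hlen h\<close>, so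
    that each leg stays in the first half of its edge.\<close>
  define \<delta> where "\<delta> = Min (insert r ((\<lambda>h. d h / 2) ` out_halves w))"
  have "\<delta> > 0" unfolding \<delta>_def using fin r d(1) by (subst Min_gr_iff) auto
  moreover have \<delta>r: "\<delta> \<le> r" and \<delta>d: "\<And>h. h \<in> out_halves w \<Longrightarrow> \<delta> \<le> d h / 2"
    unfolding \<delta>_def using fin by (intro Min_le; blast)+
  ultimately have "star_at \<Gamma> w (out_halves w) \<delta> half"
  proof (intro star_at_reindex[OF star_at_mono[OF star] bij])
    fix h t assume h: "h \<in> out_halves w" and t: "t \<in> {0..<\<delta>}"
    show "half h t = leg (b h) t"
    proof (cases "t = 0")
      case True
      then show ?thesis using star_at_D(3)[OF star b[OF h]] h by (simp add: out_halves_def)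
    next
      case False
      then show ?thesis using leg_half[OF h, of t] t \<delta>d[OF h] d(1)[OF h] by auto
    qed
  qed auto
  moreover have "2 * \<delta> \<le> hlen h" if "h \<in> out_halves w" for h
    using \<delta>d[OF that] d(2)[OF that] by linarith
  ultimately show thesis using \<open>\<delta> > 0\<close> by (intro that[of \<delta>])
qed

lemma finite_out_halves: "w \<in> U \<Longrightarrow> finite (out_halves w)"
  by (rule star_vertex, assumption) (rule star_at_D(2))

text \<open>A model only asks for finitely many vertices. Finiteness of the edges follows, since
  each half-edge is one of the finitely many legs at its source.\<close>

lemma finite_halves: "finite halves"
proof -
  have "halves = (\<Union>w\<in>U. out_halves w)" using src(1) by (auto simp: out_halves_def)
  then show ?thesis using finite_U finite_out_halves by simp
qed

lemma finite_edgeset: "finite edgeset"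
proof -
  have "edgeset = fst ` halves" unfolding halves_def by (simp only: fst_image_times) simp
  then show ?thesis using finite_halves by simp
qed

lemma half_interior:
  assumes h: "h \<in> halves" and u: "u \<in> {0<..<hlen h}"
  obtains \<delta> where "\<delta> > 0" "\<delta> \<le> u" "\<delta> \<le> hlen h - u"
    "ball (half h u) \<delta> \<inter> \<Gamma> = half h ` {u-\<delta><..<u+\<delta>}"
    "\<And>s t. s \<in> {u-\<delta><..<u+\<delta>} \<Longrightarrow> t \<in> {u-\<delta><..<u+\<delta>} \<Longrightarrow> dist (half h s) (half h t) = \<bar>s - t\<bar>"
proof -
  obtain \<delta> where \<delta>: "\<delta> > 0" "\<delta> \<le> u" "\<delta> \<le> hlen h - u"
    "ball (raw h u) \<delta> \<inter> \<Gamma> = raw h ` {u-\<delta><..<u+\<delta>}"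
    "\<And>s t. s \<in> {u-\<delta><..<u+\<delta>} \<Longrightarrow> t \<in> {u-\<delta><..<u+\<delta>} \<Longrightarrow> dist (raw h s) (raw h t) = \<bar>s - t\<bar>"
    using halvesD[OF h] raw_chart[OF h] u by (rule edge_interior) (rule that)
  have eq: "half h s = raw h s" if "s \<in> {u-\<delta><..<u+\<delta>}" for s
    using that \<delta>(2,3) by (intro half_raw) auto
  have "half h ` {u-\<delta><..<u+\<delta>} = raw h ` {u-\<delta><..<u+\<delta>}" using eq by (intro image_cong) auto
  then show thesis using \<delta> eq by (intro that[of \<delta>]) (auto simp: half_raw[OF u])
qed

text \<open>The two legs are the two directions along the edge, \<open>True\<close> being that of
  increasing position.\<close>

lemma star_interior:
  assumes h: "h \<in> halves" and u: "u \<in> {0<..<hlen h}"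
  obtains \<delta> where "\<delta> > 0" "\<delta> \<le> u" "\<delta> \<le> hlen h - u"
    "star_at \<Gamma> (half h u) (UNIV :: bool set) \<delta> (\<lambda>b t. half h (if b then u + t else u - t))"
proof -
  obtain \<delta> where \<delta>: "\<delta> > 0" "\<delta> \<le> u" "\<delta> \<le> hlen h - u"
    "ball (half h u) \<delta> \<inter> \<Gamma> = half h ` {u-\<delta><..<u+\<delta>}"
    "\<And>s t. s \<in> {u-\<delta><..<u+\<delta>} \<Longrightarrow> t \<in> {u-\<delta><..<u+\<delta>} \<Longrightarrow> dist (half h s) (half h t) = \<bar>s - t\<bar>"
    using h u by (rule half_interior) (rule that)
  have "{u-\<delta><..<u+\<delta>} = (+) u ` {0..<\<delta>} \<union> (-) u ` {0..<\<delta>}"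
  proof (intro subset_antisym subsetI)
    fix s assume s: "s \<in> {u-\<delta><..<u+\<delta>}"
    show "s \<in> (+) u ` {0..<\<delta>} \<union> (-) u ` {0..<\<delta>}"
    proof (cases "s \<ge> u")
      case True
      then show ?thesis using s by (intro UnI1 image_eqI[of _ _ "s - u"]) auto
    next
      case False
      then show ?thesis using s by (intro UnI2 image_eqI[of _ _ "u - s"]) auto
    qed
  qed (use \<delta>(1) in auto)
  note eq = this
  have img: "half h ` {u-\<delta><..<u+\<delta>} = (\<Union>b\<in>(UNIV :: bool set). (\<lambda>t. half h (if b then u + t else u - t)) ` {0..<\<delta>})"
    by (subst eq) (simp only: image_Un image_image UNIV_bool UN_insert UN_empty if_True if_False
      Un_empty_left Un_empty_right Un_commute)
  have "half h u \<in> half h ` {u-\<delta><..<u+\<delta>}" using \<delta>(1) by (intro imageI) auto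
  then have "ball (half h u) \<delta> \<inter> \<Gamma> =
      insert (half h u) (\<Union>b\<in>(UNIV :: bool set). (\<lambda>t. half h (if b then u + t else u - t)) ` {0..<\<delta>})"
    using \<delta>(4) img by auto
  moreover have "dist (half h (if i then u + s else u - s)) (half h (if j then u + t else u - t)) =
      (if i = j then \<bar>s - t\<bar> else s + t)" if "s \<in> {0..<\<delta>}" "t \<in> {0..<\<delta>}" for i j s t
  proof -
    have "(if i then u + s else u - s) \<in> {u-\<delta><..<u+\<delta>}" "(if j then u + t else u - t) \<in> {u-\<delta><..<u+\<delta>}"
      using that \<delta>(1) by auto
    from \<delta>(5)[OF this] show ?thesis using that by auto
  qed
  ultimately show thesis using \<delta>(1,2,3) by (intro that[of \<delta>]) (simp_all add: star_at_def)
qed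

lemma half_local_isometry_0:
  assumes h: "h \<in> halves"
  shows "\<exists>\<epsilon>>0. \<forall>s\<in>{0..hlen h}. \<forall>t\<in>{0..hlen h}. dist 0 s < \<epsilon> \<and> dist 0 t < \<epsilon> \<longrightarrow>
    dist (half h s) (half h t) = \<bar>s - t\<bar>"
proof -
  obtain \<delta> where \<delta>: "\<delta> > 0" "star_at \<Gamma> (src h) (out_halves (src h)) \<delta> half"
    using src(1)[OF h] by (rule star_vertex) (rule that)
  have "h \<in> out_halves (src h)" using h by (simp add: out_halves_def)
  then show ?thesis using star_at_D(5)[OF \<delta>(2)] \<delta>(1) by (intro exI[of _ \<delta>]) (auto simp: dist_real_def)
qed

text \<open>The path is isometric near every position, including the ends by means of the stars
  there, and compactness makes this uniform. No more can hold in general: distant positions on a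
  loop may be close in \<open>\<Gamma>\<close>.\<close>

lemma half_uniform_isometry:
  assumes h: "h \<in> halves"
  shows "\<exists>\<eta>>0. \<forall>s\<in>{0..hlen h}. \<forall>t\<in>{0..hlen h}. dist s t < \<eta> \<longrightarrow> dist (half h s) (half h t) = \<bar>s - t\<bar>"
proof (rule compact_uniform_locally)
  fix u assume "u \<in> {0..hlen h}"
  then consider "u = 0" | "u = hlen h" | "u \<in> {0<..<hlen h}" by fastforce
  then show "\<exists>\<epsilon>>0. \<forall>s\<in>{0..hlen h}. \<forall>t\<in>{0..hlen h}. dist u s < \<epsilon> \<and> dist u t < \<epsilon> \<longrightarrow>
    dist (half h s) (half h t) = \<bar>s - t\<bar>"
  proof cases
    case 1
    then show ?thesis using half_local_isometry_0[OF h] by simp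
  next
    case 2
    obtain \<epsilon> where \<epsilon>: "\<epsilon> > 0" "\<And>s t. s \<in> {0..hlen h} \<Longrightarrow> t \<in> {0..hlen h} \<Longrightarrow> dist 0 s < \<epsilon> \<Longrightarrow> dist 0 t < \<epsilon> \<Longrightarrow>
      dist (half (rev_half h) s) (half (rev_half h) t) = \<bar>s - t\<bar>"
      using half_local_isometry_0[of "rev_half h"] h by auto
    have "dist (half h s) (half h t) = \<bar>s - t\<bar>"
      if "s \<in> {0..hlen h}" "t \<in> {0..hlen h}" "dist u s < \<epsilon>" "dist u t < \<epsilon>" for s t
      using \<epsilon>(2)[of "hlen h - s" "hlen h - t"] that 2 by (auto simp: half_rev[OF h] dist_real_def)
    then show ?thesis using \<epsilon>(1) by blast
  next
    case 3
    obtain \<delta> where \<delta>: "\<delta> > 0"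
      "\<And>s t. s \<in> {u-\<delta><..<u+\<delta>} \<Longrightarrow> t \<in> {u-\<delta><..<u+\<delta>} \<Longrightarrow> dist (half h s) (half h t) = \<bar>s - t\<bar>"
      using h 3 by (rule half_interior) (rule that)
    have "dist (half h s) (half h t) = \<bar>s - t\<bar>" if "dist u s < \<delta>" "dist u t < \<delta>" for s t
      by (rule \<delta>(2)) (use that in \<open>auto simp: dist_real_def\<close>)
    then show ?thesis using \<delta>(1) by blast
  qed
qed simp

lemma continuous_on_half:
  assumes h: "h \<in> halves"
  shows "continuous_on {0..hlen h} (half h)"
proof -
  obtain \<eta> where \<eta>: "\<eta> > 0" "\<And>s t. s \<in> {0..hlen h} \<Longrightarrow> t \<in> {0..hlen h} \<Longrightarrow> dist s t < \<eta> \<Longrightarrow>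
      dist (half h s) (half h t) = \<bar>s - t\<bar>" using half_uniform_isometry[OF h] by blast
  show ?thesis
    unfolding continuous_on_iff
  proof (intro ballI allI impI)
    fix x e :: real assume "x \<in> {0..hlen h}" "e > 0"
    then show "\<exists>d>0. \<forall>x'\<in>{0..hlen h}. dist x' x < d \<longrightarrow> dist (half h x') (half h x) < e"
      using \<eta> by (intro exI[of _ "min \<eta> e"]) (auto simp: dist_real_def)
  qed
qed

text \<open>A point of \<open>C\<close> near the vertex \<open>w\<close> lies on a half-edge leaving
  \<open>w\<close>, which is then a direction of \<open>C\<close>. This computes the incidence map
  of \<open>model_graph\<close>.\<close>

lemma edge_ends:
  assumes C: "C \<in> edgeset"
  shows "closure C \<inter> U = {src (C, True), src (C, False)}"
proof (intro subset_antisym subsetI)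
  fix w assume w: "w \<in> closure C \<inter> U"
  then have "w \<in> U" by simp
  obtain \<delta> where \<delta>: "\<delta> > 0" "star_at \<Gamma> w (out_halves w) \<delta> half" "\<And>h. h \<in> out_halves w \<Longrightarrow> 2 * \<delta> \<le> hlen h"
    using \<open>w \<in> U\<close> by (rule star_vertex) (rule that)
  obtain y where y: "y \<in> C" "dist y w < \<delta>" using w \<delta>(1) by (auto simp: closure_approachable)
  have "y \<in> \<Gamma>" "dist w y < \<delta>" "y \<noteq> w" using y edge_subset[OF C] w by (auto simp: dist_commute)
  from star_at_cases[OF \<delta>(2) this] obtain h where h: "h \<in> out_halves w" "y = half h (dist w y)" .
  have "dist w y \<in> {0<..<hlen h}" using \<open>y \<noteq> w\<close> \<open>dist w y < \<delta>\<close> \<delta>(3)[OF h(1)] \<delta>(1) by auto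
  then have "y \<in> fst h" using half_in_edge[of h "dist w y"] h by (simp add: out_halves_def)
  moreover have "h \<in> halves" "src h = w" using h by (auto simp: out_halves_def)
  ultimately have "fst h = C" using edge_unique[OF halvesD C] y by blast
  then show "w \<in> {src (C, True), src (C, False)}"
    using \<open>src h = w\<close> by (cases h; cases "snd h") auto
next
  have "src (C, b) \<in> closure C" for b
    unfolding closure_approachable
  proof (intro allI impI)
    fix e :: real assume e: "e > 0"
    have h: "(C, b) \<in> halves" using C by (simp add: halves_def)
    obtain t where t: "t \<in> {0<..<e}" "t < hlen (C, b)" "dist (src (C, b)) (raw (C, b) t) < e"
      using src_accumulation[OF h e] by blast
    have "raw (C, b) t \<in> C" using edge_chart_mem[OF raw_chart[OF h], of t] t by simp
    then show "\<exists>y\<in>C. dist y (src (C, b)) < e" using t by (auto simp: dist_commute)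
  qed
  moreover have "src (C, b) \<in> U" for b using src(1)[of "(C, b)"] C by (simp add: halves_def)
  ultimately show "w \<in> closure C \<inter> U" if "w \<in> {src (C, True), src (C, False)}" for w using that by blast
qed

end

section \<open>Superstable divisors\<close>

lemma carrier_Div0_iff:
  "D \<in> carrier (Div0 S) \<longleftrightarrow>
     Poly_Mapping.keys D \<subseteq> S \<and> (\<Sum>x\<in>Poly_Mapping.keys D. Poly_Mapping.lookup D x) = 0"
  by (simp add: Div0_def)

lemma mult_Div0 [simp]: "D \<otimes>\<^bsub>Div0 S\<^esub> D' = D + D'"
  by (simp add: Div0_def free_Abelian_group_def)

lemma one_Div0 [simp]: "\<one>\<^bsub>Div0 S\<^esub> = 0"
  by (simp add: Div0_def)

lemma sum_lookup_keys:
  assumes "finite S" "Poly_Mapping.keys D \<subseteq> S"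
  shows "(\<Sum>x\<in>Poly_Mapping.keys D. Poly_Mapping.lookup D x) = (\<Sum>x\<in>S. Poly_Mapping.lookup D x)"
  using assms by (intro sum.mono_neutral_left) (auto simp: in_keys_iff)

lemma Div0_add_closed:
  assumes "D \<in> carrier (Div0 S)" "D' \<in> carrier (Div0 S)"
  shows "D + D' \<in> carrier (Div0 S)"
proof -
  let ?T = "Poly_Mapping.keys D \<union> Poly_Mapping.keys D'"
  have sub: "Poly_Mapping.keys (D + D') \<subseteq> ?T" by (rule keys_add)
  have "(\<Sum>x\<in>?T. Poly_Mapping.lookup (D + D') x) = 0"
    using assms sum_lookup_keys[of ?T D] sum_lookup_keys[of ?T D']
    by (simp add: carrier_Div0_iff lookup_add sum.distrib)
  then show ?thesis
    using assms sub sum_lookup_keys[OF _ sub] by (auto simp: carrier_Div0_iff)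
qed

lemma Div0_uminus_closed: "D \<in> carrier (Div0 S) \<Longrightarrow> - D \<in> carrier (Div0 S)"
  by (simp add: carrier_Div0_iff lookup_uminus sum_negf)

lemma Div0_diff_closed:
  "D \<in> carrier (Div0 S) \<Longrightarrow> D' \<in> carrier (Div0 S) \<Longrightarrow> D - D' \<in> carrier (Div0 S)"
  using Div0_add_closed[of D S "- D'"] Div0_uminus_closed[of D' S] by simp

lemma zero_in_Div0: "0 \<in> carrier (Div0 S)"
  by (simp add: carrier_Div0_iff)

lemma group_Div0: "group (Div0 S)"
proof (rule groupI)
  show "\<exists>y\<in>carrier (Div0 S). y \<otimes>\<^bsub>Div0 S\<^esub> x = \<one>\<^bsub>Div0 S\<^esub>" if "x \<in> carrier (Div0 S)" for x
    using Div0_uminus_closed[OF that] by (intro bexI[of _ "- x"]) auto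
qed (simp_all add: Div0_add_closed zero_in_Div0 add.assoc)

lemma inv_Div0:
  assumes "D \<in> carrier (Div0 S)"
  shows "inv\<^bsub>Div0 S\<^esub> D = - D"
  by (rule group.inv_equality[OF group_Div0]) (use assms Div0_uminus_closed in auto)

lemma Div0_mono: "S \<subseteq> T \<Longrightarrow> carrier (Div0 S) \<subseteq> carrier (Div0 T)"
  by (meson carrier_Div0_iff order_trans subsetI)

lemma subgroup_Div0:
  assumes "S \<subseteq> T"
  shows "subgroup (carrier (Div0 S)) (Div0 T)"
proof (rule group.subgroupI[OF group_Div0 Div0_mono[OF assms]])
  show "inv\<^bsub>Div0 T\<^esub> a \<in> carrier (Div0 S)" if "a \<in> carrier (Div0 S)" for a
    using Div0_uminus_closed[OF that] inv_Div0[of a T] Div0_mono[OF assms] that by (simp add: subset_iff)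
  show "carrier (Div0 S) \<noteq> {}" using zero_in_Div0[of S] by blast
qed (use Div0_add_closed in auto)

lemma adjacency_commute: "adjacency G v w = adjacency G w v"
  by (simp add: adjacency_def insert_commute eq_commute)

lemma lookup_Abs_finite:
  assumes "finite S"
  shows "Poly_Mapping.lookup (Abs_poly_mapping (\<lambda>v. if v \<in> S then f v else 0)) =
    (\<lambda>v. if v \<in> S then f v else 0)"
  by (rule lookup_Abs_poly_mapping) (rule finite_subset[OF _ assms], auto)

text \<open>The properties of a subdivision on which chip firing rests: finiteness, vanishing row
  sums of the Laplacian (\<open>val_eq\<close>), and connectedness in the form that a nonempty set
  missing the sink has an edge to its complement (\<open>boundary\<close>).\<close>

locale sink_graph =
  fixes G :: "('v, 'e) multigraph" and v0 :: 'v
  assumes finite_verts: "finite (verts G)" and sink: "v0 \<in> verts G"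
    and val_eq: "v \<in> verts G \<Longrightarrow> val G v = (\<Sum>w\<in>verts G. adjacency G v w)"
    and boundary: "A \<subseteq> verts G \<Longrightarrow> v0 \<notin> A \<Longrightarrow> A \<noteq> {} \<Longrightarrow>
      \<exists>v\<in>A. \<exists>w\<in>verts G - A. adjacency G v w > 0"
begin

text \<open>The full Laplacian, sink included, applied to a potential. Firing the vertices of
  \<open>A\<close> subtracts \<open>fire\<close> of the indicator of \<open>A\<close>.\<close>

definition fire :: "('v \<Rightarrow> int) \<Rightarrow> 'v \<Rightarrow> int" where
  "fire z v = (\<Sum>w\<in>verts G. laplacian G v w * z w)"

lemma fire_eq:
  assumes "v \<in> verts G"
  shows "fire z v = (\<Sum>w\<in>verts G. int (adjacency G v w) * (z v - z w))"
proof -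
  have "fire z v = (\<Sum>w\<in>verts G. (if v = w then int (val G v) * z w else 0))
      - (\<Sum>w\<in>verts G. int (adjacency G v w) * z w)"
    unfolding fire_def laplacian_def sum_subtractf[symmetric]
    by (intro sum.cong) (auto simp: algebra_simps)
  also have "(\<Sum>w\<in>verts G. (if v = w then int (val G v) * z w else 0)) = int (val G v) * z v"
    using finite_verts assms by simp
  finally show ?thesis
    using val_eq[OF assms] by (simp add: right_diff_distrib sum_subtractf sum_distrib_right)
qed

lemma fire_add: "fire (\<lambda>v. z v + z' v) v = fire z v + fire z' v"
  by (simp add: fire_def algebra_simps sum.distrib)

lemma fire_uminus: "fire (\<lambda>v. - z v) v = - fire z v"
  by (simp add: fire_def sum_negf)

lemma fire_diff: "fire (\<lambda>v. z v - z' v) v = fire z v - fire z' v"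
  by (simp add: fire_def algebra_simps sum_subtractf)

lemma fire_scale: "fire (\<lambda>v. c * z v) v = c * fire z v"
  by (simp add: fire_def sum_distrib_left algebra_simps)

lemma fire_shift: "v \<in> verts G \<Longrightarrow> fire (\<lambda>v. z v - c) v = fire z v"
  by (simp add: fire_eq)

text \<open>Symmetry of the Laplacian. It moves \<open>fire\<close> from an indicator to the
  potential \<open>h\<close> in the energy argument, and pairing with constants shows that
  \<open>fire z\<close> has degree 0.\<close>

lemma fire_self_adjoint: "(\<Sum>v\<in>verts G. h v * fire z v) = (\<Sum>v\<in>verts G. z v * fire h v)"
proof -
  have "laplacian G v w = laplacian G w v" for v w
    by (simp add: laplacian_def adjacency_commute[of G v w] eq_commute)
  then have "(\<Sum>v\<in>verts G. h v * fire z v) = (\<Sum>v\<in>verts G. \<Sum>w\<in>verts G. z w * (laplacian G w v * h v))"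
    by (simp add: fire_def sum_distrib_left algebra_simps)
  also have "\<dots> = (\<Sum>v\<in>verts G. z v * fire h v)"
    by (subst sum.swap) (simp add: fire_def sum_distrib_left)
  finally show ?thesis .
qed

lemma sum_fire: "(\<Sum>v\<in>verts G. fire z v) = 0"
  using fire_self_adjoint[of "\<lambda>_. 1" z] by (simp add: fire_eq)

lemma fire_indicator:
  assumes "A \<subseteq> verts G"
  shows "(\<Sum>w\<in>A. laplacian G v w) = fire (\<lambda>w. if w \<in> A then 1 else 0) v"
proof -
  have "fire (\<lambda>w. if w \<in> A then 1 else 0) v = (\<Sum>w\<in>verts G \<inter> A. laplacian G v w)"
    unfolding fire_def using finite_verts by (subst sum.inter_restrict) (auto intro: sum.cong)
  then show ?thesis using assms by (simp add: Int_absorb1)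
qed

text \<open>A substitute for the distance to the sink. A largest set \<open>S\<close> carrying such
  a rank is everything: otherwise an edge leads from some \<open>v\<close> outside \<open>S\<close>
  to some \<open>w\<close> in \<open>S\<close>, and \<open>v\<close> can be given the rank
  \<open>Suc (d w)\<close>.\<close>

lemma exists_rank:
  "\<exists>d::'v \<Rightarrow> nat. d v0 = 0 \<and> (\<forall>v\<in>verts G - {v0}. \<exists>w\<in>verts G. adjacency G v w > 0 \<and> d w < d v)"
proof -
  define P where "P S \<longleftrightarrow> S \<subseteq> verts G \<and> v0 \<in> S \<and> (\<exists>d::'v \<Rightarrow> nat. d v0 = 0 \<and>
    (\<forall>v\<in>S - {v0}. \<exists>w\<in>S. adjacency G v w > 0 \<and> d w < d v))" for S
  have "P {v0}" using sink by (auto simp: P_def)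
  moreover have "\<forall>S. P S \<longrightarrow> card S < Suc (card (verts G))"
    using finite_verts by (auto simp: P_def less_Suc_eq_le intro: card_mono)
  ultimately obtain S where S: "P S" "\<And>T. P T \<Longrightarrow> card T \<le> card S"
    using ex_has_greatest_nat[of P "{v0}" card "Suc (card (verts G))"] by auto
  obtain d :: "'v \<Rightarrow> nat" where d: "d v0 = 0" "\<forall>v\<in>S - {v0}. \<exists>w\<in>S. adjacency G v w > 0 \<and> d w < d v"
    using S(1) by (auto simp: P_def)
  have finS: "finite S" using S(1) finite_verts finite_subset by (auto simp: P_def)
  have "S = verts G"
  proof (rule ccontr)
    assume "S \<noteq> verts G"
    then have "verts G - S \<noteq> {}" using S(1) by (auto simp: P_def)
    then obtain v w where vw: "v \<in> verts G - S" "w \<in> S" "adjacency G v w > 0"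
      using boundary[of "verts G - S"] S(1) by (auto simp: P_def)
    have "v \<noteq> v0" using vw S(1) by (auto simp: P_def)
    have "\<exists>w'\<in>insert v S. adjacency G u w' > 0 \<and> (d(v := Suc (d w))) w' < (d(v := Suc (d w))) u"
      if u: "u \<in> insert v S - {v0}" for u
    proof (cases "u = v")
      case True
      have "w \<noteq> v" using vw by auto
      then show ?thesis using True vw by (intro bexI[of _ w]) auto
    next
      case False
      then obtain w' where w': "w' \<in> S" "adjacency G u w' > 0" "d w' < d u" using u d by blast
      have "w' \<noteq> v" using w' vw by auto
      then show ?thesis using False w' by (intro bexI[of _ w']) auto
    qed
    then have "P (insert v S)"
      unfolding P_def using vw S(1) \<open>v \<noteq> v0\<close> d(1)
      by (intro conjI exI[of _ "d(v := Suc (d w))"]) (auto simp: P_def)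
    then have "card (insert v S) \<le> card S" by (rule S(2))
    then show False using vw finS by simp
  qed
  then show ?thesis using d by auto
qed

text \<open>For \<open>h v = K ^ N - K ^ (N - d v)\<close>, the value \<open>fire h v\<close> is the
  sum of \<open>K ^ (N - d w)\<close> over the neighbours \<open>w\<close>, with multiplicity, minus
  \<open>val G v * K ^ (N - d v)\<close>. A neighbour of smaller rank alone contributes at least
  \<open>K * K ^ (N - d v)\<close> to the sum, so it is enough that \<open>K\<close> exceeds
  \<open>val G v\<close>.\<close>

lemma exists_potential:
  "\<exists>h. h v0 = 0 \<and> (\<forall>v\<in>verts G. h v \<ge> 0) \<and> (\<forall>v\<in>verts G - {v0}. fire h v \<ge> 1)"
proof -
  obtain d :: "'v \<Rightarrow> nat" where d0: "d v0 = 0"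
    and d: "\<And>v. v \<in> verts G - {v0} \<Longrightarrow> \<exists>w\<in>verts G. adjacency G v w > 0 \<and> d w < d v"
    using exists_rank by blast
  define N where "N = Max (d ` verts G)"
  have dN: "d v \<le> N" if "v \<in> verts G" for v
    using that finite_verts by (simp add: N_def)
  \<comment> \<open>One more than the sum of all valences exceeds each of them. As \<open>N\<close>
    is the largest rank, the natural subtractions \<open>N - d v\<close> are never
    truncated.\<close>
  define K :: int where "K = 1 + (\<Sum>v\<in>verts G. int (val G v))"
  have K1: "K \<ge> 1" by (simp add: K_def sum_nonneg)
  have Kval: "K \<ge> int (val G v) + 1" if "v \<in> verts G" for v
    unfolding K_def using member_le_sum[of v "verts G" "\<lambda>v. int (val G v)"] that finite_verts by auto
  define h where "h v = K ^ N - K ^ (N - d v)" for v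
  have "fire h v \<ge> 1" if v: "v \<in> verts G - {v0}" for v
  proof -
    obtain w where w: "w \<in> verts G" "adjacency G v w > 0" "d w < d v" using d[OF v] by auto
    have v': "v \<in> verts G" using v by simp
    have "K * K ^ (N - d v) = K ^ Suc (N - d v)" by simp
    also have "\<dots> \<le> K ^ (N - d w)"
      by (rule power_increasing) (use w dN[OF v'] K1 in auto)
    also have "\<dots> \<le> int (adjacency G v w) * K ^ (N - d w)"
      using w(2) K1 by (simp add: mult_le_cancel_right1)
    also have "\<dots> \<le> (\<Sum>w\<in>verts G. int (adjacency G v w) * K ^ (N - d w))"
      using K1 by (intro member_le_sum[OF w(1) _ finite_verts]) auto
    finally have 1: "K * K ^ (N - d v) \<le> (\<Sum>w\<in>verts G. int (adjacency G v w) * K ^ (N - d w))" .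
    have "fire h v = (\<Sum>w\<in>verts G. int (adjacency G v w) * (K ^ (N - d w) - K ^ (N - d v)))"
      by (simp add: fire_eq[OF v'] h_def)
    also have "\<dots> = (\<Sum>w\<in>verts G. int (adjacency G v w) * K ^ (N - d w)) - int (val G v) * K ^ (N - d v)"
      by (simp add: right_diff_distrib sum_subtractf val_eq[OF v'] sum_distrib_right)
    finally have "fire h v \<ge> (K - int (val G v)) * K ^ (N - d v)"
      using 1 by (simp add: algebra_simps)
    moreover have "1 * 1 \<le> (K - int (val G v)) * K ^ (N - d v)"
      by (rule mult_mono) (use Kval[OF v'] K1 in auto)
    ultimately show ?thesis by linarith
  qed
  moreover have "h v \<ge> 0" for v
    unfolding h_def using power_increasing[of "N - d v" N K] K1 by simp
  ultimately show ?thesis using d0 by (intro exI[of _ h]) (auto simp: h_def)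
qed

text \<open>\<open>superstable\<close> for arbitrary integer functions: there is no degree
  condition, and the value at the sink is unconstrained.\<close>

definition stable :: "('v \<Rightarrow> int) \<Rightarrow> bool" where
  "stable y \<longleftrightarrow> (\<forall>v\<in>verts G - {v0}. y v \<ge> 0) \<and>
     \<not> (\<exists>A. A \<noteq> {} \<and> A \<subseteq> verts G - {v0} \<and>
          (\<forall>v\<in>verts G - {v0}. y v - fire (\<lambda>w. if w \<in> A then 1 else 0) v \<ge> 0))"

lemma stable_nonneg: "stable y \<Longrightarrow> v \<in> verts G - {v0} \<Longrightarrow> y v \<ge> 0"
  by (simp add: stable_def)

lemma superstable_iff:
  "superstable G v0 D \<longleftrightarrow> D \<in> carrier (Div0 (verts G)) \<and> stable (Poly_Mapping.lookup D)"
proof -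
  have *: "A \<subseteq> verts G - {v0} \<Longrightarrow> (\<Sum>w\<in>A. laplacian G v w) = fire (\<lambda>w. if w \<in> A then 1 else 0) v" for A v
    by (rule fire_indicator) auto
  have "(\<exists>A. A \<noteq> {} \<and> A \<subseteq> verts G - {v0} \<and>
          (\<forall>v \<in> verts G - {v0}. Poly_Mapping.lookup D v - (\<Sum>w\<in>A. laplacian G v w) \<ge> 0)) \<longleftrightarrow>
        (\<exists>A. A \<noteq> {} \<and> A \<subseteq> verts G - {v0} \<and>
          (\<forall>v \<in> verts G - {v0}. Poly_Mapping.lookup D v - fire (\<lambda>w. if w \<in> A then 1 else 0) v \<ge> 0))"
    by (rule ex_cong1) (metis *)
  then show ?thesis unfolding superstable_def stable_def by blast
qed

text \<open>Firing a set off the sink decreases the pairing with the potential \<open>h\<close>, so a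
  representative minimising this pairing is superstable.\<close>

lemma exists_stable: "\<exists>z. stable (\<lambda>v. x v + fire z v)"
proof -
  obtain h where h0: "h v0 = 0" and h: "\<And>v. v \<in> verts G \<Longrightarrow> h v \<ge> 0"
    and fh: "\<And>v. v \<in> verts G - {v0} \<Longrightarrow> fire h v \<ge> 1"
  proof -
    obtain h where "h v0 = 0 \<and> (\<forall>v\<in>verts G. h v \<ge> 0) \<and> (\<forall>v\<in>verts G - {v0}. fire h v \<ge> 1)"
      using exists_potential by (elim exE)
    then show thesis by (intro that[of h]) simp_all
  qed
  define y where "y z v = x v + fire z v" for z v
  \<comment> \<open>The energy to be minimised. It is nonnegative on \<open>P\<close>, because
    \<open>h\<close> vanishes at the sink, the only vertex where \<open>y z\<close> may be
    negative.\<close>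
  define E where "E z = (\<Sum>v\<in>verts G. h v * y z v)" for z
  define P where "P z \<longleftrightarrow> (\<forall>v\<in>verts G - {v0}. y z v \<ge> 0)" for z
  have E_nonneg: "E z \<ge> 0" if "P z" for z
    unfolding E_def
  proof (rule sum_nonneg)
    fix v assume "v \<in> verts G"
    then show "0 \<le> h v * y z v" using h h0 that by (cases "v = v0") (auto simp: P_def)
  qed
  \<comment> \<open>The factor \<open>M\<close> bounds every \<open>\<bar>x v\<bar>\<close>, so
    \<open>M\<close> times \<open>h\<close> makes the configuration nonnegative off the sink, and
    \<open>P\<close> is not empty.\<close>
  define M where "M = (\<Sum>v\<in>verts G. \<bar>x v\<bar>)"
  have "P (\<lambda>v. M * h v)"
    unfolding P_def y_def fire_scale
  proof
    fix v assume v: "v \<in> verts G - {v0}"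
    have "\<bar>x v\<bar> \<le> M" unfolding M_def using v finite_verts by (intro member_le_sum) auto
    moreover have "M * 1 \<le> M * fire h v"
      using fh[OF v] by (intro mult_left_mono) (auto simp: M_def sum_nonneg)
    ultimately show "0 \<le> x v + M * fire h v" by linarith
  qed
  then obtain z where z: "P z" "\<And>z'. P z' \<Longrightarrow> nat (E z) \<le> nat (E z')"
    using ex_has_least_nat[of P _ "\<lambda>z. nat (E z)"] by blast
  have "stable (y z)"
    unfolding stable_def
  proof (intro conjI notI)
    show "\<forall>v\<in>verts G - {v0}. 0 \<le> y z v" using z(1) by (simp add: P_def)
    assume "\<exists>A. A \<noteq> {} \<and> A \<subseteq> verts G - {v0} \<and>
          (\<forall>v\<in>verts G - {v0}. y z v - fire (\<lambda>w. if w \<in> A then 1 else 0) v \<ge> 0)"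
    then obtain A where A: "A \<noteq> {}" "A \<subseteq> verts G - {v0}"
      "\<forall>v\<in>verts G - {v0}. y z v - fire (\<lambda>w. if w \<in> A then 1 else 0) v \<ge> 0" by blast
    define i :: "'v \<Rightarrow> int" where "i = (\<lambda>w. if w \<in> A then 1 else 0)"
    define z' where "z' v = z v - i v" for v
    have y': "y z' v = y z v - fire i v" for v
      unfolding y_def z'_def fire_diff by simp
    have "P z'" unfolding P_def y' using A(3) by (simp add: i_def)
    then have le: "E z \<le> E z'" using z(2) E_nonneg[OF z(1)] E_nonneg by fastforce
    \<comment> \<open>By adjointness firing \<open>A\<close> lowers the energy by the sum of
      \<open>fire h\<close> over \<open>A\<close>, which is positive as \<open>A\<close> avoids the
      sink.\<close>
    have "E z' = E z - (\<Sum>v\<in>verts G. h v * fire i v)"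
      unfolding E_def y' by (simp add: right_diff_distrib sum_subtractf)
    also have "(\<Sum>v\<in>verts G. h v * fire i v) = (\<Sum>v\<in>verts G. if v \<in> A then fire h v else 0)"
      by (subst fire_self_adjoint) (intro sum.cong, auto simp: i_def)
    also have "\<dots> = (\<Sum>v\<in>A. fire h v)"
      using A(2) finite_verts by (subst sum.inter_restrict[symmetric]) (auto intro!: sum.cong)
    finally have "E z' = E z - (\<Sum>v\<in>A. fire h v)" .
    moreover have "(\<Sum>v\<in>A. fire h v) > 0"
    proof (rule sum_pos)
      show "finite A" using A(2) finite_verts by (rule_tac finite_subset) auto
      show "0 < fire h v" if "v \<in> A" for v using fh[of v] A(2) that by fastforce
    qed (rule A(1))
    ultimately show False using le by linarith
  qed
  then show ?thesis unfolding y_def by blast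
qed

text \<open>Let \<open>A\<close> be the set where \<open>z\<close> is maximal; it misses the sink if
  the maximum is positive. Being integral, \<open>z\<close> drops by at least 1 from
  \<open>A\<close> to its complement, so firing \<open>A\<close> takes away no more than
  \<open>fire z\<close> on \<open>A\<close> and leaves at least \<open>y\<close>, while off
  \<open>A\<close> it only adds. Thus \<open>A\<close> could be fired from \<open>y'\<close>,
  against stability.\<close>

lemma stable_unique_aux:
  assumes st: "stable y'" and y: "\<And>v. v \<in> verts G - {v0} \<Longrightarrow> y v \<ge> 0"
    and eq: "\<And>v. v \<in> verts G - {v0} \<Longrightarrow> y' v = y v + fire z v" and z0: "z v0 = 0"
    and v: "v \<in> verts G"
  shows "z v \<le> 0"
proof (rule ccontr)
  assume "\<not> z v \<le> 0"
  define M where "M = Max (z ` verts G)"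
  have M: "z w \<le> M" if "w \<in> verts G" for w using that finite_verts by (simp add: M_def)
  have "M > 0" using M[OF v] \<open>\<not> z v \<le> 0\<close> by simp
  define A where "A = {w \<in> verts G. z w = M}"
  have "M \<in> z ` verts G" unfolding M_def using finite_verts sink by (intro Max_in) auto
  then have A: "A \<noteq> {}" "A \<subseteq> verts G - {v0}" using \<open>M > 0\<close> z0 by (auto simp: A_def)
  have legal: "y' w - fire (\<lambda>w. if w \<in> A then 1 else 0) w \<ge> 0" if w: "w \<in> verts G - {v0}" for w
  proof (cases "w \<in> A")
    case True
    have "fire (\<lambda>w. if w \<in> A then 1 else 0) w \<le> fire z w"
    proof -
      have "z w = M" using True by (simp add: A_def)
      have "(1::int) - (if u \<in> A then 1 else 0) \<le> z w - z u" if "u \<in> verts G" for u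
        using M[OF that] that \<open>z w = M\<close> by (auto simp: A_def)
      then show ?thesis
        using w True by (simp add: fire_eq sum_mono mult_left_mono)
    qed
    then show ?thesis using eq[OF w] y[OF w] by simp
  next
    case False
    have "fire (\<lambda>w. if w \<in> A then 1 else 0) w \<le> 0"
      using w False by (simp add: fire_eq sum_nonpos)
    then show ?thesis using stable_nonneg[OF st w] by simp
  qed
  have "\<not> (A \<noteq> {} \<and> A \<subseteq> verts G - {v0} \<and>
      (\<forall>v\<in>verts G - {v0}. y' v - fire (\<lambda>w. if w \<in> A then 1 else 0) v \<ge> 0))"
    using st[unfolded stable_def, THEN conjunct2] by (rule contrapos_nn) (rule exI)
  then show False using A legal by simp
qed

text \<open>Subtracting a constant from \<open>z\<close> does not change \<open>fire z\<close>, so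
  \<open>z\<close> may be taken to vanish at the sink. The maximum principle in both directions then
  makes it vanish on all vertices.\<close>

lemma stable_unique:
  assumes "stable y" "stable y'" and eq: "\<And>v. v \<in> verts G \<Longrightarrow> y' v = y v + fire z v"
    and v: "v \<in> verts G"
  shows "y' v = y v"
proof -
  define z' where "z' v = z v - z v0" for v
  have f: "fire z' w = fire z w" if "w \<in> verts G" for w
    unfolding z'_def using fire_shift[OF that] by simp
  have z'0: "z' v0 = 0" by (simp add: z'_def)
  have "z' w \<le> 0" if "w \<in> verts G" for w
    by (rule stable_unique_aux[OF assms(2), of y])
      (use assms(1,3) that f z'0 stable_nonneg in auto)
  moreover have "- z' w \<le> 0" if "w \<in> verts G" for w
  proof (rule stable_unique_aux[OF assms(1), of y' "\<lambda>v. - z' v"])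
    show "y v = y' v + fire (\<lambda>v. - z' v) v" if "v \<in> verts G - {v0}" for v
      using assms(3)[of v] f[of v] that by (simp add: fire_uminus)
  qed (use stable_nonneg[OF assms(2)] z'0 that in auto)
  ultimately have "z' w = 0" if "w \<in> verts G" for w
    using that by force
  then have "fire z' v = 0" by (simp add: fire_def)
  then show ?thesis using eq f v by simp
qed

text \<open>Off the sink, the reduced and the full Laplacian have the same image: subtracting
  \<open>z v0\<close> from the potential preserves \<open>fire\<close> and kills the contribution of
  the column of the sink.\<close>

lemma laplacian_lattice_iff:
  "x \<in> laplacian_lattice G v0 \<longleftrightarrow> Poly_Mapping.keys x \<subseteq> verts G - {v0} \<and>
     (\<exists>z. \<forall>v\<in>verts G - {v0}. Poly_Mapping.lookup x v = fire z v)" (is "?l \<longleftrightarrow> ?k \<and> ?r")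
proof
  have split: "fire z v = (\<Sum>w\<in>verts G - {v0}. laplacian G v w * z w)" if "z v0 = 0" for z v
    unfolding fire_def using finite_verts sink that by (simp add: sum.remove[of _ v0])
  {
    assume ?l
    then obtain z where "?k" and z: "Poly_Mapping.keys z \<subseteq> verts G - {v0}"
      "\<forall>v \<in> verts G - {v0}. Poly_Mapping.lookup x v =
          (\<Sum>w \<in> verts G - {v0}. laplacian G v w * Poly_Mapping.lookup z w)"
      by (auto simp: laplacian_lattice_def config_group_def)
    have "Poly_Mapping.lookup z v0 = 0" using z(1) by (auto simp: in_keys_iff)
    then show "?k \<and> ?r" using z(2) split \<open>?k\<close> by (auto intro!: exI[of _ "Poly_Mapping.lookup z"])
  next
    assume "?k \<and> ?r"
    then obtain z where "?k" and z: "\<forall>v\<in>verts G - {v0}. Poly_Mapping.lookup x v = fire z v" by blast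
    define z' where "z' = Abs_poly_mapping (\<lambda>v. if v \<in> verts G - {v0} then z v - z v0 else 0)"
    have l: "Poly_Mapping.lookup z' = (\<lambda>v. if v \<in> verts G - {v0} then z v - z v0 else 0)"
      unfolding z'_def by (rule lookup_Abs_finite) (use finite_verts in simp)
    have "fire z v = (\<Sum>w\<in>verts G - {v0}. laplacian G v w * Poly_Mapping.lookup z' w)"
      if "v \<in> verts G - {v0}" for v
    proof -
      have "fire z v = fire (\<lambda>v. z v - z v0) v" using fire_shift that by simp
      also have "\<dots> = (\<Sum>w\<in>verts G - {v0}. laplacian G v w * (z w - z v0))"
        by (rule split) simp
      finally show ?thesis using l by simp
    qed
    moreover have "Poly_Mapping.keys z' \<subseteq> verts G - {v0}"
      using l by (auto simp: in_keys_iff split: if_splits)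
    ultimately show ?l
      using z \<open>?k\<close> by (auto simp: laplacian_lattice_def config_group_def)
  }
qed

section \<open>Classes in the critical group\<close>

lemma normal_laplacian_lattice: "laplacian_lattice G v0 \<lhd> config_group G v0"
proof -
  interpret comm_group "config_group G v0"
    unfolding config_group_def by (rule abelian_free_Abelian_group)
  have "subgroup (laplacian_lattice G v0) (config_group G v0)"
  proof (rule subgroupI)
    show "laplacian_lattice G v0 \<subseteq> carrier (config_group G v0)"
      by (auto simp: laplacian_lattice_def)
    have "0 \<in> laplacian_lattice G v0"
      by (auto simp: laplacian_lattice_iff fire_def intro!: exI[of _ "\<lambda>_. 0"])
    then show "laplacian_lattice G v0 \<noteq> {}" by auto
  next
    fix a assume a: "a \<in> laplacian_lattice G v0"
    then obtain z where "\<forall>v\<in>verts G - {v0}. Poly_Mapping.lookup a v = fire z v"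
      by (auto simp: laplacian_lattice_iff)
    then have "- a \<in> laplacian_lattice G v0"
      using a by (auto simp: laplacian_lattice_iff fire_uminus lookup_uminus intro!: exI[of _ "\<lambda>v. - z v"])
    then show "inv\<^bsub>config_group G v0\<^esub> a \<in> laplacian_lattice G v0"
      using a by (simp add: config_group_def laplacian_lattice_iff)
  next
    fix a b assume a: "a \<in> laplacian_lattice G v0" and b: "b \<in> laplacian_lattice G v0"
    then obtain z z' where "\<forall>v\<in>verts G - {v0}. Poly_Mapping.lookup a v = fire z v"
      "\<forall>v\<in>verts G - {v0}. Poly_Mapping.lookup b v = fire z' v"
      by (auto simp: laplacian_lattice_iff)
    then have "a + b \<in> laplacian_lattice G v0"
      using a b keys_add[of a b]
      by (auto simp: laplacian_lattice_iff fire_add lookup_add intro!: exI[of _ "\<lambda>v. z v + z' v"])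
    then show "a \<otimes>\<^bsub>config_group G v0\<^esub> b \<in> laplacian_lattice G v0"
      by (simp add: config_group_def)
  qed
  then show ?thesis by (rule subgroup_imp_normal)
qed

lemma group_critical_group: "group (critical_group G v0)"
  unfolding critical_group_def by (rule normal.factorgroup_is_group[OF normal_laplacian_lattice])

lemma update_in_config:
  "D \<in> carrier (Div0 (verts G)) \<Longrightarrow> Poly_Mapping.update v0 0 D \<in> carrier (config_group G v0)"
  by (auto simp: carrier_Div0_iff config_group_def keys_update)

lemma update_add:
  "Poly_Mapping.update v0 0 (D + D') = Poly_Mapping.update v0 0 D + Poly_Mapping.update v0 (0::int) D'"
  by (rule poly_mapping_eqI) (simp add: lookup_update lookup_add)

lemma divisor_class_add:
  assumes "D \<in> carrier (Div0 (verts G))" "D' \<in> carrier (Div0 (verts G))"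
  shows "divisor_class G v0 (D + D') =
    divisor_class G v0 D \<otimes>\<^bsub>critical_group G v0\<^esub> divisor_class G v0 D'"
  using normal.rcos_sum[OF normal_laplacian_lattice update_in_config[OF assms(1)] update_in_config[OF assms(2)]]
  by (simp add: divisor_class_def critical_group_def update_add config_group_def)

text \<open>Agreement of \<open>D\<close> and \<open>fire z\<close> off the sink forces agreement at
  the sink, since both have sum 0.\<close>

lemma update_in_lattice_iff:
  assumes D: "D \<in> carrier (Div0 (verts G))"
  shows "Poly_Mapping.update v0 0 D \<in> laplacian_lattice G v0 \<longleftrightarrow>
    (\<exists>z. \<forall>v\<in>verts G. Poly_Mapping.lookup D v = fire z v)"
proof -
  have v0: "Poly_Mapping.lookup D v0 = fire z v0"
    if "\<forall>v\<in>verts G - {v0}. Poly_Mapping.lookup D v = fire z v" for z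
  proof -
    have "(\<Sum>v\<in>verts G. Poly_Mapping.lookup D v) = (\<Sum>v\<in>verts G. fire z v)"
      using D sum_lookup_keys[OF finite_verts, of D] by (simp add: carrier_Div0_iff sum_fire)
    moreover have "(\<Sum>v\<in>verts G - {v0}. Poly_Mapping.lookup D v) = (\<Sum>v\<in>verts G - {v0}. fire z v)"
      using that by (intro sum.cong) auto
    ultimately show ?thesis using finite_verts sink by (simp add: sum.remove[of _ v0])
  qed
  have "Poly_Mapping.keys (Poly_Mapping.update v0 0 D) \<subseteq> verts G - {v0}"
    using D by (auto simp: keys_update carrier_Div0_iff)
  then have "Poly_Mapping.update v0 0 D \<in> laplacian_lattice G v0 \<longleftrightarrow>
      (\<exists>z. \<forall>v\<in>verts G - {v0}. Poly_Mapping.lookup D v = fire z v)"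
    by (auto simp: laplacian_lattice_iff lookup_update)
  then show ?thesis using v0 by blast
qed

lemma divisor_class_eq_one_iff:
  assumes "D \<in> carrier (Div0 (verts G))"
  shows "divisor_class G v0 D = \<one>\<^bsub>critical_group G v0\<^esub> \<longleftrightarrow>
    (\<exists>z. \<forall>v\<in>verts G. Poly_Mapping.lookup D v = fire z v)"
proof -
  interpret N: normal "laplacian_lattice G v0" "config_group G v0" by (rule normal_laplacian_lattice)
  have "divisor_class G v0 D = laplacian_lattice G v0 \<longleftrightarrow>
      Poly_Mapping.update v0 0 D \<in> laplacian_lattice G v0"
    unfolding divisor_class_def
    using N.coset_join1[OF _ update_in_config[OF assms] N.is_subgroup]
      N.coset_join2[OF update_in_config[OF assms] N.is_subgroup] by blast
  then show ?thesis using update_in_lattice_iff[OF assms] by (simp add: critical_group_def)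
qed

text \<open>Deleting the coefficient at the sink is surjective onto configurations: that coefficient
  can be chosen to make the degree 0.\<close>

lemma carrier_critical_group: "carrier (critical_group G v0) = divisor_class G v0 ` carrier (Div0 (verts G))"
proof -
  have "x \<in> (\<lambda>D. Poly_Mapping.update v0 0 D) ` carrier (Div0 (verts G))"
    if "Poly_Mapping.keys x \<subseteq> verts G - {v0}" for x :: "'v \<Rightarrow>\<^sub>0 int"
  proof
    define D where "D = Poly_Mapping.update v0 (- (\<Sum>v\<in>verts G. Poly_Mapping.lookup x v)) x"
    have x0: "Poly_Mapping.lookup x v0 = 0" using that by (auto simp: in_keys_iff)
    have k: "Poly_Mapping.keys D \<subseteq> verts G" using that sink by (auto simp: D_def keys_update)
    have "(\<Sum>v\<in>verts G - {v0}. Poly_Mapping.lookup D v) = (\<Sum>v\<in>verts G - {v0}. Poly_Mapping.lookup x v)"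
      by (intro sum.cong) (auto simp: D_def lookup_update)
    moreover have "Poly_Mapping.lookup D v0 = - (\<Sum>v\<in>verts G - {v0}. Poly_Mapping.lookup x v)"
      using finite_verts sink x0 by (simp add: sum.remove[of _ v0] D_def lookup_update)
    ultimately have "(\<Sum>v\<in>verts G. Poly_Mapping.lookup D v) = 0"
      using finite_verts sink by (simp add: sum.remove[of _ v0])
    then show "D \<in> carrier (Div0 (verts G))"
      using k sum_lookup_keys[OF finite_verts k] by (simp add: carrier_Div0_iff)
    show "x = Poly_Mapping.update v0 0 D"
      using x0 by (intro poly_mapping_eqI) (auto simp: D_def lookup_update)
  qed
  then have "carrier (config_group G v0) = Poly_Mapping.update v0 0 ` carrier (Div0 (verts G))"
    using update_in_config by (fastforce simp: config_group_def)
  then show ?thesis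
    by (simp add: critical_group_def carrier_FactGroup divisor_class_def[abs_def] image_image)
qed

lemma divisor_class_eq_iff:
  assumes "D \<in> carrier (Div0 (verts G))" "D' \<in> carrier (Div0 (verts G))"
  shows "divisor_class G v0 D = divisor_class G v0 D' \<longleftrightarrow>
    (\<exists>z. \<forall>v\<in>verts G. Poly_Mapping.lookup D v = Poly_Mapping.lookup D' v + fire z v)"
proof -
  interpret K: group "critical_group G v0" by (rule group_critical_group)
  have D: "D - D' \<in> carrier (Div0 (verts G))" using assms by (rule Div0_diff_closed)
  have c: "divisor_class G v0 E \<in> carrier (critical_group G v0)" if "E \<in> carrier (Div0 (verts G))" for E
    using that carrier_critical_group by blast
  have "divisor_class G v0 D =
      divisor_class G v0 (D - D') \<otimes>\<^bsub>critical_group G v0\<^esub> divisor_class G v0 D'"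
    using divisor_class_add[OF D assms(2)] by simp
  then have "divisor_class G v0 D = divisor_class G v0 D' \<longleftrightarrow>
      divisor_class G v0 (D - D') = \<one>\<^bsub>critical_group G v0\<^esub>"
    using c[OF D] c[OF assms(2)] by (metis K.r_cancel_one)
  then show ?thesis
    unfolding divisor_class_eq_one_iff[OF D] by (simp add: lookup_minus algebra_simps)
qed

lemma superstable_divisor_class_unique:
  assumes "superstable G v0 D" "superstable G v0 D'" "divisor_class G v0 D = divisor_class G v0 D'"
  shows "D = D'"
proof (rule poly_mapping_eqI)
  fix v
  obtain z where z: "\<forall>v\<in>verts G. Poly_Mapping.lookup D v = Poly_Mapping.lookup D' v + fire z v"
    using divisor_class_eq_iff assms superstable_iff by blast
  show "Poly_Mapping.lookup D v = Poly_Mapping.lookup D' v"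
  proof (cases "v \<in> verts G")
    case True
    then show ?thesis using stable_unique[of "Poly_Mapping.lookup D'" "Poly_Mapping.lookup D" z] assms z
      by (simp add: superstable_iff)
  next
    case False
    then show ?thesis using assms unfolding superstable_iff carrier_Div0_iff
      by (metis in_keys_iff subsetD)
  qed
qed

lemma exists_superstable:
  assumes D: "D \<in> carrier (Div0 (verts G))"
  shows "\<exists>D'. superstable G v0 D' \<and> divisor_class G v0 D' = divisor_class G v0 D"
proof -
  obtain z where z: "stable (\<lambda>v. Poly_Mapping.lookup D v + fire z v)" using exists_stable by blast
  define D' where "D' = Abs_poly_mapping (\<lambda>v. if v \<in> verts G then Poly_Mapping.lookup D v + fire z v else 0)"
  have l: "Poly_Mapping.lookup D' = (\<lambda>v. if v \<in> verts G then Poly_Mapping.lookup D v + fire z v else 0)"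
    unfolding D'_def by (rule lookup_Abs_finite[OF finite_verts])
  have k: "Poly_Mapping.keys D' \<subseteq> verts G" using l by (auto simp: in_keys_iff split: if_splits)
  have "(\<Sum>v\<in>verts G. Poly_Mapping.lookup D' v) = 0"
    using D sum_lookup_keys[OF finite_verts, of D] by (simp add: l sum.distrib sum_fire carrier_Div0_iff)
  then have D': "D' \<in> carrier (Div0 (verts G))"
    using k sum_lookup_keys[OF finite_verts k] by (simp add: carrier_Div0_iff)
  have "stable (Poly_Mapping.lookup D')" using z unfolding stable_def l by auto
  moreover have "divisor_class G v0 D' = divisor_class G v0 D"
    using divisor_class_eq_iff[OF D' D] l by auto
  ultimately show ?thesis using D' by (intro exI[of _ D'] conjI) (simp_all add: superstable_iff)
qed

text \<open>Existence and uniqueness give the definite description in \<open>extension_map\<close> a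
  meaning. What is retained of its value is that it is a divisor of degree 0 in the class of
  \<open>D\<close>.\<close>

lemma the_superstable:
  assumes "D \<in> carrier (Div0 (verts G))"
  defines "D' \<equiv> THE D'. superstable G v0 D' \<and> divisor_class G v0 D' = divisor_class G v0 D"
  shows "D' \<in> carrier (Div0 (verts G))" "divisor_class G v0 D' = divisor_class G v0 D"
proof -
  have "\<exists>!D'. superstable G v0 D' \<and> divisor_class G v0 D' = divisor_class G v0 D"
    using exists_superstable[OF assms(1)]
  proof (elim exE, intro ex1I)
    fix E E'
    assume "superstable G v0 E \<and> divisor_class G v0 E = divisor_class G v0 D"
      "superstable G v0 E' \<and> divisor_class G v0 E' = divisor_class G v0 D"
    then show "E' = E" using superstable_divisor_class_unique[of E' E] by simp
  qed
  from theI'[OF this] show "D' \<in> carrier (Div0 (verts G))" "divisor_class G v0 D' = divisor_class G v0 D"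
    unfolding D'_def superstable_iff by auto
qed

end

section \<open>Principal divisors and the Laplacian\<close>

context charted_model
begin

text \<open>The affine interpolation is the same from either end of an edge, so it can be defined
  along the chart direction and transferred by reversal. A point off \<open>U\<close> determines its
  edge and its position there.\<close>

lemma exists_edgewise_affine:
  "\<exists>f. (\<forall>w\<in>U. f w = z w) \<and> (\<forall>h\<in>halves. \<forall>t\<in>{0..hlen h}.
     f (half h t) = z (src h) + (z (src (rev_half h)) - z (src h)) / hlen h * t)"
proof -
  define val where "val h t = z (src h) + (z (src (rev_half h)) - z (src h)) / hlen h * t" for h t
  have val_rev: "val (rev_half h) t = val h (hlen h - t)" if "h \<in> halves" for h t
    using hlen_pos[OF that] by (simp add: val_def field_simps)
  define rep where "rep x y \<longleftrightarrow> (\<exists>C t. (C, True) \<in> halves \<and> t \<in> {0<..<hlen (C, True)} \<and>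
    x = half (C, True) t \<and> y = val (C, True) t)" for x y
  define f where "f x = (if x \<in> U then z x else (SOME y. rep x y))" for x
  have f_True: "f (half (C, True) t) = val (C, True) t"
    if h: "(C, True) \<in> halves" and t: "t \<in> {0<..<hlen (C, True)}" for C t
  proof -
    have "rep (half (C, True) t) (val (C, True) t)" using h t unfolding rep_def by blast
    moreover have "y = val (C, True) t" if y: "rep (half (C, True) t) y" for y
    proof -
      obtain C' t' where *: "(C', True) \<in> halves" "t' \<in> {0<..<hlen (C', True)}"
        "half (C, True) t = half (C', True) t'" "y = val (C', True) t'"
        using y unfolding rep_def by blast
      have "C' = C" using edge_unique[of C' C "half (C, True) t"] half_in_edge[OF h t] half_in_edge[OF *(1,2)]
          *(1,3) h by (simp add: halves_def)
      then show ?thesis using half_inj[OF h t, of t'] * by simp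
    qed
    ultimately have "(SOME y. rep (half (C, True) t) y) = val (C, True) t"
      by (rule some_equality)
    then show ?thesis using half_notin_U[OF h t] by (simp add: f_def)
  qed
  have f_half: "f (half h t) = val h t" if h: "h \<in> halves" and t: "t \<in> {0..hlen h}" for h t
  proof -
    consider "t = 0" | "t = hlen h" | "t \<in> {0<..<hlen h}" using t by fastforce
    then show ?thesis
    proof cases
      case 1
      then show ?thesis using src(1)[OF h] by (simp add: f_def val_def)
    next
      case 2
      then show ?thesis using src(1)[of "rev_half h"] h hlen_pos[OF h] by (simp add: f_def val_def)
    next
      case 3
      obtain C b where hC: "h = (C, b)" by (cases h)
      show ?thesis
      proof (cases b)
        case True
        then show ?thesis using f_True h 3 hC by simp
      next
        case False
        then have r: "rev_half h = (C, True)" using hC by (simp add: rev_half_def)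
        have "hlen (C, True) = hlen h" by (metis r rev_half_simps(2))
        then have "f (half (rev_half h) (hlen h - t)) = val (rev_half h) (hlen h - t)"
          using f_True[of C "hlen h - t"] h 3 r rev_half_simps(4)[of h] by simp
        then show ?thesis using half_rev[OF h] val_rev[OF h] by simp
      qed
    qed
  qed
  then show ?thesis unfolding val_def by (intro exI[of _ f]) (simp add: f_def)
qed

text \<open>At an interior point of an edge the two directions have opposite slopes, which cancel;
  at a vertex the legs are the half-edges leaving it. Continuity follows from the existence of the
  orders.\<close>

lemma exists_tropical:
  fixes s :: "'a set \<times> bool \<Rightarrow> int"
  assumes s: "\<And>h. h \<in> halves \<Longrightarrow> z (src (rev_half h)) = z (src h) + of_int (s h) * hlen h"
  shows "\<exists>f. tropical_rational \<Gamma> f \<and>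
    (\<forall>h\<in>halves. \<forall>t\<in>{0..hlen h}. f (half h t) = z (src h) + of_int (s h) * t) \<and>
    (\<forall>w\<in>U. f w = z w \<and> has_ord \<Gamma> f w (\<Sum>h\<in>out_halves w. s h)) \<and> (\<forall>x\<in>\<Gamma> - U. has_ord \<Gamma> f x 0)"
proof -
  obtain f where fU: "\<And>w. w \<in> U \<Longrightarrow> f w = z w" and f0: "\<And>h t. h \<in> halves \<Longrightarrow> t \<in> {0..hlen h} \<Longrightarrow>
     f (half h t) = z (src h) + (z (src (rev_half h)) - z (src h)) / hlen h * t"
    using exists_edgewise_affine[of z] by blast
  have f: "f (half h t) = z (src h) + of_int (s h) * t" if "h \<in> halves" "t \<in> {0..hlen h}" for h t
    using f0[OF that] s[OF that(1)] hlen_pos[OF that(1)] by simp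
  have ordU: "has_ord \<Gamma> f w (\<Sum>h\<in>out_halves w. s h)" if w: "w \<in> U" for w
  proof -
    obtain \<delta> where \<delta>: "\<delta> > 0" "\<And>h. h \<in> out_halves w \<Longrightarrow> 2 * \<delta> \<le> hlen h"
      "star_at \<Gamma> w (out_halves w) \<delta> half"
      using w by (rule star_vertex) (rule that)
    show ?thesis
    proof (rule has_ord_star_at[OF \<delta>(3)])
      fix h assume h: "h \<in> out_halves w"
      have "\<forall>\<^sub>F t in at_right 0. t \<in> {0<..<\<delta>}" by (rule eventually_at_right_real[OF \<delta>(1)])
      then show "\<forall>\<^sub>F t in at_right 0. f (half h t) = f w + of_int (s h) * t"
      proof eventually_elim
        case (elim t)
        then show ?case using f[of h t] h \<delta>(2)[OF h] fU[OF w] by (simp add: out_halves_def)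
      qed
    qed
  qed
  have ordE: "has_ord \<Gamma> f x 0" if x: "x \<in> \<Gamma> - U" for x
  proof -
    have "x \<in> \<Gamma>" "x \<notin> U" using x by auto
    from half_cover[OF this] obtain C u where h: "\<And>b. (C, b) \<in> halves" and u: "u \<in> {0<..<hlen (C, True)}"
      and xu: "x = half (C, True) u" by blast
    let ?h = "(C, True)"
    obtain \<delta> where \<delta>: "\<delta> > 0" "\<delta> \<le> u" "\<delta> \<le> hlen ?h - u"
      "star_at \<Gamma> (half ?h u) (UNIV :: bool set) \<delta> (\<lambda>b t. half ?h (if b then u + t else u - t))"
      using h u by (rule star_interior) (rule that)
    have "has_ord \<Gamma> f (half ?h u) (\<Sum>b\<in>UNIV. if b then s ?h else - s ?h)"
    proof (rule has_ord_star_at[OF \<delta>(4)])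
      fix b
      have "\<forall>\<^sub>F t in at_right 0. t \<in> {0<..<\<delta>}" by (rule eventually_at_right_real[OF \<delta>(1)])
      then show "\<forall>\<^sub>F t in at_right 0. f (half ?h (if b then u + t else u - t)) =
          f (half ?h u) + of_int (if b then s ?h else - s ?h) * t"
      proof eventually_elim
        case (elim t)
        then show ?case using f[OF h, of "if b then u + t else u - t"] f[OF h, of u] u \<delta>(2,3)
          by (cases b) (auto simp: algebra_simps)
      qed
    qed
    then show ?thesis by (simp add: UNIV_bool xu)
  qed
  have "continuous_on \<Gamma> f"
    unfolding continuous_on_eq_continuous_within
  proof
    fix x assume "x \<in> \<Gamma>"
    then show "continuous (at x within \<Gamma>) f"
      using ordU ordE has_ord_imp_continuous by (cases "x \<in> U") blast+
  qed
  moreover have "\<exists>l \<phi> a. \<exists>s::int. edge_chart C l \<phi> \<and> (\<forall>t\<in>{0<..<l}. f (\<phi> t) = a + of_int s * t)"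
    if C: "C \<in> edgeset" for C
  proof -
    have h: "(C, True) \<in> halves" using C by (simp add: halves_def)
    have "f (raw (C, True) t) = z (src (C, True)) + of_int (s (C, True)) * t"
      if "t \<in> {0<..<hlen (C, True)}" for t
      using f[OF h, of t] that half_raw[OF that] by simp
    then show ?thesis using raw_chart[OF h] by (metis fst_conv)
  qed
  ultimately have "tropical_rational \<Gamma> f"
    unfolding tropical_rational_def using model by blast
  then show ?thesis using f fU ordU ordE by blast
qed

text \<open>Order 0 makes \<open>f - f x\<close> locally odd about each interior point \<open>x\<close> of an edge, hence \<open>f\<close> affine.\<close>

lemma has_ord_imp_edgewise_affine:
  fixes f :: "'a \<Rightarrow> real"
  assumes ord: "\<And>x. x \<in> \<Gamma> \<Longrightarrow> has_ord \<Gamma> f x (D x)" and D: "\<And>x. x \<in> \<Gamma> \<Longrightarrow> x \<notin> U \<Longrightarrow> D x = 0"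
    and h: "h \<in> halves"
  shows "\<exists>s::int. \<forall>t\<in>{0..hlen h}. f (half h t) = f (src h) + of_int s * t"
proof -
  let ?g = "\<lambda>t. f (half h t)"
  have l: "hlen h > 0" by (rule hlen_pos[OF h])
  have fcont: "continuous_on \<Gamma> f"
    unfolding continuous_on_eq_continuous_within using ord has_ord_imp_continuous by blast
  have gcont: "continuous_on {0..hlen h} ?g"
    by (rule continuous_on_compose2[OF fcont continuous_on_half[OF h]]) (use half_in_graph[OF h] in blast)
  have local: "\<exists>\<epsilon>>0. \<forall>t\<in>{0<..<\<epsilon>}. ?g (u + t) + ?g (u - t) = 2 * ?g u \<and>
      (\<exists>s::int. ?g (u + t) - ?g u = of_int s * t)" if u: "u \<in> {0<..<hlen h}" for u
  proof -
    have x: "half h u \<in> \<Gamma>" using half_in_graph[OF h, of u] u by simp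
    have "has_ord \<Gamma> f (half h u) 0"
      using ord[OF x] D[OF x half_notin_U[OF h u]] by simp
    then obtain \<epsilon> B where \<epsilon>: "\<epsilon> > 0"
      "\<And>t. t \<in> {0<..<\<epsilon>} \<Longrightarrow> (\<Sum>y\<in>{y\<in>\<Gamma>. dist (half h u) y = t}. f y - f (half h u)) = of_int 0 * t"
      "\<And>t y. t \<in> {0<..<\<epsilon>} \<Longrightarrow> y \<in> \<Gamma> \<Longrightarrow> dist (half h u) y = t \<Longrightarrow> \<exists>s::int. f y - f (half h u) = of_int s * t"
      by (rule has_ord_sphere) (rule that)
    obtain \<delta> where \<delta>: "\<delta> > 0" "\<delta> \<le> u" "\<delta> \<le> hlen h - u"
      "star_at \<Gamma> (half h u) (UNIV :: bool set) \<delta> (\<lambda>b t. half h (if b then u + t else u - t))"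
      using h u by (rule star_interior) (rule that)
    have "?g (u + t) + ?g (u - t) = 2 * ?g u \<and> (\<exists>s::int. ?g (u + t) - ?g u = of_int s * t)"
      if t: "t \<in> {0<..<min \<epsilon> \<delta>}" for t
    proof
      have t': "0 < t" "t < \<delta>" "t \<in> {0<..<\<epsilon>}" "t \<in> {0..<\<delta>}" using t by auto
      \<comment> \<open>The sphere of radius \<open>t\<close> consists of the points at the
        positions \<open>u + t\<close> and \<open>u - t\<close>, and order 0 makes their increments
        cancel.\<close>
      have "(\<Sum>y\<in>{y\<in>\<Gamma>. dist (half h u) y = t}. f y - f (half h u)) =
          (\<Sum>b\<in>UNIV. f (half h (if b then u + t else u - t)) - f (half h u))"
        by (rule sum.reindex_bij_betw[OF star_at_sphere[OF \<delta>(4) t'(1,2)], symmetric])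
      then show "?g (u + t) + ?g (u - t) = 2 * ?g u"
        using \<epsilon>(2)[OF t'(3)] by (simp add: UNIV_bool)
      show "\<exists>s::int. ?g (u + t) - ?g u = of_int s * t"
        using \<epsilon>(3)[OF t'(3), of "half h (u + t)"] star_at_dist[OF \<delta>(4) _ t'(4), of True] by simp
    qed
    then show ?thesis using \<epsilon>(1) \<delta>(1) by (intro exI[of _ "min \<epsilon> \<delta>"]) simp
  qed
  have "\<exists>\<alpha> \<sigma>. \<forall>t\<in>{0<..<hlen h}. ?g t = \<alpha> + \<sigma> * t"
  proof (rule locally_symmetric_imp_affine[OF l])
    show "continuous_on {0<..<hlen h} ?g" by (rule continuous_on_subset[OF gcont]) auto
    fix u assume "u \<in> {0<..<hlen h}"
    from local[OF this] obtain \<epsilon> where \<epsilon>: "\<epsilon> > 0" "\<forall>t\<in>{0<..<\<epsilon>}. ?g (u + t) + ?g (u - t) = 2 * ?g u" by blast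
    have "\<forall>\<^sub>F t in at_right 0. t \<in> {0<..<\<epsilon>}" by (rule eventually_at_right_real[OF \<epsilon>(1)])
    then show "\<forall>\<^sub>F t in at_right 0. ?g (u + t) + ?g (u - t) = 2 * ?g u"
      by eventually_elim (use \<epsilon>(2) in blast)
  qed
  then obtain \<alpha> \<sigma> where aff: "\<And>t. t \<in> {0<..<hlen h} \<Longrightarrow> ?g t = \<alpha> + \<sigma> * t" by blast
  have aff': "?g t - \<sigma> * t = \<alpha>" if "t \<in> {0..hlen h}" for t
  proof (rule continuous_constant_on_closure[where f = "\<lambda>t. ?g t - \<sigma> * t" and x = t])
    have cl: "closure {0<..<hlen h} = {0..hlen h}" using l by simp
    show "continuous_on (closure {0<..<hlen h}) (\<lambda>t. ?g t - \<sigma> * t)"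
      unfolding cl by (intro continuous_intros gcont)
    show "t \<in> closure {0<..<hlen h}" unfolding cl by (rule that)
  qed (use aff in auto)
  \<comment> \<open>Near every interior point the order yields integral difference quotients; at the
    midpoint such a quotient is \<open>\<sigma>\<close>.\<close>
  define u where "u = hlen h / 2"
  have u: "u \<in> {0<..<hlen h}" using l by (simp add: u_def)
  from local[OF u] obtain \<epsilon> where \<epsilon>: "\<epsilon> > 0" "\<And>t. t \<in> {0<..<\<epsilon>} \<Longrightarrow> \<exists>s::int. ?g (u + t) - ?g u = of_int s * t" by blast
  define t where "t = min \<epsilon> u / 2"
  have t: "t \<in> {0<..<\<epsilon>}" "u + t \<in> {0<..<hlen h}" "t > 0" using \<epsilon>(1) u l by (auto simp: t_def u_def min_def)
  obtain s :: int where "?g (u + t) - ?g u = of_int s * t" using \<epsilon>(2)[OF t(1)] by blast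
  moreover have "?g (u + t) - ?g u = \<sigma> * t" using aff[OF u] aff[OF t(2)] by (simp add: algebra_simps)
  ultimately have "\<sigma> = of_int s" using t(3) by simp
  moreover have "\<alpha> = f (src h)" using aff'[of 0] l by simp
  ultimately show ?thesis using aff' by (intro exI[of _ s]) (auto simp: algebra_simps)
qed

text \<open>The sphere sum of \<open>has_ord_sphere\<close> is evaluated on the star formed by the
  half-edges, so the star chart that witnesses the order is irrelevant.\<close>

lemma has_ord_vertex:
  assumes ord: "has_ord \<Gamma> f w m" and w: "w \<in> U"
    and aff: "\<And>h t. h \<in> out_halves w \<Longrightarrow> t \<in> {0..hlen h} \<Longrightarrow> f (half h t) = f w + of_int (s h) * t"
  shows "m = (\<Sum>h\<in>out_halves w. s h)"
proof -
  obtain \<epsilon> B where \<epsilon>: "\<epsilon> > 0"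
    "\<And>t. t \<in> {0<..<\<epsilon>} \<Longrightarrow> (\<Sum>y\<in>{y\<in>\<Gamma>. dist w y = t}. f y - f w) = of_int m * t"
    using ord by (rule has_ord_sphere) (rule that)
  obtain \<delta> where \<delta>: "\<delta> > 0" "\<And>h. h \<in> out_halves w \<Longrightarrow> 2 * \<delta> \<le> hlen h"
    "star_at \<Gamma> w (out_halves w) \<delta> half"
    using w by (rule star_vertex) (rule that)
  define t where "t = min \<epsilon> \<delta> / 2"
  have t: "t > 0" "t < \<delta>" "t \<in> {0<..<\<epsilon>}" using \<epsilon>(1) \<delta>(1) by (auto simp: t_def)
  have "of_int m * t = (\<Sum>h\<in>out_halves w. f (half h t) - f w)"
    unfolding \<epsilon>(2)[OF t(3), symmetric]
    by (rule sum.reindex_bij_betw[OF star_at_sphere[OF \<delta>(3) t(1,2)], symmetric])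
  also have "\<dots> = (\<Sum>h\<in>out_halves w. of_int (s h) * t)"
  proof (intro sum.cong refl)
    fix h assume h: "h \<in> out_halves w"
    show "f (half h t) - f w = of_int (s h) * t" using aff[OF h, of t] t \<delta>(2)[OF h] by simp
  qed
  also have "\<dots> = of_int (\<Sum>h\<in>out_halves w. s h) * t" by (simp add: sum_distrib_right)
  finally have "real_of_int m = of_int (\<Sum>h\<in>out_halves w. s h)" using t(1) by simp
  then show ?thesis by (simp only: of_int_eq_iff)
qed

text \<open>Connectedness of the finite graph, derived from that of \<open>\<Gamma>\<close>: without
  such a half-edge the indicator of \<open>A\<close> would extend with slope 0 to a continuous
  function with values 0 and 1, which would have to be constant.\<close>

lemma half_crossing:
  assumes A: "A \<subseteq> U" "A \<noteq> {}" "v \<in> U" "v \<notin> A"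
  obtains h where "h \<in> halves" "src h \<in> A" "src (rev_half h) \<notin> A"
proof (rule ccontr)
  assume "\<not> thesis"
  then have no: "\<And>h. h \<in> halves \<Longrightarrow> src h \<in> A \<Longrightarrow> src (rev_half h) \<in> A" using that by blast
  define z :: "'a \<Rightarrow> real" where "z x = (if x \<in> A then 1 else 0)" for x
  have iff: "src h \<in> A \<longleftrightarrow> src (rev_half h) \<in> A" if "h \<in> halves" for h
    using no[OF that] no[of "rev_half h"] that by auto
  have "z (src (rev_half h)) = z (src h) + of_int 0 * hlen h" if "h \<in> halves" for h
    using iff[OF that] by (simp add: z_def)
  from exists_tropical[OF this] obtain f where f: "tropical_rational \<Gamma> f"
    "\<And>h t. h \<in> halves \<Longrightarrow> t \<in> {0..hlen h} \<Longrightarrow> f (half h t) = z (src h)" "\<And>w. w \<in> U \<Longrightarrow> f w = z w" by auto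
  have "f x \<in> {0, 1}" if x: "x \<in> \<Gamma>" for x
  proof (cases "x \<in> U")
    case True
    then show ?thesis using f(3) by (simp add: z_def)
  next
    case False
    from half_cover[OF x False] obtain C t where "\<And>b. (C, b) \<in> halves" "t \<in> {0<..<hlen (C, True)}"
      "x = half (C, True) t" by blast
    then show ?thesis using f(2)[of "(C, True)" t] by (simp add: z_def)
  qed
  then have "f ` \<Gamma> \<subseteq> {0, 1}" by blast
  then have "finite (f ` \<Gamma>)" by (rule finite_subset) simp
  moreover have "continuous_on \<Gamma> f" using f(1) by (simp add: tropical_rational_def)
  ultimately have "f constant_on \<Gamma>" using continuous_finite_range_constant connected_graph by blast
  moreover obtain a where "a \<in> A" using A by blast
  ultimately have "f a = f v" using A U_sub unfolding constant_on_def by (metis subsetD)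
  then show False using f(3)[of a] f(3)[of v] A \<open>a \<in> A\<close> by (auto simp: z_def)
qed

section \<open>The Laplacian of a model\<close>

abbreviation mgraph :: "('a, 'a set) multigraph" where
  "mgraph \<equiv> model_graph \<Gamma> U"

text \<open>An edge joining the distinct vertices \<open>w\<close> and \<open>w'\<close> has exactly
  one direction leaving \<open>w\<close>.\<close>

lemma adjacency_eq_card_halves:
  assumes "w \<in> U" "w' \<in> U" "w \<noteq> w'"
  shows "adjacency mgraph w w' = card {h \<in> out_halves w. src (rev_half h) = w'}"
proof -
  have "bij_betw fst {h \<in> out_halves w. src (rev_half h) = w'} {C \<in> edgeset. closure C \<inter> U = {w, w'}}"
  proof (rule bij_betw_imageI)
    show "inj_on fst {h \<in> out_halves w. src (rev_half h) = w'}"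
    proof (rule inj_onI, rule ccontr)
      fix h h' assume a: "h \<in> {h \<in> out_halves w. src (rev_half h) = w'}"
        "h' \<in> {h \<in> out_halves w. src (rev_half h) = w'}" "fst h = fst h'" "h \<noteq> h'"
      then have "h' = rev_half h" by (auto simp: rev_half_def prod_eq_iff)
      then show False using a assms(3) by (simp add: out_halves_def)
    qed
    show "fst ` {h \<in> out_halves w. src (rev_half h) = w'} = {C \<in> edgeset. closure C \<inter> U = {w, w'}}"
    proof (intro subset_antisym subsetI)
      fix C assume "C \<in> fst ` {h \<in> out_halves w. src (rev_half h) = w'}"
      then obtain b where h: "(C, b) \<in> halves" "src (C, b) = w" "src (C, \<not> b) = w'"
        by (auto simp: out_halves_def rev_half_def)
      then have "C \<in> edgeset" by (simp add: halves_def)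
      moreover have "{src (C, True), src (C, False)} = {w, w'}" using h by (cases b) auto
      ultimately show "C \<in> {C \<in> edgeset. closure C \<inter> U = {w, w'}}" using edge_ends by simp
    next
      fix C assume "C \<in> {C \<in> edgeset. closure C \<inter> U = {w, w'}}"
      then have C: "C \<in> edgeset" "{src (C, True), src (C, False)} = {w, w'}" using edge_ends by auto
      then obtain b where "src (C, b) = w" "src (C, \<not> b) = w'"
        unfolding doubleton_eq_iff by (metis (full_types))
      then have "(C, b) \<in> {h \<in> out_halves w. src (rev_half h) = w'}"
        using C(1) by (simp add: out_halves_def halves_def rev_half_def)
      then have "fst (C, b) \<in> fst ` {h \<in> out_halves w. src (rev_half h) = w'}" by (rule imageI)
      then show "C \<in> fst ` {h \<in> out_halves w. src (rev_half h) = w'}" by simp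
    qed
  qed
  then have "card {h \<in> out_halves w. src (rev_half h) = w'} = card {C \<in> edgeset. closure C \<inter> U = {w, w'}}"
    by (rule bij_betw_same_card)
  then show ?thesis using assms(3) by (simp add: adjacency_def model_graph_def)
qed

text \<open>Half-edges are grouped by their other end. A loop contributes a zero difference, in
  accordance with its absence from \<open>adjacency\<close>.\<close>

lemma sum_out_halves:
  fixes z :: "'a \<Rightarrow> int"
  assumes w: "w \<in> U"
  shows "(\<Sum>h\<in>out_halves w. z (src (rev_half h)) - z w) =
    (\<Sum>w'\<in>U. int (adjacency mgraph w w') * (z w' - z w))"
proof -
  have img: "(\<lambda>h. src (rev_half h)) ` out_halves w \<subseteq> U"
    using src(1)[of "rev_half _"] by (auto simp: out_halves_def)
  have "(\<Sum>h\<in>out_halves w. z (src (rev_half h)) - z w) =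
      (\<Sum>w'\<in>U. \<Sum>h\<in>{h \<in> out_halves w. src (rev_half h) = w'}. z (src (rev_half h)) - z w)"
    by (rule sum.group[OF finite_out_halves[OF w] finite_U img, symmetric])
  also have "\<dots> = (\<Sum>w'\<in>U. int (adjacency mgraph w w') * (z w' - z w))"
  proof (intro sum.cong refl)
    fix w' assume w': "w' \<in> U"
    have "(\<Sum>h\<in>{h \<in> out_halves w. src (rev_half h) = w'}. z (src (rev_half h)) - z w) =
        int (card {h \<in> out_halves w. src (rev_half h) = w'}) * (z w' - z w)"
      by simp
    then show "(\<Sum>h\<in>{h \<in> out_halves w. src (rev_half h) = w'}. z (src (rev_half h)) - z w) =
        int (adjacency mgraph w w') * (z w' - z w)"
      using adjacency_eq_card_halves[OF w w'] by (cases "w = w'") simp_all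
  qed
  finally show ?thesis .
qed

lemma sink_graph_mgraph:
  assumes v0: "v0 \<in> U"
  shows "sink_graph mgraph v0"
proof
  show "finite (verts mgraph)" "v0 \<in> verts mgraph" using finite_U v0 by (simp_all add: model_graph_def)
next
  fix w assume "w \<in> verts mgraph"
  then have w: "w \<in> U" by (simp add: model_graph_def)
  \<comment> \<open>Proper edges at \<open>w\<close>, sorted by their other end; loops have a single
    end and drop out.\<close>
  have "{C \<in> edgeset. w \<in> closure C \<inter> U \<and> card (closure C \<inter> U) = 2} =
      (\<Union>w'\<in>U - {w}. {C \<in> edgeset. closure C \<inter> U = {w, w'}})"
  proof (intro subset_antisym subsetI)
    fix C assume "C \<in> {C \<in> edgeset. w \<in> closure C \<inter> U \<and> card (closure C \<inter> U) = 2}"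
    then have C: "C \<in> edgeset" "w \<in> closure C \<inter> U" "card (closure C \<inter> U) = 2" by auto
    then obtain a b where "closure C \<inter> U = {a, b}" "a \<noteq> b" by (metis card_2_iff)
    then obtain w' where "closure C \<inter> U = {w, w'}" "w' \<noteq> w" using C(2) by (metis insertE insert_commute singletonD)
    then show "C \<in> (\<Union>w'\<in>U - {w}. {C \<in> edgeset. closure C \<inter> U = {w, w'}})" using C(1) by blast
  qed auto
  then have "val mgraph w = card (\<Union>w'\<in>U - {w}. {C \<in> edgeset. closure C \<inter> U = {w, w'}})"
    by (simp add: val_def model_graph_def)
  also have "\<dots> = (\<Sum>w'\<in>U - {w}. card {C \<in> edgeset. closure C \<inter> U = {w, w'}})"
    by (rule card_UN_disjoint) (use finite_U finite_edgeset in \<open>auto simp: doubleton_eq_iff\<close>)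
  also have "\<dots> = (\<Sum>w'\<in>U - {w}. adjacency mgraph w w')"
    by (intro sum.cong) (auto simp: adjacency_def model_graph_def)
  also have "\<dots> = (\<Sum>w'\<in>U. adjacency mgraph w w')"
    using finite_U w by (simp add: sum.remove[of U w] adjacency_def)
  finally show "val mgraph w = (\<Sum>w'\<in>verts mgraph. adjacency mgraph w w')" by (simp add: model_graph_def)
next
  fix A assume "A \<subseteq> verts mgraph" "v0 \<notin> A" "A \<noteq> {}"
  then have A: "A \<subseteq> U" "A \<noteq> {}" "v0 \<in> U" "v0 \<notin> A" using v0 by (simp_all add: model_graph_def)
  from half_crossing[OF A] obtain h where h: "h \<in> halves" "src h \<in> A" "src (rev_half h) \<notin> A" by blast
  have w': "src (rev_half h) \<in> U" using src(1)[of "rev_half h"] h(1) by simp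
  have "h \<in> {h' \<in> out_halves (src h). src (rev_half h') = src (rev_half h)}"
    using h(1) by (simp add: out_halves_def)
  moreover have "finite {h' \<in> out_halves (src h). src (rev_half h') = src (rev_half h)}"
    using finite_out_halves[of "src h"] h(2) A(1) by auto
  ultimately have "card {h' \<in> out_halves (src h). src (rev_half h') = src (rev_half h)} > 0"
    unfolding card_gt_0_iff by blast
  moreover have "adjacency mgraph (src h) (src (rev_half h)) =
      card {h' \<in> out_halves (src h). src (rev_half h') = src (rev_half h)}"
    using h A(1) w' by (intro adjacency_eq_card_halves) auto
  ultimately have "adjacency mgraph (src h) (src (rev_half h)) > 0" by simp
  then show "\<exists>v\<in>A. \<exists>w\<in>verts mgraph - A. adjacency mgraph v w > 0"
    using h w' by (intro bexI[of _ "src h"] bexI[of _ "src (rev_half h)"]) (auto simp: model_graph_def)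
qed

text \<open>The potential is \<open>z = - f / l\<close>; the sign appears because the Laplacian is positive
  semidefinite, while \<open>has_ord\<close> sums outgoing slopes.\<close>

lemma principal_iff_fire:
  fixes D :: "'a \<Rightarrow> int"
  assumes v0: "v0 \<in> U" and l: "\<And>C. C \<in> edgeset \<Longrightarrow> len C = l" "l > 0"
    and D: "\<And>x. x \<in> \<Gamma> \<Longrightarrow> x \<notin> U \<Longrightarrow> D x = 0"
  shows "(\<exists>f. tropical_rational \<Gamma> f \<and> (\<forall>x\<in>\<Gamma>. has_ord \<Gamma> f x (D x))) \<longleftrightarrow>
    (\<exists>z. \<forall>w\<in>U. D w = sink_graph.fire mgraph z w)"
proof -
  interpret G: sink_graph mgraph v0 by (rule sink_graph_mgraph[OF v0])
  have vG: "verts mgraph = U" by (simp add: model_graph_def)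
  have hl: "hlen h = l" if "h \<in> halves" for h using l(1)[OF halvesD[OF that]] by (simp add: hlen_def)
  have fire: "G.fire z w = - (\<Sum>h\<in>out_halves w. z (src (rev_half h)) - z w)" if "w \<in> U" for z w
    unfolding sum_out_halves[OF that] using G.fire_eq[of w z] that
    by (simp add: vG sum_negf[symmetric] algebra_simps)
  show ?thesis
  proof
    assume "\<exists>f. tropical_rational \<Gamma> f \<and> (\<forall>x\<in>\<Gamma>. has_ord \<Gamma> f x (D x))"
    then obtain f where ord: "\<And>x. x \<in> \<Gamma> \<Longrightarrow> has_ord \<Gamma> f x (D x)" by blast
    have "\<exists>s::int. \<forall>t\<in>{0..hlen h}. f (half h t) = f (src h) + of_int s * t" if "h \<in> halves" for h
      by (rule has_ord_imp_edgewise_affine[OF ord D that])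
    then obtain s :: "'a set \<times> bool \<Rightarrow> int" where
      s: "\<And>h t. h \<in> halves \<Longrightarrow> t \<in> {0..hlen h} \<Longrightarrow> f (half h t) = f (src h) + of_int (s h) * t" by metis
    have s_l: "f (src (rev_half h)) = f (src h) + of_int (s h) * l" if h: "h \<in> halves" for h
      using s[OF h, of l] hl[OF h] l(2) half_hlen[OF h] by simp
    \<comment> \<open>The quotient is integral for vertices, as shown next; the floor only turns it
      into an integer.\<close>
    define z where "z w = \<lfloor>(f v0 - f w) / l\<rfloor>" for w
    have z: "of_int (z w) * l = f v0 - f w" if w: "w \<in> U" for w
    proof -
      \<comment> \<open>The set where integrality holds contains \<open>v0\<close>. A half-edge
        leading out of \<open>U - A\<close> would transport integrality back to its source, because
        its slope is an integer and its length is \<open>l\<close>.\<close>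
      define A where "A = {w \<in> U. \<exists>m::int. f v0 - f w = of_int m * l}"
      have "U - A = {}"
      proof (rule ccontr)
        assume ne: "U - A \<noteq> {}"
        have "v0 \<in> A" using v0 by (auto simp: A_def intro: exI[of _ 0])
        from half_crossing[OF Diff_subset ne v0] \<open>v0 \<in> A\<close>
        obtain h where h: "h \<in> halves" "src h \<in> U - A" "src (rev_half h) \<notin> U - A" by blast
        moreover have "src (rev_half h) \<in> U" using src(1)[of "rev_half h"] h(1) by simp
        ultimately obtain m :: int where "f v0 - f (src (rev_half h)) = of_int m * l" by (auto simp: A_def)
        then have "f v0 - f (src h) = of_int (m + s h) * l" using s_l[OF h(1)] by (simp add: algebra_simps)
        then show False using h(2) unfolding A_def by blast
      qed
      then obtain m :: int where m: "f v0 - f w = of_int m * l" using w by (auto simp: A_def)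
      then show ?thesis using l(2) by (simp add: z_def)
    qed
    have "D w = G.fire z w" if w: "w \<in> U" for w
    proof -
      have "D w = (\<Sum>h\<in>out_halves w. s h)"
        by (rule has_ord_vertex[OF ord w]) (use w U_sub s in \<open>auto simp: out_halves_def\<close>)
      also have "\<dots> = (\<Sum>h\<in>out_halves w. z w - z (src (rev_half h)))"
      proof (intro sum.cong refl)
        fix h assume "h \<in> out_halves w"
        then have h: "h \<in> halves" "src h = w" by (auto simp: out_halves_def)
        have "of_int (z w - z (src (rev_half h))) * l = of_int (s h) * l"
          using z[OF w] z[of "src (rev_half h)"] src(1)[of "rev_half h"] s_l[OF h(1)] h
          by (simp add: algebra_simps)
        then have "real_of_int (z w - z (src (rev_half h))) = of_int (s h)" using l(2) by simp
        then show "s h = z w - z (src (rev_half h))" by linarith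
      qed
      also have "\<dots> = G.fire z w" unfolding fire[OF w] by (simp add: sum_negf[symmetric])
      finally show ?thesis .
    qed
    then show "\<exists>z. \<forall>w\<in>U. D w = G.fire z w" by blast
  next
    assume "\<exists>z. \<forall>w\<in>U. D w = G.fire z w"
    then obtain z where z: "\<And>w. w \<in> U \<Longrightarrow> D w = G.fire z w" by blast
    \<comment> \<open>The slope along \<open>h\<close> of the interpolation of
      \<open>- l * z\<close>, integral because every edge has length \<open>l\<close>.\<close>
    define s where "s h = z (src h) - z (src (rev_half h))" for h
    have "- l * of_int (z (src (rev_half h))) = - l * of_int (z (src h)) + of_int (s h) * hlen h"
      if "h \<in> halves" for h
      by (simp add: hl[OF that] s_def algebra_simps)
    from exists_tropical[of "\<lambda>w. - l * of_int (z w)" s, OF this]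
    obtain f where f: "tropical_rational \<Gamma> f" "\<And>w. w \<in> U \<Longrightarrow> has_ord \<Gamma> f w (\<Sum>h\<in>out_halves w. s h)"
      "\<And>x. x \<in> \<Gamma> - U \<Longrightarrow> has_ord \<Gamma> f x 0" by blast
    have "(\<Sum>h\<in>out_halves w. s h) = D w" if w: "w \<in> U" for w
    proof -
      have "(\<Sum>h\<in>out_halves w. s h) = (\<Sum>h\<in>out_halves w. - (z (src (rev_half h)) - z w))"
        by (intro sum.cong) (auto simp: s_def out_halves_def)
      then show ?thesis unfolding z[OF w] fire[OF w] by (simp only: sum_negf)
    qed
    then have "has_ord \<Gamma> f x (D x)" if "x \<in> \<Gamma>" for x
      using f(2)[of x] f(3)[of x] D[OF that] that by (cases "x \<in> U") auto
    then show "\<exists>f. tropical_rational \<Gamma> f \<and> (\<forall>x\<in>\<Gamma>. has_ord \<Gamma> f x (D x))" using f(1) by blast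
  qed
qed

end

section \<open>Rational points\<close>

text \<open>Length and chart are chosen together, so that the property \<open>Q\<close> holds for
  the length of the very chart that is used.\<close>

lemma exists_charted_model:
  assumes "metric_graph \<Gamma>" "graph_model \<Gamma> U"
    and "\<And>C. C \<in> components (\<Gamma> - U) \<Longrightarrow> \<exists>l. has_edge_length C l \<and> Q l"
  obtains len \<phi> where "charted_model \<Gamma> U len \<phi>" "\<And>C. C \<in> components (\<Gamma> - U) \<Longrightarrow> Q (len C)"
proof -
  have "\<exists>l \<phi>. edge_chart C l \<phi> \<and> Q l" if "C \<in> components (\<Gamma> - U)" for C
    using assms(3)[OF that] unfolding has_edge_length_def by blast
  then obtain len \<phi> where c: "\<And>C. C \<in> components (\<Gamma> - U) \<Longrightarrow> edge_chart C (len C) (\<phi> C)"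
    "\<And>C. C \<in> components (\<Gamma> - U) \<Longrightarrow> Q (len C)" by metis
  have "charted_model \<Gamma> U len \<phi>" by unfold_locales (use assms(1,2) c(1) in auto)
  then show thesis using c(2) by (rule that)
qed

lemma group_multiple_closed:
  fixes H :: "real set"
  assumes "0 \<in> H" "\<And>x y. x \<in> H \<Longrightarrow> y \<in> H \<Longrightarrow> x - y \<in> H" "a \<in> H"
  shows "real j * a \<in> H"
proof (induction j)
  case (Suc j)
  have "0 - a \<in> H" using assms by blast
  then have "real j * a - (0 - a) \<in> H" using Suc assms(2) by blast
  then show ?case by (simp add: algebra_simps)
qed (use assms(1) in simp)

text \<open>These groups are dense for \<open>p \<ge> 2\<close>, but those for \<open>p = 2\<close> and \<open>p = 3\<close> only share the
  integral multiples of \<open>l\<close>, which allows density arguments to be used for vertices.\<close>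

definition adic_multiples :: "nat \<Rightarrow> real \<Rightarrow> real set" where
  "adic_multiples p l = {x. \<exists>n::nat. \<exists>m::int. x * real p ^ n = of_int m * l}"

lemma adic_multiples_diff:
  assumes "x \<in> adic_multiples p l" "y \<in> adic_multiples p l"
  shows "x - y \<in> adic_multiples p l"
proof -
  obtain n n' :: nat and m m' :: int where *: "x * real p ^ n = of_int m * l" "y * real p ^ n' = of_int m' * l"
    using assms by (auto simp: adic_multiples_def)
  have "(x - y) * real p ^ (n + n') = (x * real p ^ n) * real p ^ n' - (y * real p ^ n') * real p ^ n"
    by (simp add: power_add algebra_simps)
  also have "\<dots> = of_int (m * int p ^ n' - m' * int p ^ n) * l"
    unfolding * by (simp add: algebra_simps)
  finally show ?thesis unfolding adic_multiples_def by blast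
qed

lemma adic_multiples_0 [simp]: "0 \<in> adic_multiples p l"
  unfolding adic_multiples_def by (auto intro!: exI[of _ "0::int"])

lemma adic_multiples_self: "of_int m * l \<in> adic_multiples p l"
  unfolding adic_multiples_def by (auto intro!: exI[of _ "0::nat"])

lemma adic_multiples_small:
  assumes "p \<ge> 2" "l > 0" "\<epsilon> > 0"
  shows "\<exists>a\<in>adic_multiples p l. 0 < a \<and> a < \<epsilon>"
proof -
  obtain n where n: "(1 / real p) ^ n < \<epsilon> / l"
    using real_arch_pow_inv[of "\<epsilon> / l" "1 / real p"] assms by auto
  define a where "a = l * (1 / real p) ^ n"
  have "a * real p ^ n = of_int 1 * l" using assms(1) by (simp add: a_def power_divide)
  then have "a \<in> adic_multiples p l" unfolding adic_multiples_def by blast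
  moreover have "a > 0" using assms by (simp add: a_def)
  moreover have "a < \<epsilon>" using n assms(2) by (simp add: a_def field_simps)
  ultimately show ?thesis by blast
qed

text \<open>Clearing denominators gives \<open>m * 3 ^ n' = m' * 2 ^ n\<close>, and by coprimality
  \<open>2 ^ n\<close> divides \<open>m\<close>.\<close>

lemma adic_multiples_2_3:
  assumes "x \<in> adic_multiples 2 l" "x \<in> adic_multiples 3 l" "l > 0"
  shows "\<exists>m::int. x = of_int m * l"
proof -
  obtain n n' :: nat and m m' :: int where *: "x * 2 ^ n = of_int m * l" "x * 3 ^ n' = of_int m' * l"
    using assms by (auto simp: adic_multiples_def)
  have "of_int (m * 3 ^ n') * l = (of_int m * l) * 3 ^ n'" by simp
  also have "\<dots> = (x * 3 ^ n') * 2 ^ n" unfolding *(1)[symmetric] by (simp only: ac_simps)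
  also have "\<dots> = of_int (m' * 2 ^ n) * l" unfolding *(2) by simp
  finally have "of_int (m * 3 ^ n') * l = of_int (m' * 2 ^ n) * l" .
  then have "real_of_int (m * 3 ^ n') = of_int (m' * 2 ^ n)" using assms(3) by simp
  then have "m * 3 ^ n' = m' * 2 ^ n" by (simp only: of_int_eq_iff)
  then have "2 ^ n dvd m * 3 ^ n'" by simp
  moreover have "coprime ((2::int) ^ n) (3 ^ n')" by (intro coprime_power_left_iff[THEN iffD2] disjI1 coprime_power_right_iff[THEN iffD2]) simp
  ultimately have "2 ^ n dvd m" by (simp add: coprime_dvd_mult_left_iff)
  then obtain q where "m = 2 ^ n * q" by (elim dvdE)
  then have "x = of_int q * l" using *(1) by simp
  then show ?thesis by blast
qed

context charted_model
begin

text \<open>A common form for the rational points, where \<open>H\<close> is \<open>\<rat>\<close>,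
  and for the auxiliary sets that single out the vertices of a subdivision.\<close>

definition lattice_points :: "real set \<Rightarrow> 'a set" where
  "lattice_points H = {x\<in>\<Gamma>. x \<in> U \<or> (\<exists>h\<in>halves. \<exists>t\<in>{0<..<hlen h} \<inter> H. x = half h t)}"

definition length_group :: "real set \<Rightarrow> bool" where
  "length_group H \<longleftrightarrow> 0 \<in> H \<and> (\<forall>x\<in>H. \<forall>y\<in>H. x - y \<in> H) \<and> (\<forall>h\<in>halves. hlen h \<in> H)"

lemma length_groupD:
  assumes "length_group H"
  shows "0 \<in> H" "\<And>x y. x \<in> H \<Longrightarrow> y \<in> H \<Longrightarrow> x - y \<in> H" "\<And>h. h \<in> halves \<Longrightarrow> hlen h \<in> H"
  using assms by (auto simp: length_group_def)

lemma length_group_diff_iff: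
  assumes "length_group H" "a \<in> H"
  shows "a - b \<in> H \<longleftrightarrow> b \<in> H" "b - a \<in> H \<longleftrightarrow> b \<in> H" "\<bar>a - b\<bar> \<in> H \<longleftrightarrow> b \<in> H" "a + b \<in> H \<longleftrightarrow> b \<in> H"
proof -
  note H = length_groupD(1,2)[OF assms(1)]
  have neg: "- x \<in> H" if "x \<in> H" for x using H(2)[OF H(1) that] by simp
  show 1: "a - b \<in> H \<longleftrightarrow> b \<in> H" for b using H(2)[OF assms(2), of b] H(2)[OF assms(2), of "a - b"] by auto
  have 2: "b - a \<in> H \<longleftrightarrow> a - b \<in> H" using neg[of "a - b"] neg[of "b - a"] by auto
  then show "b - a \<in> H \<longleftrightarrow> b \<in> H" "\<bar>a - b\<bar> \<in> H \<longleftrightarrow> b \<in> H" using 1 by (auto simp: abs_if)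
  show "a + b \<in> H \<longleftrightarrow> b \<in> H" using 1[of "- b"] neg[of b] neg[of "- b"] by auto
qed

lemma U_lattice_points: "U \<subseteq> lattice_points H"
  using U_sub by (auto simp: lattice_points_def)

text \<open>A point inside an edge has just two positions, \<open>t\<close> along one direction and
  \<open>hlen h - t\<close> along the other, and \<open>H\<close> contains both or neither.\<close>

lemma half_lattice_points_iff:
  assumes H: "length_group H" and h: "h \<in> halves" and t: "t \<in> {0..hlen h}"
  shows "half h t \<in> lattice_points H \<longleftrightarrow> t \<in> H"
proof -
  consider "t = 0" | "t = hlen h" | "t \<in> {0<..<hlen h}" using t by fastforce
  then show ?thesis
  proof cases
    case 1
    then show ?thesis using src(1)[OF h] U_lattice_points length_groupD(1)[OF H] by auto
  next
    case 2
    then show ?thesis using src(1)[of "rev_half h"] h U_lattice_points length_groupD(3)[OF H] by auto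
  next
    case 3
    show ?thesis
    proof
      assume "t \<in> H"
      then show "half h t \<in> lattice_points H"
        using 3 h half_in_graph[OF h t] unfolding lattice_points_def by blast
    next
      assume "half h t \<in> lattice_points H"
      then obtain h' t' where h': "h' \<in> halves" "t' \<in> {0<..<hlen h'}" "t' \<in> H" "half h t = half h' t'"
        using half_notin_U[OF h 3] unfolding lattice_points_def by blast
      have C: "fst h = fst h'"
        using edge_unique[OF halvesD[OF h] halvesD[OF h'(1)]] half_in_edge[OF h 3] half_in_edge[OF h'(1,2)] h'(4)
        by simp
      then have l: "hlen h' = hlen h" by (simp add: hlen_def)
      show "t \<in> H"
      proof (cases "h = h'")
        case True
        then show ?thesis using half_inj[OF h 3, of t'] h' by simp
      next
        case False
        then have "h' = rev_half h" using C by (auto simp: rev_half_def prod_eq_iff)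
        then have "half h t = half h (hlen h - t')" using h'(4) half_rev[OF h] by simp
        moreover have "hlen h - t' \<in> {0<..<hlen h}" using h'(2) l by auto
        ultimately have "t = hlen h - t'" using half_inj[OF h 3] by blast
        then show ?thesis using length_groupD(2,3)[OF H] h h'(3) by simp
      qed
    qed
  qed
qed

text \<open>Near a vertex the distance of two points is the difference or the sum of their distances
  to it, and near an interior point of an edge it is the difference of their positions. So if one
  position lies in \<open>H\<close>, the other does exactly when the distance does. The claim is
  conditional on \<open>y\<close>, because with neither position in \<open>H\<close> the distance
  may still lie in it.\<close>

lemma lattice_points_local:
  assumes H: "length_group H" and x: "x \<in> \<Gamma>"
  shows "\<exists>\<epsilon>>0. \<forall>y\<in>\<Gamma>. \<forall>y'\<in>\<Gamma>. dist x y < \<epsilon> \<and> dist x y' < \<epsilon> \<longrightarrow>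
    (y \<in> lattice_points H \<longrightarrow> (y' \<in> lattice_points H \<longleftrightarrow> dist y y' \<in> H))"
proof (cases "x \<in> U")
  case True
  obtain \<delta> where \<delta>: "\<delta> > 0" "\<And>h. h \<in> out_halves x \<Longrightarrow> 2 * \<delta> \<le> hlen h"
    "star_at \<Gamma> x (out_halves x) \<delta> half"
    using True by (rule star_vertex) (rule that)
  have dH: "y \<in> lattice_points H \<longleftrightarrow> dist x y \<in> H" if y: "y \<in> \<Gamma>" "dist x y < \<delta>" for y
  proof (cases "y = x")
    case True
    then show ?thesis using \<open>x \<in> U\<close> U_lattice_points length_groupD(1)[OF H] by auto
  next
    case False
    from star_at_cases[OF \<delta>(3) y False] obtain h where h: "h \<in> out_halves x" "y = half h (dist x y)" .
    have "half h (dist x y) \<in> lattice_points H \<longleftrightarrow> dist x y \<in> H"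
      by (rule half_lattice_points_iff[OF H]) (use h(1) y \<delta>(1) \<delta>(2)[OF h(1)] in \<open>auto simp: out_halves_def\<close>)
    then show ?thesis using h(2) by simp
  qed
  have d: "dist y y' = \<bar>dist x y - dist x y'\<bar> \<or> dist y y' = dist x y + dist x y'"
    if y: "y \<in> \<Gamma>" "dist x y < \<delta>" and y': "y' \<in> \<Gamma>" "dist x y' < \<delta>" for y y'
  proof (cases "y = x \<or> y' = x")
    case True
    then show ?thesis by (auto simp: dist_commute)
  next
    case False
    then have ne: "y \<noteq> x" "y' \<noteq> x" by auto
    from star_at_cases[OF \<delta>(3) y ne(1)] obtain h where h: "h \<in> out_halves x" "y = half h (dist x y)" .
    from star_at_cases[OF \<delta>(3) y' ne(2)] obtain h' where h': "h' \<in> out_halves x" "y' = half h' (dist x y')" .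
    have "dist (half h (dist x y)) (half h' (dist x y')) =
        (if h = h' then \<bar>dist x y - dist x y'\<bar> else dist x y + dist x y')"
      using star_at_D(5,6)[OF \<delta>(3)] h(1) h'(1) y y' by simp
    then show ?thesis using h(2) h'(2) by (metis)
  qed
  have "y' \<in> lattice_points H \<longleftrightarrow> dist y y' \<in> H"
    if "y \<in> \<Gamma>" "y' \<in> \<Gamma>" "dist x y < \<delta>" "dist x y' < \<delta>" "y \<in> lattice_points H" for y y'
    using d[OF that(1,3,2,4)] dH[OF that(1,3)] dH[OF that(2,4)] length_group_diff_iff(3,4)[OF H, of "dist x y" "dist x y'"] that(5)
    by auto
  then show ?thesis using \<delta>(1) by blast
next
  case False
  from half_cover[OF x False] obtain C u where hC: "\<And>b. (C, b) \<in> halves" and u: "u \<in> {0<..<hlen (C, True)}"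
    and xu: "x = half (C, True) u" by blast
  let ?h = "(C, True)"
  obtain \<delta> where \<delta>: "\<delta> > 0" "\<delta> \<le> u" "\<delta> \<le> hlen ?h - u"
    "ball (half ?h u) \<delta> \<inter> \<Gamma> = half ?h ` {u-\<delta><..<u+\<delta>}"
    "\<And>s t. s \<in> {u-\<delta><..<u+\<delta>} \<Longrightarrow> t \<in> {u-\<delta><..<u+\<delta>} \<Longrightarrow> dist (half ?h s) (half ?h t) = \<bar>s - t\<bar>"
    using hC u by (rule half_interior) (rule that)
  have "y' \<in> lattice_points H \<longleftrightarrow> dist y y' \<in> H"
    if y: "y \<in> \<Gamma>" "y' \<in> \<Gamma>" "dist x y < \<delta>" "dist x y' < \<delta>" "y \<in> lattice_points H" for y y'
  proof -
    have "y \<in> half ?h ` {u-\<delta><..<u+\<delta>}" "y' \<in> half ?h ` {u-\<delta><..<u+\<delta>}"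
      unfolding \<delta>(4)[symmetric] using y xu by auto
    then obtain s t where st: "s \<in> {u-\<delta><..<u+\<delta>}" "y = half ?h s" "t \<in> {u-\<delta><..<u+\<delta>}" "y' = half ?h t" by blast
    have "s \<in> {0..hlen ?h}" "t \<in> {0..hlen ?h}" using st \<delta>(2,3) by auto
    then have "s \<in> H" "y' \<in> lattice_points H \<longleftrightarrow> t \<in> H"
      using half_lattice_points_iff[OF H hC] y(5) st by auto
    then show ?thesis using \<delta>(5)[OF st(1,3)] st length_group_diff_iff(3)[OF H, of s t] by simp
  qed
  then show ?thesis using \<delta>(1) by blast
qed

text \<open>The path may cross many edges of the model. The local comparison, made uniform by
  compactness of \<open>\<Gamma>\<close>, is chained in steps of a small size \<open>a\<close> from
  \<open>H\<close>: the path is at a lattice point at every multiple of \<open>a\<close>, and a last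
  step shorter than \<open>a\<close> reaches \<open>t\<close>.\<close>

lemma path_lattice_points_iff:
  assumes H: "length_group H" and small: "\<And>\<epsilon>. \<epsilon> > 0 \<Longrightarrow> \<exists>a\<in>H. 0 < a \<and> a < \<epsilon>"
    and \<gamma>: "\<And>t. t \<in> {0..d} \<Longrightarrow> \<gamma> t \<in> \<Gamma>"
    and iso: "\<exists>\<eta>>0. \<forall>s\<in>{0..d}. \<forall>t\<in>{0..d}. dist s t < \<eta> \<longrightarrow> dist (\<gamma> s) (\<gamma> t) = \<bar>s - t\<bar>"
    and start: "\<gamma> 0 \<in> lattice_points H" and t: "t \<in> {0..d}"
  shows "\<gamma> t \<in> lattice_points H \<longleftrightarrow> t \<in> H"
proof -
  let ?P = "\<lambda>y y'. y \<in> lattice_points H \<longrightarrow> (y' \<in> lattice_points H \<longleftrightarrow> dist y y' \<in> H)"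
  obtain \<epsilon> where \<epsilon>: "\<epsilon> > 0" "\<forall>y\<in>\<Gamma>. \<forall>y'\<in>\<Gamma>. dist y y' < \<epsilon> \<longrightarrow> ?P y y'"
    using compact_uniform_locally[of \<Gamma> ?P, OF compact_graph lattice_points_local[OF H]] by blast
  obtain \<eta> where \<eta>: "\<eta> > 0" "\<forall>s\<in>{0..d}. \<forall>t\<in>{0..d}. dist s t < \<eta> \<longrightarrow> dist (\<gamma> s) (\<gamma> t) = \<bar>s - t\<bar>"
    using iso by blast
  obtain a where a: "a \<in> H" "0 < a" "a < min \<epsilon> \<eta>" using small[of "min \<epsilon> \<eta>"] \<epsilon>(1) \<eta>(1) by auto
  have step: "\<gamma> s' \<in> lattice_points H \<longleftrightarrow> \<bar>s - s'\<bar> \<in> H"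
    if s: "s \<in> {0..d}" "s' \<in> {0..d}" "\<bar>s - s'\<bar> \<le> a" "\<gamma> s \<in> lattice_points H" for s s'
  proof -
    have "dist (\<gamma> s) (\<gamma> s') = \<bar>s - s'\<bar>" using \<eta>(2) s a(3) by (simp add: dist_real_def)
    moreover from this have "dist (\<gamma> s) (\<gamma> s') < \<epsilon>" using s(3) a(3) by simp
    ultimately show ?thesis using \<epsilon>(2) \<gamma>[OF s(1)] \<gamma>[OF s(2)] s(4) by auto
  qed
  have mult: "real j * a \<le> d \<Longrightarrow> \<gamma> (real j * a) \<in> lattice_points H" for j
  proof (induction j)
    case 0
    then show ?case using start by simp
  next
    case (Suc j)
    have "real (Suc j) * a = real j * a + a" by (simp add: algebra_simps)
    with Suc.prems a(2) have "real j * a \<in> {0..d}" "real (Suc j) * a \<in> {0..d}"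
      "\<bar>real j * a - real (Suc j) * a\<bar> = a" by auto
    then show ?case using step[of "real j * a" "real (Suc j) * a"] Suc.IH a(1) by simp
  qed
  define j where "j = nat \<lfloor>t / a\<rfloor>"
  have "real j \<le> t / a" "t / a < real j + 1" using t a(2) by (auto simp: j_def)
  then have j: "real j * a \<le> t" "t < real j * a + a" using a(2) by (simp_all add: field_simps)
  have ja: "real j * a \<in> {0..d}" using j t a(2) by auto
  have "\<gamma> t \<in> lattice_points H \<longleftrightarrow> \<bar>real j * a - t\<bar> \<in> H"
    by (rule step[OF ja t]) (use j mult[of j] ja in auto)
  moreover have "real j * a \<in> H" by (rule group_multiple_closed[OF length_groupD(1,2)[OF H] a(1)])
  ultimately show ?thesis using length_group_diff_iff(3)[OF H] by simp
qed

text \<open>A geodesic from a vertex to \<open>x\<close> is a path as above, so the distance from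
  \<open>x\<close> to any given vertex is rational exactly when \<open>x\<close> is a lattice point.
  One vertex therefore decides for all of them.\<close>

lemma rational_points_eq_lattice_points:
  assumes "\<And>C. C \<in> edgeset \<Longrightarrow> len C \<in> \<rat>"
  shows "length_group \<rat>" "rational_points \<Gamma> U = lattice_points \<rat>"
proof -
  show H: "length_group \<rat>" using assms halvesD by (auto simp: length_group_def hlen_def)
  have iff: "x \<in> lattice_points \<rat> \<longleftrightarrow> dist x v \<in> \<rat>" if x: "x \<in> \<Gamma>" and v: "v \<in> U" for x v
  proof -
    have vG: "v \<in> \<Gamma>" using v U_sub by blast
    obtain \<gamma> where \<gamma>: "\<gamma> 0 = v" "\<gamma> (dist v x) = x" "\<And>t. t \<in> {0..dist v x} \<Longrightarrow> \<gamma> t \<in> \<Gamma>"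
      "\<And>s t. s \<in> {0..dist v x} \<Longrightarrow> t \<in> {0..dist v x} \<Longrightarrow> dist (\<gamma> s) (\<gamma> t) = \<bar>s - t\<bar>"
      using vG x by (rule geodesic) (rule that)
    have "\<gamma> (dist v x) \<in> lattice_points \<rat> \<longleftrightarrow> dist v x \<in> \<rat>"
    proof (rule path_lattice_points_iff[OF H])
      show "\<exists>a\<in>\<rat>. 0 < a \<and> a < \<epsilon>" if "\<epsilon> > 0" for \<epsilon> :: real
        using Rats_dense_in_real[OF that] by blast
      show "\<exists>\<eta>>0. \<forall>s\<in>{0..dist v x}. \<forall>t\<in>{0..dist v x}. dist s t < \<eta> \<longrightarrow> dist (\<gamma> s) (\<gamma> t) = \<bar>s - t\<bar>"
        using \<gamma>(4) by (intro exI[of _ 1]) simp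
      show "\<gamma> 0 \<in> lattice_points \<rat>" using \<gamma>(1) v U_lattice_points by auto
    qed (use \<gamma>(3) in auto)
    then show ?thesis using \<gamma>(2) by (simp add: dist_commute)
  qed
  obtain v where "v \<in> U" using U_ne by blast
  show "rational_points \<Gamma> U = lattice_points \<rat>"
  proof (intro subset_antisym subsetI)
    fix x assume "x \<in> rational_points \<Gamma> U"
    then show "x \<in> lattice_points \<rat>" using iff[of x v] \<open>v \<in> U\<close> by (simp add: rational_points_def)
  next
    fix x assume x: "x \<in> lattice_points \<rat>"
    then have "x \<in> \<Gamma>" by (simp add: lattice_points_def)
    then show "x \<in> rational_points \<Gamma> U" using iff[of x] x by (simp add: rational_points_def)
  qed
qed

text \<open>The multiples of \<open>l\<close> are discrete, so the path argument is run in the dense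
  groups for \<open>p = 2\<close> and \<open>p = 3\<close>. A lattice point for both has an integral
  multiple of \<open>l\<close> as its position, and no such multiple lies strictly between 0 and
  \<open>l\<close>; so it is a vertex.\<close>

lemma path_vertices_iff:
  assumes l: "\<And>C. C \<in> edgeset \<Longrightarrow> len C = l" "l > 0"
    and \<gamma>: "\<And>t. t \<in> {0..d} \<Longrightarrow> \<gamma> t \<in> \<Gamma>"
    and iso: "\<exists>\<eta>>0. \<forall>s\<in>{0..d}. \<forall>t\<in>{0..d}. dist s t < \<eta> \<longrightarrow> dist (\<gamma> s) (\<gamma> t) = \<bar>s - t\<bar>"
    and start: "\<gamma> 0 \<in> U" and t: "t \<in> {0..d}"
  shows "\<gamma> t \<in> U \<longleftrightarrow> (\<exists>m::int. t = of_int m * l)"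
proof -
  have hl: "hlen h = l" if "h \<in> halves" for h using l(1)[OF halvesD[OF that]] by (simp add: hlen_def)
  have H: "length_group (adic_multiples p l)" for p
    using adic_multiples_diff adic_multiples_self[of 1 l p] hl by (auto simp: length_group_def)
  have iff: "\<gamma> t \<in> lattice_points (adic_multiples p l) \<longleftrightarrow> t \<in> adic_multiples p l" if "p \<ge> 2" for p
    using start U_lattice_points
    by (intro path_lattice_points_iff[OF H adic_multiples_small[OF that l(2)] \<gamma> iso _ t]) auto
  show ?thesis
  proof
    assume "\<gamma> t \<in> U"
    then show "\<exists>m::int. t = of_int m * l"
      using iff[of 2] iff[of 3] U_lattice_points adic_multiples_2_3[OF _ _ l(2)] by (simp add: subset_iff)
  next
    assume "\<exists>m::int. t = of_int m * l"
    then have R: "\<gamma> t \<in> lattice_points (adic_multiples p l)" if "p \<ge> 2" for p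
      using iff[OF that] adic_multiples_self by auto
    show "\<gamma> t \<in> U"
    proof (rule ccontr)
      assume "\<gamma> t \<notin> U"
      from half_cover[OF \<gamma>[OF t] this] obtain C u where hC: "\<And>b. (C, b) \<in> halves"
        and u: "u \<in> {0<..<hlen (C, True)}" "\<gamma> t = half (C, True) u" by blast
      have "u \<in> adic_multiples p l" if "p \<ge> 2" for p
        using half_lattice_points_iff[OF H hC, of u] R[OF that] u by simp
      then obtain m :: int where m: "u = of_int m * l" using adic_multiples_2_3[OF _ _ l(2)] by fastforce
      then have "0 < real_of_int m * l" "real_of_int m * l < 1 * l" using u hl[OF hC] by auto
      then have "0 < m" "real_of_int m < 1" using l(2) by (simp_all add: zero_less_mult_iff)
      then show False by simp
    qed
  qed
qed

end

section \<open>Quotients as direct limits\<close>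

text \<open>\<open>G\<close> is the directed union of the subgroups \<open>A i\<close>, and the
  kernel of \<open>\<pi> i\<close> on \<open>A i\<close> is cut out by \<open>N\<close>, so
  \<open>x\<close> and \<open>y\<close> have the same class in the limit exactly if \<open>x\<close>
  times the inverse of \<open>y\<close> lies in \<open>N\<close>. Sending \<open>x\<close> to its
  class is a surjective homomorphism with kernel \<open>N\<close>.\<close>

lemma FactGroup_is_iso_direct_limit:
  fixes G :: "('a, 'b) monoid_scheme" and A :: "'i \<Rightarrow> 'a set" and K :: "'i \<Rightarrow> 'g monoid"
    and \<psi> :: "'i \<Rightarrow> 'i \<Rightarrow> 'g \<Rightarrow> 'g"
  assumes G: "group G" and N: "N \<subseteq> carrier G"
    and union: "carrier G = (\<Union>i\<in>I. A i)"
    and directed: "\<And>i j. i \<in> I \<Longrightarrow> j \<in> I \<Longrightarrow> \<exists>m\<in>I. ord i m \<and> ord j m"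
    and mono: "\<And>i j. i \<in> I \<Longrightarrow> j \<in> I \<Longrightarrow> ord i j \<Longrightarrow> A i \<subseteq> A j"
    and sub: "\<And>i. i \<in> I \<Longrightarrow> subgroup (A i) G"
    and K: "\<And>i. i \<in> I \<Longrightarrow> group (K i)"
    and hom: "\<And>i x y. i \<in> I \<Longrightarrow> x \<in> A i \<Longrightarrow> y \<in> A i \<Longrightarrow> \<pi> i (x \<otimes>\<^bsub>G\<^esub> y) = \<pi> i x \<otimes>\<^bsub>K i\<^esub> \<pi> i y"
    and onto: "\<And>i. i \<in> I \<Longrightarrow> carrier (K i) = \<pi> i ` A i"
    and ker: "\<And>i x. i \<in> I \<Longrightarrow> x \<in> A i \<Longrightarrow> x \<in> N \<longleftrightarrow> \<pi> i x = \<one>\<^bsub>K i\<^esub>"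
    and trans: "\<And>i j x. i \<in> I \<Longrightarrow> j \<in> I \<Longrightarrow> ord i j \<Longrightarrow> x \<in> A i \<Longrightarrow> \<psi> i j (\<pi> i x) = \<pi> j x"
  shows "G Mod N \<cong> direct_limit I ord K \<psi>"
proof -
  interpret G: group G by (rule G)
  let ?R = "limit_rel I ord K \<psi>"
  let ?L = "direct_limit I ord K \<psi>"
  have AG: "x \<in> carrier G" if "i \<in> I" "x \<in> A i" for i x
    using union that by blast
  have pi_eq_iff: "\<pi> i x = \<pi> i y \<longleftrightarrow> x \<otimes>\<^bsub>G\<^esub> inv\<^bsub>G\<^esub> y \<in> N"
    if i: "i \<in> I" "x \<in> A i" "y \<in> A i" for i x y
  proof -
    interpret Ki: group "K i" by (rule K[OF i(1)])
    interpret Ai: subgroup "A i" G by (rule sub[OF i(1)])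
    have inv: "inv\<^bsub>G\<^esub> y \<in> A i" using i by (rule_tac Ai.m_inv_closed)
    have carr: "\<pi> i z \<in> carrier (K i)" if "z \<in> A i" for z
      using onto[OF i(1)] that by blast
    have xz: "x \<otimes>\<^bsub>G\<^esub> inv\<^bsub>G\<^esub> y \<in> A i" using i inv by (simp add: Ai.m_closed)
    have "x = (x \<otimes>\<^bsub>G\<^esub> inv\<^bsub>G\<^esub> y) \<otimes>\<^bsub>G\<^esub> y"
      using AG[OF i(1)] i inv by (simp add: G.m_assoc)
    then have "\<pi> i x = \<pi> i (x \<otimes>\<^bsub>G\<^esub> inv\<^bsub>G\<^esub> y) \<otimes>\<^bsub>K i\<^esub> \<pi> i y"
      using hom[OF i(1) xz i(3)] by simp
    then have "\<pi> i x = \<pi> i y \<longleftrightarrow> \<pi> i (x \<otimes>\<^bsub>G\<^esub> inv\<^bsub>G\<^esub> y) = \<one>\<^bsub>K i\<^esub>"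
      using carr[OF xz] carr[OF i(3)] by (metis Ki.l_cancel_one' Ki.l_cancel_one Ki.r_cancel_one Ki.r_cancel_one')
    then show ?thesis using ker[OF i(1) xz] by simp
  qed
  have rel_iff: "((i, \<pi> i x), (j, \<pi> j y)) \<in> ?R \<longleftrightarrow> x \<otimes>\<^bsub>G\<^esub> inv\<^bsub>G\<^esub> y \<in> N"
    if ij: "i \<in> I" "j \<in> I" "x \<in> A i" "y \<in> A j" for i j x y
  proof -
    have eq: "\<psi> i m (\<pi> i x) = \<psi> j m (\<pi> j y) \<longleftrightarrow> x \<otimes>\<^bsub>G\<^esub> inv\<^bsub>G\<^esub> y \<in> N"
      if m: "m \<in> I" "ord i m" "ord j m" for m
      using trans ij m mono[of i m] mono[of j m] pi_eq_iff[of m x y] by (metis subsetD)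
    have "\<pi> i x \<in> carrier (K i)" "\<pi> j y \<in> carrier (K j)" using onto ij by auto
    then show ?thesis using directed[OF ij(1,2)] ij eq unfolding limit_rel_def by auto
  qed
  \<comment> \<open>The union over all indices with \<open>x\<close> in \<open>A i\<close> avoids a
    choice of index; by \<open>F_eq\<close> below, each of them already gives the whole
    class.\<close>
  define F where "F x = (\<Union>i\<in>{i\<in>I. x \<in> A i}. ?R `` {(i, \<pi> i x)})" for x
  have F_mem: "(j, \<pi> j y) \<in> F x \<longleftrightarrow> x \<otimes>\<^bsub>G\<^esub> inv\<^bsub>G\<^esub> y \<in> N"
    if "j \<in> I" "y \<in> A j" "x \<in> carrier G" for j x y
    using rel_iff that union unfolding F_def by auto
  have R_form: "\<exists>j\<in>I. \<exists>y\<in>A j. p = (j, \<pi> j y)" if "(q, p) \<in> ?R" for p q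
    using that onto unfolding limit_rel_def by fastforce
  have F_eq: "F x = ?R `` {(i, \<pi> i x)}" if "i \<in> I" "x \<in> A i" for i x
  proof (intro Set.set_eqI)
    fix p
    have "(q, p) \<in> ?R \<longleftrightarrow> (q', p) \<in> ?R" if q: "q = (j, \<pi> j x)" "q' = (j', \<pi> j' x)"
      "j \<in> I" "x \<in> A j" "j' \<in> I" "x \<in> A j'" for q q' j j'
    proof (cases "\<exists>m\<in>I. \<exists>y\<in>A m. p = (m, \<pi> m y)")
      case True
      then show ?thesis using q rel_iff by blast
    next
      case False
      then show ?thesis using R_form by blast
    qed
    then show "p \<in> F x \<longleftrightarrow> p \<in> ?R `` {(i, \<pi> i x)}"
      using that unfolding F_def by blast
  qed
  have F_self: "(i, \<pi> i x) \<in> F x" if "i \<in> I" "x \<in> A i" for i x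
  proof -
    have "x \<otimes>\<^bsub>G\<^esub> inv\<^bsub>G\<^esub> x = \<one>\<^bsub>G\<^esub>" using AG that by simp
    moreover have "\<pi> i \<one>\<^bsub>G\<^esub> = \<one>\<^bsub>K i\<^esub>"
    proof -
      interpret Ki: group "K i" by (rule K[OF that(1)])
      have one: "\<one>\<^bsub>G\<^esub> \<in> A i" using sub that by (simp add: subgroup.one_closed)
      then have "\<pi> i \<one>\<^bsub>G\<^esub> \<otimes>\<^bsub>K i\<^esub> \<pi> i \<one>\<^bsub>G\<^esub> = \<pi> i \<one>\<^bsub>G\<^esub>" using hom[OF that(1) one one] by simp
      moreover have "\<pi> i \<one>\<^bsub>G\<^esub> \<in> carrier (K i)" using onto[OF that(1)] one by auto
      ultimately show ?thesis by simp
    qed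
    ultimately show ?thesis
      using F_mem[OF that AG[OF that]] ker[OF that(1)] sub[OF that(1)] by (simp add: subgroup.one_closed)
  qed
  have one_N: "\<one>\<^bsub>G\<^esub> \<in> N" if "I \<noteq> {}"
  proof -
    obtain i where i: "i \<in> I" using \<open>I \<noteq> {}\<close> by auto
    have one: "\<one>\<^bsub>G\<^esub> \<in> A i" using sub i by (simp add: subgroup.one_closed)
    show ?thesis using F_mem[OF i one] F_self[OF i one] AG[OF i one] by simp
  qed
  have "I \<noteq> {}" using union G.one_closed by auto
  note one_N = one_N[OF this]
  have F_eq_iff: "F x = F y \<longleftrightarrow> x \<otimes>\<^bsub>G\<^esub> inv\<^bsub>G\<^esub> y \<in> N" if x: "x \<in> carrier G" and y: "y \<in> carrier G" for x y
  proof
    obtain i where i: "i \<in> I" "x \<in> A i" using x union by auto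
    obtain j where j: "j \<in> I" "y \<in> A j" using y union by auto
    obtain m where m: "m \<in> I" "ord i m" "ord j m" using directed i j by blast
    have xy: "x \<in> A m" "y \<in> A m" using mono i j m by blast+
    { assume "F x = F y"
      then show "x \<otimes>\<^bsub>G\<^esub> inv\<^bsub>G\<^esub> y \<in> N" using F_self[OF j] F_mem[OF j x] by simp }
    { assume "x \<otimes>\<^bsub>G\<^esub> inv\<^bsub>G\<^esub> y \<in> N"
      then have "\<pi> m x = \<pi> m y" using pi_eq_iff m xy by simp
      then show "F x = F y" using F_eq[OF m(1)] xy by simp }
  qed
  have carrL: "carrier ?L = F ` carrier G"
  proof -
    have "carrier ?L = (\<lambda>p. ?R `` {p}) ` (SIGMA i:I. carrier (K i))"
      by (auto simp: direct_limit_def quotient_def)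
    also have "\<dots> = F ` carrier G"
    proof (intro Set.set_eqI iffI)
      fix P assume "P \<in> (\<lambda>p. ?R `` {p}) ` (SIGMA i:I. carrier (K i))"
      then obtain i x where "i \<in> I" "x \<in> A i" "P = ?R `` {(i, \<pi> i x)}" using onto by fastforce
      then show "P \<in> F ` carrier G" using F_eq union by blast
    next
      fix P assume "P \<in> F ` carrier G"
      then obtain i x where ix: "i \<in> I" "x \<in> A i" "P = F x" using union by blast
      then have "(i, \<pi> i x) \<in> (SIGMA i:I. carrier (K i))" "P = ?R `` {(i, \<pi> i x)}"
        using onto F_eq by auto
      then show "P \<in> (\<lambda>p. ?R `` {p}) ` (SIGMA i:I. carrier (K i))" by blast
    qed
    finally show ?thesis .
  qed
  have multL: "F x \<otimes>\<^bsub>?L\<^esub> F y = F (x \<otimes>\<^bsub>G\<^esub> y)" if x: "x \<in> carrier G" and y: "y \<in> carrier G" for x y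
  proof -
    \<comment> \<open>The product in \<open>direct_limit\<close> is a union over all representatives
      and all common upper indices; every one of them gives the same class.\<close>
    have one: "?R `` {(m, \<psi> i m a \<otimes>\<^bsub>K m\<^esub> \<psi> j m b)} = F (x \<otimes>\<^bsub>G\<^esub> y)"
      if p: "(i, a) \<in> F x" "(j, b) \<in> F y" and m: "m \<in> I" "ord i m" "ord j m" for i j a b m
    proof -
      obtain x' where i: "i \<in> I" "x' \<in> A i" "a = \<pi> i x'" using p R_form[of _ "(i,a)"] unfolding F_def by auto
      obtain y' where j: "j \<in> I" "y' \<in> A j" "b = \<pi> j y'" using p R_form[of _ "(j,b)"] unfolding F_def by auto
      have Fx: "F x = F x'" using F_eq_iff[OF x] F_mem[OF i(1,2) x] AG i p by simp
      have Fy: "F y = F y'" using F_eq_iff[OF y] F_mem[OF j(1,2) y] AG j p by simp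
      obtain i0 where i0: "i0 \<in> I" "x \<in> A i0" using x union by auto
      obtain j0 where j0: "j0 \<in> I" "y \<in> A j0" using y union by auto
      obtain m0 where m0: "m0 \<in> I" "ord i0 m0" "ord j0 m0" using directed i0 j0 by blast
      \<comment> \<open>The index \<open>m\<close> bounds those of \<open>x'\<close> and
        \<open>y'\<close>, and \<open>m0\<close> bounds those of \<open>x\<close> and
        \<open>y\<close>; the comparison takes place at \<open>m1\<close>, above both.\<close>
      obtain m1 where m1: "m1 \<in> I" "ord m m1" "ord m0 m1" using directed m m0 by blast
      have A: "x \<in> A m1" "y \<in> A m1" "x' \<in> A m1" "y' \<in> A m1"
        using i j i0 j0 m0 m1 mono m by (meson subsetD)+
      have xm: "x' \<in> A m" "y' \<in> A m" using mono i j m by blast+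
      have xym: "x' \<otimes>\<^bsub>G\<^esub> y' \<in> A m" using xm sub[OF m(1)] by (simp add: subgroup.m_closed)
      have xy1: "x' \<otimes>\<^bsub>G\<^esub> y' \<in> A m1" "x \<otimes>\<^bsub>G\<^esub> y \<in> A m1" using A sub[OF m1(1)] by (simp_all add: subgroup.m_closed)
      have "\<pi> m1 x = \<pi> m1 x'" "\<pi> m1 y = \<pi> m1 y'"
        using pi_eq_iff m1 A F_eq_iff x y AG i j Fx Fy by auto
      then have "\<pi> m1 (x' \<otimes>\<^bsub>G\<^esub> y') = \<pi> m1 (x \<otimes>\<^bsub>G\<^esub> y)" using hom[OF m1(1)] A by simp
      then have "F (x' \<otimes>\<^bsub>G\<^esub> y') = F (x \<otimes>\<^bsub>G\<^esub> y)" using F_eq[OF m1(1)] xy1 by simp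
      moreover have "\<psi> i m a \<otimes>\<^bsub>K m\<^esub> \<psi> j m b = \<pi> m (x' \<otimes>\<^bsub>G\<^esub> y')"
        using trans i j m hom[OF m(1)] xm by simp
      ultimately show ?thesis using F_eq[OF m(1) xym] by simp
    qed
    obtain i0 where i0: "i0 \<in> I" "x \<in> A i0" using x union by auto
    obtain j0 where j0: "j0 \<in> I" "y \<in> A j0" using y union by auto
    obtain m0 where m0: "m0 \<in> I" "ord i0 m0" "ord j0 m0" using directed i0 j0 by blast
    have "F x \<otimes>\<^bsub>?L\<^esub> F y = (\<Union>(i, a)\<in>F x. \<Union>(j, b)\<in>F y. \<Union>m\<in>{m\<in>I. ord i m \<and> ord j m}.
        ?R `` {(m, \<psi> i m a \<otimes>\<^bsub>K m\<^esub> \<psi> j m b)})"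
      by (simp add: direct_limit_def)
    also have "\<dots> = F (x \<otimes>\<^bsub>G\<^esub> y)"
    proof (intro Set.set_eqI iffI)
      fix p assume "p \<in> (\<Union>(i, a)\<in>F x. \<Union>(j, b)\<in>F y. \<Union>m\<in>{m\<in>I. ord i m \<and> ord j m}.
        ?R `` {(m, \<psi> i m a \<otimes>\<^bsub>K m\<^esub> \<psi> j m b)})"
      then obtain i a j b m where "(i, a) \<in> F x" "(j, b) \<in> F y" "m \<in> I" "ord i m" "ord j m"
        "p \<in> ?R `` {(m, \<psi> i m a \<otimes>\<^bsub>K m\<^esub> \<psi> j m b)}" by blast
      then show "p \<in> F (x \<otimes>\<^bsub>G\<^esub> y)" using one by blast
    next
      fix p assume "p \<in> F (x \<otimes>\<^bsub>G\<^esub> y)"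
      then have "p \<in> ?R `` {(m0, \<psi> i0 m0 (\<pi> i0 x) \<otimes>\<^bsub>K m0\<^esub> \<psi> j0 m0 (\<pi> j0 y))}"
        using one[OF F_self[OF i0] F_self[OF j0] m0] by simp
      then show "p \<in> (\<Union>(i, a)\<in>F x. \<Union>(j, b)\<in>F y. \<Union>m\<in>{m\<in>I. ord i m \<and> ord j m}.
        ?R `` {(m, \<psi> i m a \<otimes>\<^bsub>K m\<^esub> \<psi> j m b)})" 
        using F_self[OF i0] F_self[OF j0] m0 by blast
    qed
    finally show ?thesis .
  qed
  have pi_one: "\<pi> i \<one>\<^bsub>G\<^esub> = \<one>\<^bsub>K i\<^esub>" if "i \<in> I" for i
    using ker[OF that] one_N sub[OF that] subgroup.one_closed by metis
  have oneL: "\<one>\<^bsub>?L\<^esub> = F \<one>\<^bsub>G\<^esub>"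
  proof -
    have "F \<one>\<^bsub>G\<^esub> = ?R `` {(i, \<one>\<^bsub>K i\<^esub>)}" if "i \<in> I" for i
      using F_eq[OF that] pi_one[OF that] sub[OF that] subgroup.one_closed by metis
    then show ?thesis using \<open>I \<noteq> {}\<close> by (auto simp: direct_limit_def)
  qed
  have Fhom: "F \<in> hom G ?L" using multL carrL by (auto simp: hom_def)
  \<comment> \<open>The limit inherits the group laws as a homomorphic image of
    \<open>G\<close>.\<close>
  have "group (?L\<lparr>carrier := F ` carrier G, one := F \<one>\<^bsub>G\<^esub>\<rparr>)"
    by (rule G.hom_imp_img_group[OF Fhom])
  then have "group ?L" using carrL oneL by (simp add: direct_limit_def)
  then interpret Fh: group_hom G ?L F
    using Fhom by (simp add: group_hom_def group_hom_axioms_def G.is_group)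
  have "kernel G ?L F = N"
    unfolding kernel_def oneL using F_eq_iff[OF _ G.one_closed] N by auto
  moreover have "(\<lambda>X. the_elem (F ` X)) \<in> iso (G Mod kernel G ?L F) ?L"
    by (rule Fh.FactGroup_iso_set) (use carrL in simp)
  ultimately show ?thesis by (auto simp: is_iso_def)
qed

section \<open>Subdivisions of a tropical curve\<close>

lemma coarsest_graph_model:
  assumes "Q_tropical_curve \<Gamma> V" "coarsest_vertices \<Gamma> V V0"
  shows "graph_model \<Gamma> V0"
proof -
  have V: "graph_model \<Gamma> V" using assms(1) by (simp add: Q_tropical_curve_def)
  show ?thesis
  proof (cases "\<exists>x\<in>\<Gamma>. \<not> has_valence \<Gamma> x 2")
    case True
    then have V0: "V0 = {x\<in>\<Gamma>. \<not> has_valence \<Gamma> x 2}" using assms(2) by (simp add: coarsest_vertices_def)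
    then have "finite V0" using V finite_subset by (auto simp: graph_model_def)
    then show ?thesis using True V0 by (auto simp: graph_model_def)
  next
    case False
    then obtain v where "v \<in> rational_points \<Gamma> V" "V0 = {v}"
      using assms(2) by (auto simp: coarsest_vertices_def)
    then show ?thesis using False by (auto simp: graph_model_def rational_points_def)
  qed
qed

lemma Q_tropical_curve_charts:
  assumes "Q_tropical_curve \<Gamma> V"
  obtains len \<phi> where "charted_model \<Gamma> V len \<phi>" "\<And>C. C \<in> components (\<Gamma> - V) \<Longrightarrow> len C \<in> \<rat>"
proof (rule exists_charted_model[of \<Gamma> V "\<lambda>l. l \<in> \<rat>"])
  show "\<exists>l. has_edge_length C l \<and> l \<in> \<rat>" if "C \<in> components (\<Gamma> - V)" for C
    using assms that unfolding Q_tropical_curve_def by blast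
qed (use assms that in \<open>auto simp: Q_tropical_curve_def\<close>)

lemma model_subset_rational_points:
  assumes "Q_tropical_curve \<Gamma> V"
  shows "V \<subseteq> rational_points \<Gamma> V"
proof -
  obtain len \<phi> where "charted_model \<Gamma> V len \<phi>" "\<And>C. C \<in> components (\<Gamma> - V) \<Longrightarrow> len C \<in> \<rat>"
    using assms by (rule Q_tropical_curve_charts) (rule that)
  then show ?thesis
    using charted_model.rational_points_eq_lattice_points(2) charted_model.U_lattice_points by metis
qed

text \<open>For a circle the base point is rational by choice; otherwise \<open>V0\<close> consists
  of points that every model contains.\<close>

lemma coarsest_rational:
  assumes "Q_tropical_curve \<Gamma> V" "coarsest_vertices \<Gamma> V V0"
  shows "V0 \<subseteq> rational_points \<Gamma> V"
proof (cases "\<exists>x\<in>\<Gamma>. \<not> has_valence \<Gamma> x 2")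
  case True
  then have "V0 \<subseteq> V" using assms by (auto simp: coarsest_vertices_def Q_tropical_curve_def graph_model_def)
  then show ?thesis using model_subset_rational_points[OF assms(1)] by blast
next
  case False
  then show ?thesis using assms(2) by (auto simp: coarsest_vertices_def)
qed

locale subdivided_curve =
  fixes \<Gamma> V V0 :: "'a::metric_space set" and c :: real and W :: "nat \<Rightarrow> 'a set"
  assumes curve: "Q_tropical_curve \<Gamma> V" and coarsest: "coarsest_vertices \<Gamma> V V0"
    and scaling: "integral_scaling \<Gamma> V0 c"
    and subdivision: "k \<ge> 1 \<Longrightarrow> subdivision_vertices \<Gamma> V0 c k (W k)"
begin

lemma metric: "metric_graph \<Gamma>"
  using curve by (simp add: Q_tropical_curve_def)

lemma c_pos: "c > 0"
  using scaling by (simp add: integral_scaling_def)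

lemma V0_subset: "k \<ge> 1 \<Longrightarrow> V0 \<subseteq> W k"
  using subdivision by (simp add: subdivision_vertices_def)

lemma subdivision_charts:
  assumes "k \<ge> 1"
  obtains len \<phi> where "charted_model \<Gamma> (W k) len \<phi>"
    "\<And>C. C \<in> components (\<Gamma> - W k) \<Longrightarrow> len C = 1 / (c * real k)"
proof (rule exists_charted_model[of \<Gamma> "W k" "\<lambda>l. l = 1 / (c * real k)"])
  show "\<exists>l. has_edge_length C l \<and> l = 1 / (c * real k)" if C: "C \<in> components (\<Gamma> - W k)" for C
  proof -
    obtain l where "has_edge_length C l" "c * l = 1 / real k"
      using subdivision[OF assms] C unfolding subdivision_vertices_def by blast
    then show ?thesis using c_pos assms by (intro exI[of _ l]) (simp add: field_simps)
  qed
qed (use metric subdivision[OF assms] that in \<open>auto simp: subdivision_vertices_def\<close>)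

text \<open>An edge of the coarsest structure is a locally isometric path starting in
  \<open>V0\<close>, hence at a rational point that is a vertex of every subdivision. The path
  lemmas, applied in the models \<open>V\<close> and \<open>W k\<close>, express both memberships of
  \<open>x\<close> through the single number \<open>t\<close>.\<close>

lemma coarsest_position:
  assumes x: "x \<in> \<Gamma>" "x \<notin> V0"
  obtains \<gamma> d t n where "\<gamma> t = x" "t \<in> {0..d}" "c * d = of_int n" "d > 0" "d \<in> \<rat>"
    "\<gamma> t \<in> rational_points \<Gamma> V \<longleftrightarrow> t \<in> \<rat>"
    "\<And>k. k \<ge> 1 \<Longrightarrow> \<gamma> t \<in> W k \<longleftrightarrow> (\<exists>m::int. t = of_int m * (1 / (c * real k)))"
proof -
  obtain len0 \<phi>0 where M0: "charted_model \<Gamma> V0 len0 \<phi>0"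
    "\<And>C. C \<in> components (\<Gamma> - V0) \<Longrightarrow> c * len0 C \<in> \<int>"
  proof (rule exists_charted_model[of \<Gamma> V0 "\<lambda>l. c * l \<in> \<int>"])
    show "\<exists>l. has_edge_length C l \<and> c * l \<in> \<int>" if "C \<in> components (\<Gamma> - V0)" for C
      using scaling that unfolding integral_scaling_def by blast
  qed (use metric coarsest_graph_model[OF curve coarsest] that in auto)
  interpret M0: charted_model \<Gamma> V0 len0 \<phi>0 by (rule M0(1))
  obtain C t where hC: "\<And>b. (C, b) \<in> M0.halves" and t: "t \<in> {0<..<M0.hlen (C, True)}"
    "x = M0.half (C, True) t" using x by (rule M0.half_cover) (rule that)
  define \<gamma> where "\<gamma> = M0.half (C, True)"
  define d where "d = M0.hlen (C, True)"
  have d: "d > 0" "t \<in> {0..d}" using M0.hlen_pos[OF hC] t by (auto simp: d_def)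
  have path: "\<gamma> s \<in> \<Gamma>" if "s \<in> {0..d}" for s
    using M0.half_in_graph[OF hC] that by (simp add: \<gamma>_def d_def)
  have iso: "\<exists>\<eta>>0. \<forall>s\<in>{0..d}. \<forall>t\<in>{0..d}. dist s t < \<eta> \<longrightarrow> dist (\<gamma> s) (\<gamma> t) = \<bar>s - t\<bar>"
    using M0.half_uniform_isometry[OF hC] by (simp add: \<gamma>_def d_def)
  have ends: "\<gamma> 0 \<in> V0" "\<gamma> d \<in> V0"
    using M0.src(1)[OF hC] M0.src(1)[of "M0.rev_half (C, True)"] hC by (simp_all add: \<gamma>_def d_def)
  have "c * d \<in> \<int>" using M0(2)[OF M0.halvesD[OF hC]] by (simp add: d_def M0.hlen_def)
  then obtain n where n: "c * d = of_int n" by (auto elim: Ints_cases)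
  have rat: "\<gamma> s \<in> rational_points \<Gamma> V \<longleftrightarrow> s \<in> \<rat>" if s: "s \<in> {0..d}" for s
  proof -
    obtain len \<phi> where M: "charted_model \<Gamma> V len \<phi>" "\<And>C. C \<in> components (\<Gamma> - V) \<Longrightarrow> len C \<in> \<rat>"
      using curve by (rule Q_tropical_curve_charts) (rule that)
    interpret M: charted_model \<Gamma> V len \<phi> by (rule M(1))
    have R: "M.length_group \<rat>" "rational_points \<Gamma> V = M.lattice_points \<rat>"
      by (rule M.rational_points_eq_lattice_points, rule M(2), assumption)+
    show ?thesis
      unfolding R(2)
    proof (rule M.path_lattice_points_iff[where \<gamma> = \<gamma> and t = s, OF R(1) _ path iso _ s])
      show "\<exists>a\<in>\<rat>. 0 < a \<and> a < \<epsilon>" if "\<epsilon> > 0" for \<epsilon> :: real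
        using Rats_dense_in_real[OF that] by blast
      show "\<gamma> 0 \<in> M.lattice_points \<rat>"
        using ends(1) coarsest_rational[OF curve coarsest] unfolding R(2) by blast
    qed
  qed
  \<comment> \<open>The path also ends at a rational point, so its length is rational.\<close>
  have dQ: "d \<in> \<rat>" using rat[of d] d ends(2) coarsest_rational[OF curve coarsest] by auto
  have W: "\<gamma> t \<in> W k \<longleftrightarrow> (\<exists>m::int. t = of_int m * (1 / (c * real k)))" if k: "k \<ge> 1" for k
  proof -
    obtain len \<phi> where M: "charted_model \<Gamma> (W k) len \<phi>"
      "\<And>C. C \<in> components (\<Gamma> - W k) \<Longrightarrow> len C = 1 / (c * real k)"
      using k by (rule subdivision_charts) (rule that)
    show ?thesis
      by (rule charted_model.path_vertices_iff[where \<gamma> = \<gamma> and t = t, OF M(1) M(2) _ path iso _ d(2)])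
        (use c_pos k ends(1) V0_subset[OF k] in auto)
  qed
  show thesis
    by (rule that[of \<gamma> t d n]) (use t d n dQ rat W in \<open>auto simp: \<gamma>_def\<close>)
qed

text \<open>The sets \<open>W k\<close> are given separately for each \<open>k\<close>, so their
  being nested has to be read off from positions: a multiple of \<open>1 / (c * real k1)\<close> is
  also a multiple of \<open>1 / (c * real k2)\<close>.\<close>

lemma subdivision_mono:
  assumes "k1 \<ge> 1" "k2 \<ge> 1" "k1 dvd k2"
  shows "W k1 \<subseteq> W k2"
proof
  fix x assume x: "x \<in> W k1"
  then have "x \<in> \<Gamma>" using subdivision[OF assms(1)] by (auto simp: subdivision_vertices_def graph_model_def)
  show "x \<in> W k2"
  proof (cases "x \<in> V0")
    case True
    then show ?thesis using V0_subset[OF assms(2)] by blast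
  next
    case False
    obtain \<gamma> t where g: "\<gamma> t = x"
      "\<And>k. k \<ge> 1 \<Longrightarrow> \<gamma> t \<in> W k \<longleftrightarrow> (\<exists>m::int. t = of_int m * (1 / (c * real k)))"
      using \<open>x \<in> \<Gamma>\<close> False by (rule coarsest_position) (rule that)
    obtain q where q: "k2 = k1 * q" using assms(3) by (elim dvdE)
    obtain m :: int where "t = of_int m * (1 / (c * real k1))" using g x assms(1) by auto
    moreover have "real q \<noteq> 0" using q assms(2) by (intro notI) simp
    ultimately have "t = of_int (m * int q) * (1 / (c * real k2))" using q by simp
    then show ?thesis using g assms(2) by blast
  qed
qed

lemma subdivision_rational:
  assumes k: "k \<ge> 1"
  shows "W k \<subseteq> rational_points \<Gamma> V"
proof
  fix x assume x: "x \<in> W k"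
  then have "x \<in> \<Gamma>" using subdivision[OF k] by (auto simp: subdivision_vertices_def graph_model_def)
  show "x \<in> rational_points \<Gamma> V"
  proof (cases "x \<in> V0")
    case True
    then show ?thesis using coarsest_rational[OF curve coarsest] by blast
  next
    case False
    obtain \<gamma> d t n where g: "\<gamma> t = x" "c * d = of_int n" "d > 0" "d \<in> \<rat>"
      "\<gamma> t \<in> rational_points \<Gamma> V \<longleftrightarrow> t \<in> \<rat>"
      "\<And>k. k \<ge> 1 \<Longrightarrow> \<gamma> t \<in> W k \<longleftrightarrow> (\<exists>m::int. t = of_int m * (1 / (c * real k)))"
      using \<open>x \<in> \<Gamma>\<close> False by (rule coarsest_position) (rule that)
    \<comment> \<open>The edge through \<open>x\<close> has rational length \<open>d\<close> and
      \<open>c * d\<close> is an integer, which makes \<open>c\<close> rational.\<close>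
    have "c = of_int n / d" using g(2,3) by (simp add: field_simps)
    then have "c \<in> \<rat>" using g(4) by simp
    moreover obtain m :: int where "t = of_int m * (1 / (c * real k))" using g(1,6) x k by auto
    ultimately have "t \<in> \<rat>" by simp
    then show ?thesis using g(1,5) by simp
  qed
qed

text \<open>If \<open>t\<close> is the position of \<open>x\<close>, then \<open>c * t\<close> is
  rational, and a denominator \<open>b\<close> of it serves as \<open>k\<close>, since
  \<open>t\<close> is a multiple of \<open>1 / (c * real b)\<close>.\<close>

lemma rational_point_in_subdivision:
  assumes x: "x \<in> rational_points \<Gamma> V"
  shows "\<exists>k\<ge>1. x \<in> W k"
proof -
  have "x \<in> \<Gamma>" using x by (simp add: rational_points_def)
  show ?thesis
  proof (cases "x \<in> V0")
    case True
    then show ?thesis using V0_subset[of 1] by auto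
  next
    case False
    obtain \<gamma> d t n where g: "\<gamma> t = x" "c * d = of_int n" "d > 0" "d \<in> \<rat>"
      "\<gamma> t \<in> rational_points \<Gamma> V \<longleftrightarrow> t \<in> \<rat>"
      "\<And>k. k \<ge> 1 \<Longrightarrow> \<gamma> t \<in> W k \<longleftrightarrow> (\<exists>m::int. t = of_int m * (1 / (c * real k)))"
      using \<open>x \<in> \<Gamma>\<close> False by (rule coarsest_position) (rule that)
    have "c = of_int n / d" using g(2,3) by (simp add: field_simps)
    then have "c * t \<in> \<rat>" using g(1,4,5) x by simp
    then obtain a :: int and b :: nat where ab: "b \<noteq> 0" "c * t = of_int a / real b"
      by (elim Rats_cases') (metis of_nat_0_less_iff not_gr0 of_int_of_nat_eq zero_less_imp_eq_int)
    have "t = of_int a * (1 / (c * real b))" using ab c_pos by (simp add: field_simps)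
    then show ?thesis using g(1) g(6)[of b] ab(1) by (intro exI[of _ b]) auto
  qed
qed

lemma finite_rational_in_subdivision:
  assumes "finite F" "F \<subseteq> rational_points \<Gamma> V"
  shows "\<exists>k\<ge>1. F \<subseteq> W k"
  using assms
proof (induction F rule: finite_induct)
  case empty
  then show ?case by auto
next
  case (insert x F)
  obtain k where k: "k \<ge> 1" "F \<subseteq> W k" using insert by auto
  obtain k' where k': "k' \<ge> 1" "x \<in> W k'" using rational_point_in_subdivision[of x] insert by auto
  have kk: "k * k' \<ge> 1" using k k' by simp
  have "W k \<subseteq> W (k * k')" "W k' \<subseteq> W (k * k')"
    using subdivision_mono[OF k(1) kk] subdivision_mono[OF k'(1) kk] by simp_all
  then show ?case using k k' kk by (intro exI[of _ "k * k'"]) auto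
qed

lemma Div0_union:
  "carrier (Div0 (rational_points \<Gamma> V)) = (\<Union>k\<in>{k. k \<ge> 1}. carrier (Div0 (W k)))"
proof (intro subset_antisym subsetI)
  fix D assume D: "D \<in> carrier (Div0 (rational_points \<Gamma> V))"
  then have "Poly_Mapping.keys D \<subseteq> rational_points \<Gamma> V" by (simp add: carrier_Div0_iff)
  from finite_rational_in_subdivision[OF finite_keys this]
  obtain k where "k \<ge> 1" "Poly_Mapping.keys D \<subseteq> W k" by blast
  then show "D \<in> (\<Union>k\<in>{k. k \<ge> 1}. carrier (Div0 (W k)))" using D by (auto simp: carrier_Div0_iff)
next
  fix D assume "D \<in> (\<Union>k\<in>{k. k \<ge> 1}. carrier (Div0 (W k)))"
  then obtain k where "k \<ge> 1" "D \<in> carrier (Div0 (W k))" by blast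
  then show "D \<in> carrier (Div0 (rational_points \<Gamma> V))" using Div0_mono[OF subdivision_rational] by blast
qed

section \<open>Comparison of the Picard group with the critical groups\<close>

context
  fixes v0 :: 'a
  assumes v0: "v0 \<in> V0"
begin

lemma sink_graph_subdivision:
  assumes k: "k \<ge> 1"
  shows "sink_graph (model_graph \<Gamma> (W k)) v0"
proof -
  obtain len \<phi> where "charted_model \<Gamma> (W k) len \<phi>"
    using k by (rule subdivision_charts) (rule that)
  then show ?thesis
    by (rule charted_model.sink_graph_mgraph) (use v0 V0_subset[OF k] in blast)
qed

lemma Prin_Q_iff_divisor_class:
  assumes k: "k \<ge> 1" and D: "D \<in> carrier (Div0 (W k))"
  shows "D \<in> Prin_Q \<Gamma> V \<longleftrightarrow>
    divisor_class (model_graph \<Gamma> (W k)) v0 D = \<one>\<^bsub>critical_group (model_graph \<Gamma> (W k)) v0\<^esub>"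
proof -
  obtain len \<phi> where M: "charted_model \<Gamma> (W k) len \<phi>"
    "\<And>C. C \<in> components (\<Gamma> - W k) \<Longrightarrow> len C = 1 / (c * real k)"
    using k by (rule subdivision_charts) (rule that)
  interpret M: charted_model \<Gamma> "W k" len \<phi> by (rule M(1))
  interpret G: sink_graph "model_graph \<Gamma> (W k)" v0 by (rule sink_graph_subdivision[OF k])
  have v: "v0 \<in> W k" using v0 V0_subset[OF k] by blast
  have vG: "verts (model_graph \<Gamma> (W k)) = W k" by (simp add: model_graph_def)
  have 0: "Poly_Mapping.lookup D x = 0" if "x \<notin> W k" for x
    using D that by (auto simp: carrier_Div0_iff in_keys_iff)
  have "D \<in> carrier (Div0 (rational_points \<Gamma> V))" using D k Div0_union by blast
  then have "D \<in> Prin_Q \<Gamma> V \<longleftrightarrow>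
      (\<exists>f. tropical_rational \<Gamma> f \<and> (\<forall>x\<in>\<Gamma>. has_ord \<Gamma> f x (Poly_Mapping.lookup D x)))"
    by (simp add: Prin_Q_def)
  also have "\<dots> \<longleftrightarrow> (\<exists>z. \<forall>w\<in>W k. Poly_Mapping.lookup D w = G.fire z w)"
    by (rule M.principal_iff_fire[OF v M(2)]) (use c_pos k 0 in auto)
  also have "\<dots> \<longleftrightarrow> divisor_class (model_graph \<Gamma> (W k)) v0 D = \<one>\<^bsub>critical_group (model_graph \<Gamma> (W k)) v0\<^esub>"
    using G.divisor_class_eq_one_iff[of D] D by (simp add: vG)
  finally show ?thesis .
qed

lemma divisor_class_eq_iff_Prin_Q:
  assumes k: "k \<ge> 1" and D: "D \<in> carrier (Div0 (W k))" "D' \<in> carrier (Div0 (W k))"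
  shows "divisor_class (model_graph \<Gamma> (W k)) v0 D = divisor_class (model_graph \<Gamma> (W k)) v0 D' \<longleftrightarrow>
    D - D' \<in> Prin_Q \<Gamma> V"
proof -
  interpret G: sink_graph "model_graph \<Gamma> (W k)" v0 by (rule sink_graph_subdivision[OF k])
  have vG: "verts (model_graph \<Gamma> (W k)) = W k" by (simp add: model_graph_def)
  have "D - D' \<in> carrier (Div0 (W k))" using D by (rule Div0_diff_closed)
  then show ?thesis
    using Prin_Q_iff_divisor_class[OF k, of "D - D'"] G.divisor_class_eq_one_iff[of "D - D'"]
      G.divisor_class_eq_iff[of D D'] D
    by (simp add: vG lookup_minus algebra_simps)
qed

text \<open>The superstable representative \<open>D'\<close> and the divisor \<open>D\<close> differ
  by an element of \<open>Prin_Q\<close>. This condition does not involve the level, so they are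
  still equivalent on \<open>W k2\<close>. The transition map is thus induced by the inclusion of
  divisors, whichever representative is taken.\<close>

lemma extension_map_divisor_class:
  assumes k: "k1 \<ge> 1" "k2 \<ge> 1" "k1 dvd k2" and D: "D \<in> carrier (Div0 (W k1))"
  shows "extension_map (model_graph \<Gamma> (W k1)) (model_graph \<Gamma> (W k2)) v0
      (divisor_class (model_graph \<Gamma> (W k1)) v0 D) = divisor_class (model_graph \<Gamma> (W k2)) v0 D"
proof -
  interpret G: sink_graph "model_graph \<Gamma> (W k1)" v0 by (rule sink_graph_subdivision[OF k(1)])
  have vG: "verts (model_graph \<Gamma> (W k1)) = W k1" by (simp add: model_graph_def)
  define D' where "D' = (THE D'. superstable (model_graph \<Gamma> (W k1)) v0 D' \<and>
    divisor_class (model_graph \<Gamma> (W k1)) v0 D' = divisor_class (model_graph \<Gamma> (W k1)) v0 D)"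
  have D': "D' \<in> carrier (Div0 (W k1))"
    "divisor_class (model_graph \<Gamma> (W k1)) v0 D' = divisor_class (model_graph \<Gamma> (W k1)) v0 D"
    using G.the_superstable[of D] D unfolding D'_def vG by auto
  then have "D' - D \<in> Prin_Q \<Gamma> V" using divisor_class_eq_iff_Prin_Q[OF k(1) _ D] by simp
  moreover have "carrier (Div0 (W k1)) \<subseteq> carrier (Div0 (W k2))"
    by (rule Div0_mono[OF subdivision_mono[OF k]])
  ultimately have "divisor_class (model_graph \<Gamma> (W k2)) v0 D' = divisor_class (model_graph \<Gamma> (W k2)) v0 D"
    using divisor_class_eq_iff_Prin_Q[OF k(2)] D D'(1) by blast
  then show ?thesis by (simp add: extension_map_def D'_def)
qed

lemma Pic_Q_iso_direct_limit:
  "Pic_Q \<Gamma> V \<cong>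
    direct_limit {k::nat. k \<ge> 1} (dvd)
      (\<lambda>k. critical_group (model_graph \<Gamma> (W k)) v0)
      (\<lambda>k1 k2. extension_map (model_graph \<Gamma> (W k1)) (model_graph \<Gamma> (W k2)) v0)"
  unfolding Pic_Q_def
proof (rule FactGroup_is_iso_direct_limit[where A = "\<lambda>k. carrier (Div0 (W k))"
      and \<pi> = "\<lambda>k. divisor_class (model_graph \<Gamma> (W k)) v0"])
  show "group (Div0 (rational_points \<Gamma> V))" by (rule group_Div0)
  show "Prin_Q \<Gamma> V \<subseteq> carrier (Div0 (rational_points \<Gamma> V))" by (auto simp: Prin_Q_def)
  show "carrier (Div0 (rational_points \<Gamma> V)) = (\<Union>k\<in>{k. 1 \<le> k}. carrier (Div0 (W k)))" by (rule Div0_union)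
next
  fix i j :: nat assume "i \<in> {k. 1 \<le> k}" "j \<in> {k. 1 \<le> k}"
  then show "\<exists>m\<in>{k. 1 \<le> k}. i dvd m \<and> j dvd m" by (intro bexI[of _ "i * j"]) auto
next
  fix i j :: nat assume "i \<in> {k. 1 \<le> k}" "j \<in> {k. 1 \<le> k}" "i dvd j"
  then show "carrier (Div0 (W i)) \<subseteq> carrier (Div0 (W j))" by (intro Div0_mono subdivision_mono) auto
next
  fix i :: nat assume i: "i \<in> {k. 1 \<le> k}"
  then show "subgroup (carrier (Div0 (W i))) (Div0 (rational_points \<Gamma> V))"
    by (intro subgroup_Div0 subdivision_rational) simp
  have vG: "verts (model_graph \<Gamma> (W i)) = W i" by (simp add: model_graph_def)
  interpret G: sink_graph "model_graph \<Gamma> (W i)" v0 using sink_graph_subdivision i by simp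
  show "group (critical_group (model_graph \<Gamma> (W i)) v0)" by (rule G.group_critical_group)
  show "carrier (critical_group (model_graph \<Gamma> (W i)) v0) =
      divisor_class (model_graph \<Gamma> (W i)) v0 ` carrier (Div0 (W i))"
    using G.carrier_critical_group by (simp add: vG)
  show "divisor_class (model_graph \<Gamma> (W i)) v0 (x \<otimes>\<^bsub>Div0 (rational_points \<Gamma> V)\<^esub> y) =
      divisor_class (model_graph \<Gamma> (W i)) v0 x \<otimes>\<^bsub>critical_group (model_graph \<Gamma> (W i)) v0\<^esub>
      divisor_class (model_graph \<Gamma> (W i)) v0 y"
    if "x \<in> carrier (Div0 (W i))" "y \<in> carrier (Div0 (W i))" for x y
    using G.divisor_class_add[of x y] that by (simp add: vG)
  show "x \<in> Prin_Q \<Gamma> V \<longleftrightarrow>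
      divisor_class (model_graph \<Gamma> (W i)) v0 x = \<one>\<^bsub>critical_group (model_graph \<Gamma> (W i)) v0\<^esub>"
    if "x \<in> carrier (Div0 (W i))" for x
    using Prin_Q_iff_divisor_class that i by simp
next
  fix i j :: nat and x assume "i \<in> {k. 1 \<le> k}" "j \<in> {k. 1 \<le> k}" "i dvd j" "x \<in> carrier (Div0 (W i))"
  then show "extension_map (model_graph \<Gamma> (W i)) (model_graph \<Gamma> (W j)) v0
      (divisor_class (model_graph \<Gamma> (W i)) v0 x) = divisor_class (model_graph \<Gamma> (W j)) v0 x"
    by (intro extension_map_divisor_class) auto
qed

end

end

theorem theorem49:
  fixes \<Gamma> V V0 :: "'a::metric_space set" and v0 :: 'a and c :: real and W :: "nat \<Rightarrow> 'a set"
  assumes "Q_tropical_curve \<Gamma> V"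
    and "coarsest_vertices \<Gamma> V V0" and "v0 \<in> V0"
    and "integral_scaling \<Gamma> V0 c"
    and "\<And>k. k \<ge> 1 \<Longrightarrow> subdivision_vertices \<Gamma> V0 c k (W k)"
  shows "Pic_Q \<Gamma> V \<cong>
    direct_limit {k::nat. k \<ge> 1} (dvd)
      (\<lambda>k. critical_group (model_graph \<Gamma> (W k)) v0)
      (\<lambda>k1 k2. extension_map (model_graph \<Gamma> (W k1)) (model_graph \<Gamma> (W k2)) v0)"
proof -
  interpret subdivided_curve \<Gamma> V V0 c W
    by unfold_locales (use assms in auto)
  show ?thesis by (rule Pic_Q_iso_direct_limit[OF assms(3)])
qed

end
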